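(* Let $\mathcal{V}$ be an affine subspace of $\mathrm{M}_n(\mathbb{R})$ included in $\mathrm{GL}_n(\mathbb{R})$ with dimension $\binom{n}{2}$. Then there is a unique list $(n_1,\dots,n_p)$ of positive integers such that $n=n_1+\cdots+n_p$ and $$\mathcal{V}\sim I_n+\bigl(\mathrm{A}_{n_1}(\mathbb{R})\vee\cdots\vee \mathrm{A}_{n_p}(\mathbb{R})\bigr).$$
   Context: $\mathrm{M}_n(\mathbb{R})$ is the algebra of real $n\times n$ matrices, $I_n$ is the identity matrix, and $\mathrm{A}_n(\mathbb{R})$ is the space of skew-symmetric real $n\times n$ matrices. An affine subspace of $\mathrm{M}_n(\mathbb{R})$ is a translate of a linear subspace. Two affine subspaces $\mathcal{V},\mathcal{W}$ of $\mathrm{M}_n(\mathbb{R})$ are equivalent, written $\mathcal{V}\sim\mathcal{W}$, if $\mathcal{W}=R\mathcal{V}S$ for some $(R,S)\in\mathrm{GL}_n(\mathbb{R})^2$. For subsets $V\subset \mathrm{M}_n(\mathbb{R})$ and $W\subset \mathrm{M}_p(\mathbb{R})$, $V\vee W:=\left\{\begin{bmatrix}A&B\\0&C\end{bmatrix} \mid A\in V,\ B\in \mathrm{M}_{n,p}(\mathbb{R}),\ C\in W\right\}\subset \mathrm{M}_{n+p}(\mathbb{R})$, where $\mathrm{M}_{n,p}(\mathbb{R})$ is the space of $n\times p$ matrices; the operation $\vee$ is associative. *)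

theory Defs
  imports "Jordan_Normal_Form.VS_Connect"
begin

definition GL :: "nat \<Rightarrow> real mat set" where
  "GL n = {A \<in> carrier_mat n n. invertible_mat A}"

definition skew_mats :: "nat \<Rightarrow> real mat set" where
  "skew_mats n = {A \<in> carrier_mat n n. transpose_mat A = - A}"

definition translate_mat :: "real mat \<Rightarrow> real mat set \<Rightarrow> real mat set" where
  "translate_mat P W = {P + M |M. M \<in> W}"

definition affine_subspace_mat :: "nat \<Rightarrow> real mat set \<Rightarrow> bool" where
  "affine_subspace_mat n V \<longleftrightarrow>
     (\<exists>P W. P \<in> carrier_mat n n \<and>
            VectorSpace.subspace class_ring W (module_mat TYPE(real) n n) \<and>
            V = translate_mat P W)"

definition direction_mat :: "real mat set \<Rightarrow> real mat set" where
  "direction_mat V = {A - B |A B. A \<in> V \<and> B \<in> V}"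

definition affine_dim_mat :: "nat \<Rightarrow> real mat set \<Rightarrow> nat" where
  "affine_dim_mat n V =
     vectorspace.dim class_ring ((module_mat TYPE(real) n n)\<lparr>carrier := direction_mat V\<rparr>)"

definition equiv_mats :: "nat \<Rightarrow> real mat set \<Rightarrow> real mat set \<Rightarrow> bool" where
  "equiv_mats n V W \<longleftrightarrow> (\<exists>R \<in> GL n. \<exists>S \<in> GL n. W = {R * M * S |M. M \<in> V})"

definition join_mats :: "nat \<Rightarrow> nat \<Rightarrow> real mat set \<Rightarrow> real mat set \<Rightarrow> real mat set" where
  "join_mats n p V W =
     {four_block_mat A B (0\<^sub>m p n) C |A B C. A \<in> V \<and> B \<in> carrier_mat n p \<and> C \<in> W}"

text \<open>The join of the spaces of skew-symmetric matrices of sizes \<open>n\<^sub>1, \<dots>, n\<^sub>p\<close>, bracketed to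
  the right. The empty join consists of the \<open>0 \<times> 0\<close> matrix, which is neutral for the join.\<close>

fun skew_join :: "nat list \<Rightarrow> real mat set" where
  "skew_join [] = carrier_mat 0 0"
| "skew_join (m # ms) = join_mats m (sum_list ms) (skew_mats m) (skew_join ms)"

lemma skew_join_singleton: "skew_join [m] = skew_mats m"
proof -
  have *: "four_block_mat A B (0\<^sub>m 0 m) C = A"
    if "A \<in> carrier_mat m m" "B \<in> carrier_mat m 0" "C \<in> carrier_mat 0 0" for A B C :: "real mat"
    using that by (intro eq_matI) auto
  have "A \<in> skew_join [m]" if "A \<in> skew_mats m" for A
  proof -
    have "four_block_mat A (0\<^sub>m m 0) (0\<^sub>m 0 m) (0\<^sub>m 0 0) = A"
      using that by (intro *) (auto simp: skew_mats_def)
    moreover have "0\<^sub>m 0 0 \<in> skew_join []" "0\<^sub>m m 0 \<in> carrier_mat m (sum_list [])" by simp_all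
    ultimately show ?thesis using that
      unfolding skew_join.simps(2) join_mats_def sum_list.Nil mem_Collect_eq by metis
  qed
  moreover have "A \<in> skew_mats m" if "A \<in> skew_join [m]" for A
    using that * unfolding skew_join.simps join_mats_def skew_mats_def by auto
  ultimately show ?thesis by blast
qed

lemma skew_join_carrier: "skew_join ns \<subseteq> carrier_mat (sum_list ns) (sum_list ns)"
proof (induction ns)
  case (Cons m ms)
  then show ?case
    by (auto simp: join_mats_def skew_mats_def intro!: four_block_carrier_mat)
qed auto

lemma join_mats_assoc:
  assumes "U \<subseteq> carrier_mat a a" "V \<subseteq> carrier_mat b b" "W \<subseteq> carrier_mat c c"
  shows "join_mats (a + b) c (join_mats a b U V) W = join_mats a (b + c) U (join_mats b c V W)"
    (is "?L = ?R")
proof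
  show "?L \<subseteq> ?R"
  proof
    fix X assume "X \<in> ?L"
    then obtain A B C D E where X: "X = four_block_mat (four_block_mat A B (0\<^sub>m b a) C) D (0\<^sub>m c (a + b)) E"
      and m: "A \<in> U" "B \<in> carrier_mat a b" "C \<in> V" "D \<in> carrier_mat (a + b) c" "E \<in> W"
      unfolding join_mats_def by blast
    define D1 where "D1 = mat a c (\<lambda>(i,j). D $$ (i,j))"
    define D2 where "D2 = mat b c (\<lambda>(i,j). D $$ (i + a,j))"
    define B' where "B' = mat a (b + c) (\<lambda>(i,j). if j < b then B $$ (i,j) else D1 $$ (i,j - b))"
    have car: "A \<in> carrier_mat a a" "C \<in> carrier_mat b b" "E \<in> carrier_mat c c"
      using assms m by auto
    have D2: "D2 \<in> carrier_mat b c" by (simp add: D2_def)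
    have "X = four_block_mat A B' (0\<^sub>m (b + c) a) (four_block_mat C D2 (0\<^sub>m c b) E)"
      using car m(2,4) unfolding X
      by (intro eq_matI) (auto simp: B'_def D1_def D2_def)
    moreover have "four_block_mat C D2 (0\<^sub>m c b) E \<in> join_mats b c V W"
      using m(3,5) D2 unfolding join_mats_def by blast
    moreover have "B' \<in> carrier_mat a (b + c)" by (simp add: B'_def)
    ultimately show "X \<in> ?R" using m(1) unfolding join_mats_def[of a "b + c"] by blast
  qed
  show "?R \<subseteq> ?L"
  proof
    fix X assume "X \<in> ?R"
    then obtain A B C D E where X: "X = four_block_mat A B (0\<^sub>m (b + c) a) (four_block_mat C D (0\<^sub>m c b) E)"
      and m: "A \<in> U" "B \<in> carrier_mat a (b + c)" "C \<in> V" "D \<in> carrier_mat b c" "E \<in> W"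
      unfolding join_mats_def by blast
    define B1 where "B1 = mat a b (\<lambda>(i,j). B $$ (i,j))"
    define D' where "D' = mat (a + b) c (\<lambda>(i,j). if i < a then B $$ (i,j + b) else D $$ (i - a,j))"
    have car: "A \<in> carrier_mat a a" "C \<in> carrier_mat b b" "E \<in> carrier_mat c c"
      using assms m by auto
    have B1: "B1 \<in> carrier_mat a b" by (simp add: B1_def)
    have "X = four_block_mat (four_block_mat A B1 (0\<^sub>m b a) C) D' (0\<^sub>m c (a + b)) E"
      using car m(2,4) unfolding X
      by (intro eq_matI) (auto simp: B1_def D'_def)
    moreover have "four_block_mat A B1 (0\<^sub>m b a) C \<in> join_mats a b U V"
      using m(1,3) B1 unfolding join_mats_def by blast
    moreover have "D' \<in> carrier_mat (a + b) c" by (simp add: D'_def)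
    ultimately show "X \<in> ?L" using m(5) unfolding join_mats_def[of "a + b" c] by blast
  qed
qed

lemma direction_translate_mat:
  assumes P: "P \<in> carrier_mat n n"
    and W: "VectorSpace.subspace class_ring W (module_mat TYPE(real) n n)"
  shows "direction_mat (translate_mat P W) = W"
proof -
  interpret vectorspace class_ring "module_mat TYPE(real) n n" by (rule matrix_vs)
  have sub: "submodule class_ring W (module_mat TYPE(real) n n)"
    using W by (rule VectorSpace.subspace.submod)
  have c: "W \<subseteq> carrier_mat n n" and z: "0\<^sub>m n n \<in> W"
    and add: "\<And>A B. A \<in> W \<Longrightarrow> B \<in> W \<Longrightarrow> A + B \<in> W"
    and sm: "\<And>r A. A \<in> W \<Longrightarrow> r \<cdot>\<^sub>m A \<in> W"
    using sub unfolding submodule_def by (auto simp: module_mat_simps class_ring_simps)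
  have diff: "(P + A) - (P + B) = A + (-1) \<cdot>\<^sub>m B" if "A \<in> W" "B \<in> W" for A B
  proof -
    have "A \<in> carrier_mat n n" "B \<in> carrier_mat n n" using that c by auto
    then show ?thesis using P by (intro eq_matI) auto
  qed
  have "direction_mat (translate_mat P W) = {A + (-1) \<cdot>\<^sub>m B |A B. A \<in> W \<and> B \<in> W}"
    
  proof -
    have "direction_mat (translate_mat P W) = {(P + A) - (P + B) |A B. A \<in> W \<and> B \<in> W}"
      unfolding direction_mat_def translate_mat_def by blast
    also have "\<dots> = {A + (-1) \<cdot>\<^sub>m B |A B. A \<in> W \<and> B \<in> W}"
      by (intro Collect_cong) (use diff in metis)
    finally show ?thesis .
  qed
  also have "\<dots> = W"
  proof
    show "{A + (-1) \<cdot>\<^sub>m B |A B. A \<in> W \<and> B \<in> W} \<subseteq> W" using add sm by blast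
    show "W \<subseteq> {A + (-1) \<cdot>\<^sub>m B |A B. A \<in> W \<and> B \<in> W}"
    proof
      fix A assume A: "A \<in> W"
      have "A = A + (-1) \<cdot>\<^sub>m (0\<^sub>m n n)" using A c by (intro eq_matI) auto
      then show "A \<in> {A + (-1) \<cdot>\<^sub>m B |A B. A \<in> W \<and> B \<in> W}" using A z by blast
    qed
  qed
  finally show ?thesis .
qed

end

theory Submission
  imports Defs "HOL-Library.Function_Algebras"
begin

text \<open>
  Multiplying by the inverse of an element of \<open>V\<close> turns \<open>V\<close> into \<open>I + W\<close> for a linear space \<open>W\<close> of
  operators on \<open>E = \<real>\<^sup>n\<close> none of which has a nonzero fixed vector; we call this a trivial spectrum.

  A vector \<open>x \<noteq> 0\<close> is adapted if \<open>W\<close> contains no rank one operator with image \<open>\<real> x\<close>. Adapted vectors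
  exist, \<open>W x\<close> has dimension at most \<open>n - 1\<close>, and the stabiliser \<open>W\<^sub>x = {M \<in> W. M x = 0}\<close> acts faithfully
  and with trivial spectrum on \<open>E / \<real> x\<close>; so \<open>dim W \<le> n choose 2\<close> by induction. If equality holds, then
  \<open>W x\<close> is a hyperplane \<open>H\<close> with \<open>x \<notin> H\<close>, every element of \<open>W\<^sub>x\<close> has its image in \<open>H\<close>, and \<open>W\<^sub>x\<close> is a
  trivial spectrum space of maximal dimension on \<open>H\<close>. By induction one of two things happens. Either
  \<open>W\<^sub>x\<close> leaves a proper nonzero subspace of \<open>H\<close> invariant, and then so does \<open>W\<close>; or \<open>W\<^sub>x\<close> consists of
  the operators that are skew for a definite bilinear form on \<open>H\<close>, and then either \<open>W\<close> leaves \<open>H\<close>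
  invariant or the form extends to a definite form on \<open>E\<close> for which \<open>W\<close> consists of the skew
  operators. In the reducible cases counting dimensions shows that \<open>W\<close> is the full join of the spaces
  that it induces on the invariant subspace and on the quotient, both of maximal dimension.

  For uniqueness, the set of dimensions of \<open>W x\<close> with \<open>x \<noteq> 0\<close> is invariant under equivalence, and for the
  join of sizes \<open>n\<^sub>1, \<dots>, n\<^sub>p\<close> it consists of the numbers \<open>n\<^sub>1 + \<dots> + n\<^sub>k - 1\<close>.
\<close>

text \<open>Everything takes place in one ambient real vector space. A finite-dimensional space is
  the range of a projector \<open>P\<close>, and an operator on it is a function unchanged by
  composition with \<open>P\<close> on either side. Subspaces, and quotients represented by
  complements, are then ranges of smaller projectors of the same type, so an induction on the
  dimension never changes the type. Since functions form a real vector space, spaces of operators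
  and spaces of vectors share one notion of dimension. Two identities govern the equality cases:
  C(n,2) = (n-1) + C(n-1,2), for the values at an adapted vector and its stabiliser, and C(a+b,2) =
  C(a,2) + C(b,2) + ab, for an invariant subspace, where ab counts the maps from the quotient to the
  subspace. The definite form obtained by extension from the hyperplane need not be symmetric. This
  is harmless because an equivalence multiplies by independent matrices on the two sides: columns
  are taken in a basis that is orthonormal for the symmetric part, rows with the functionals that
  the form itself attaches to that basis.\<close>

instantiation "fun" :: (type, real_vector) real_vector
begin
definition scaleR_fun :: "real \<Rightarrow> ('a \<Rightarrow> 'b) \<Rightarrow> 'a \<Rightarrow> 'b"
  where "scaleR_fun c f = (\<lambda>x. c *\<^sub>R f x)"
instance
  by standard (simp_all add: scaleR_fun_def fun_eq_iff algebra_simps)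
end

lemma scaleR_fun_apply [simp]: "(c *\<^sub>R f) x = c *\<^sub>R f x"
  by (simp add: scaleR_fun_def)

lemma sum_fun_apply: "(\<Sum>i\<in>I. f i) x = (\<Sum>i\<in>I. f i x)"
  by (induction I rule: infinite_finite_induct) auto

section \<open>Finite-dimensional subspaces\<close>

text \<open>The library's own predicate for real vector spaces is hidden by the vector space theory for
  matrices, hence the definition from scratch.\<close>

definition lin_subspace :: "'a::real_vector set \<Rightarrow> bool" where
  "lin_subspace S \<longleftrightarrow>
     0 \<in> S \<and> (\<forall>x\<in>S. \<forall>y\<in>S. x + y \<in> S) \<and> (\<forall>c. \<forall>x\<in>S. c *\<^sub>R x \<in> S)"

text \<open>The value of \<open>dim\<close> is the cardinality of a basis, hence 0 on an
  infinite-dimensional space. This predicate therefore accompanies the dimension counts.\<close>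

definition fds :: "'a::real_vector set \<Rightarrow> bool" where
  "fds S \<longleftrightarrow> (\<exists>B. finite B \<and> span B = S)"

lemma lin_subspace_iff: "lin_subspace S \<longleftrightarrow> span S = S"
  unfolding lin_subspace_def span_eq_iff real_vector.subspace_def ..

lemma lin_subspaceI:
  assumes "0 \<in> S" "\<And>x y. x \<in> S \<Longrightarrow> y \<in> S \<Longrightarrow> x + y \<in> S" "\<And>c x. x \<in> S \<Longrightarrow> c *\<^sub>R x \<in> S"
  shows "lin_subspace S"
  using assms unfolding lin_subspace_def by blast

lemma lin_subspace_0: "lin_subspace S \<Longrightarrow> 0 \<in> S"
  and lin_subspace_add: "lin_subspace S \<Longrightarrow> x \<in> S \<Longrightarrow> y \<in> S \<Longrightarrow> x + y \<in> S"
  and lin_subspace_scale: "lin_subspace S \<Longrightarrow> x \<in> S \<Longrightarrow> c *\<^sub>R x \<in> S"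
  unfolding lin_subspace_def by blast+

lemma lin_subspace_diff: "lin_subspace S \<Longrightarrow> x \<in> S \<Longrightarrow> y \<in> S \<Longrightarrow> x - y \<in> S"
  by (metis lin_subspace_iff span_diff)

lemma lin_subspace_sum: "lin_subspace S \<Longrightarrow> (\<And>i. i \<in> I \<Longrightarrow> f i \<in> S) \<Longrightarrow> sum f I \<in> S"
  by (metis lin_subspace_iff span_sum)

lemma fds_lin_subspace: "fds S \<Longrightarrow> lin_subspace S"
  unfolding fds_def lin_subspace_iff by auto

lemma lin_subspace_image: "linear f \<Longrightarrow> lin_subspace S \<Longrightarrow> lin_subspace (f ` S)"
  by (metis lin_subspace_iff real_vector.linear_span_image)

lemma lin_subspace_kernel: "linear f \<Longrightarrow> lin_subspace S \<Longrightarrow> lin_subspace {x \<in> S. f x = 0}"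
  by (rule lin_subspaceI) (auto simp: lin_subspace_def linear_0 linear_add linear_scale)

lemma fds_basis:
  assumes "fds S"
  obtains B where "finite B" "independent B" "span B = S" "card B = dim S"
proof -
  obtain F where F: "finite F" "span F = S" using assms unfolding fds_def by blast
  obtain B where B: "B \<subseteq> S" "independent B" "S \<subseteq> span B" "card B = dim S"
    using basis_exists by blast
  have "finite B" using real_vector.independent_span_bound[OF F(1) B(2)] B(1) F(2) by blast
  moreover have "span B = S"
    using B(1,3) fds_lin_subspace[OF assms] span_mono[of B S] unfolding lin_subspace_iff by blast
  ultimately show ?thesis using that B by blast
qed

lemma fds_subset:
  assumes "fds S" "lin_subspace T" "T \<subseteq> S"
  shows "fds T" "dim T \<le> dim S"
proof -
  obtain F where F: "finite F" "span F = S" "card F = dim S" using assms(1) fds_basis by metis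
  obtain B where B: "B \<subseteq> T" "independent B" "T \<subseteq> span B" "card B = dim T"
    using basis_exists by blast
  have *: "finite B \<and> card B \<le> card F"
    using real_vector.independent_span_bound[OF F(1) B(2)] B(1) F(2) assms(3) by blast
  have "span B = T"
    using B(1,3) assms(2) span_mono[of B T] unfolding lin_subspace_iff by blast
  then show "fds T" "dim T \<le> dim S" using * B(4) F(3) unfolding fds_def by auto
qed

lemma fds_dim_eq:
  assumes "fds S" "lin_subspace T" "T \<subseteq> S" "dim S \<le> dim T"
  shows "T = S"
proof (rule ccontr)
  assume "T \<noteq> S"
  then obtain x where x: "x \<in> S" "x \<notin> T" using assms(3) by blast
  obtain F where F: "finite F" "span F = S" "card F = dim S" using assms(1) fds_basis by metis
  obtain B where B: "finite B" "independent B" "span B = T" "card B = dim T"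
    using fds_basis fds_subset(1)[OF assms(1-3)] by metis
  have "independent (insert x B)" using B x by (simp add: real_vector.independent_insertI)
  moreover have "insert x B \<subseteq> span F" using x F B(3) assms(3) span_superset by blast
  ultimately have "card (insert x B) \<le> card F"
    using real_vector.independent_span_bound[OF F(1)] by blast
  moreover have "x \<notin> B" using x B(3) span_superset by blast
  ultimately show False using B F assms(4) by simp
qed

lemma fds_span: "finite B \<Longrightarrow> fds (span B)"
  unfolding fds_def by blast

lemma fds_zero: "fds {0}" "dim {0::'a::real_vector} = 0"
proof -
  show "fds {0}" using fds_span[of "{}"] by simp
  show "dim {0::'a} = 0"
    by (metis card.empty real_vector.dim_span_eq_card_independent real_vector.independent_empty
        real_vector.span_empty)
qed

lemma dim_zero_iff: "fds S \<Longrightarrow> dim S = 0 \<longleftrightarrow> S = {0}"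
  by (metis card_0_eq fds_basis fds_zero(2) real_vector.span_empty)

text \<open>By independence some linear map is the identity on \<open>A\<close> and zero on
  \<open>C\<close>; it sends \<open>x\<close> both to \<open>x\<close> and to 0.\<close>

lemma independent_span_disjoint:
  assumes "independent (A \<union> C)" "A \<inter> C = {}" "x \<in> span A" "x \<in> span C"
  shows "x = 0"
proof -
  obtain p :: "'a \<Rightarrow> 'a" where p: "linear p" "\<And>b. b \<in> A \<union> C \<Longrightarrow> p b = (if b \<in> A then b else 0)"
    using real_vector.linear_independent_extend[OF assms(1), of "\<lambda>b. if b \<in> A then b else 0"] by blast
  have "p x = id x"
    by (rule real_vector.linear_eq_on[OF p(1) _ assms(3)])
       (use p(2) in \<open>auto intro: linearI\<close>)
  moreover have "p x = (\<lambda>_. 0) x"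
    by (rule real_vector.linear_eq_on[OF p(1) _ assms(4)])
       (use p(2) assms(2) in \<open>auto intro: linearI\<close>)
  ultimately show ?thesis by simp
qed

text \<open>Finite dimension of \<open>S\<close> is a conclusion, drawn from the image and the
  kernel, because spaces of operators are not known to be finite-dimensional in advance. A basis of
  the kernel is extended to one of \<open>S\<close>, and the added vectors \<open>C\<close> are
  mapped injectively to a basis of the image.\<close>

lemma rank_nullity_gen:
  assumes f: "linear f" and S: "lin_subspace S"
    and im: "fds (f ` S)" and ker: "fds {x \<in> S. f x = 0}"
  shows "fds S" "dim S = dim (f ` S) + dim {x \<in> S. f x = 0}"
proof -
  obtain A where A: "finite A" "independent A" "span A = {x \<in> S. f x = 0}"
      "card A = dim {x \<in> S. f x = 0}"
    using fds_basis[OF ker] by metis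
  have "A \<subseteq> S" using A(3) span_superset[of A] by blast
  then obtain B where B: "A \<subseteq> B" "B \<subseteq> S" "independent B" "S \<subseteq> span B"
    using real_vector.maximal_independent_subset_extend[OF _ A(2)] by metis
  have SB: "span B = S" using B(2,4) S span_mono[of B S] unfolding lin_subspace_iff by blast
  define C where "C = B - A"
  have BAC: "B = A \<union> C" "A \<inter> C = {}" using B(1) unfolding C_def by auto
  have indC: "independent C" using B(3) BAC(1) real_vector.independent_mono by blast
  have ker0: "x = 0" if "x \<in> span C" "f x = 0" for x
  proof -
    have "x \<in> span A" using that A(3) SB BAC(1) span_mono[of C B] by auto
    then show ?thesis using independent_span_disjoint[of A C x] that B(3) BAC by auto
  qed
  have inj: "inj_on f (span C)"
  proof (rule inj_onI)
    fix x y assume xy: "x \<in> span C" "y \<in> span C" "f x = f y"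
    then have "f (x - y) = 0" by (simp add: linear_diff[OF f])
    then show "x = y" using ker0[of "x - y"] span_diff[OF xy(1,2)] by simp
  qed
  have "f ` A \<subseteq> {0}" using A(3) span_superset[of A] by blast
  then have "span (f ` A \<union> f ` C) = span (f ` C)"
    by (metis Un_commute Un_insert_right real_vector.span_insert_0 subset_singletonD sup_bot_right)
  then have "span (f ` C) = f ` S"
    by (simp add: SB[symmetric] real_vector.linear_span_image[OF f, symmetric] BAC(1) image_Un)
  moreover have "independent (f ` C)"
    by (rule real_vector.linear_independent_injective_image[OF f indC inj])
  ultimately have dimf: "dim (f ` S) = card (f ` C)"
    by (metis real_vector.dim_span_eq_card_independent)
  obtain F where F: "finite F" "span F = f ` S" using im unfolding fds_def by blast
  have "f ` C \<subseteq> span F" using F(2) B(2) BAC(1) by blast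
  then have "finite (f ` C)"
    using real_vector.independent_span_bound[OF F(1) \<open>independent (f ` C)\<close>] by blast
  moreover have injC: "inj_on f C" using inj span_superset[of C] inj_on_subset by blast
  ultimately have finC: "finite C" using finite_imageD by blast
  show "fds S" using SB finC A(1) BAC(1) unfolding fds_def by blast
  have "dim S = card B" using SB B(3) real_vector.dim_span_eq_card_independent by metis
  then show "dim S = dim (f ` S) + dim {x \<in> S. f x = 0}"
    using dimf card_image[OF injC] A BAC finC by (simp add: card_Un_disjoint)
qed

lemma fds_image:
  assumes "linear f" "fds S"
  shows "fds (f ` S)"
  using assms unfolding fds_def by (metis finite_imageI real_vector.linear_span_image)

lemma rank_nullity:
  assumes "linear f" "fds S"
  shows "dim S = dim (f ` S) + dim {x \<in> S. f x = 0}"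
  using assms fds_image fds_subset(1)[OF assms(2), of "{x \<in> S. f x = 0}"]
  by (intro rank_nullity_gen(2)) (auto simp: lin_subspace_kernel fds_lin_subspace)

lemma dim_image_inj:
  assumes "linear f" "fds S" "\<And>x. x \<in> S \<Longrightarrow> f x = 0 \<Longrightarrow> x = 0"
  shows "dim (f ` S) = dim S"
proof -
  have "{x \<in> S. f x = 0} = {0}"
    using assms lin_subspace_0[OF fds_lin_subspace[OF assms(2)]] linear_0[OF assms(1)] by auto
  then show ?thesis using rank_nullity[OF assms(1,2)] fds_zero by simp
qed

lemma image_eq_if_inj:
  assumes "linear f" "fds S" "f ` S \<subseteq> S" "\<And>x. x \<in> S \<Longrightarrow> f x = 0 \<Longrightarrow> x = 0"
  shows "f ` S = S"
  using assms by (intro fds_dim_eq) (auto simp: dim_image_inj lin_subspace_image fds_lin_subspace)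

lemma dim_line: "x \<noteq> 0 \<Longrightarrow> dim (range (\<lambda>c. c *\<^sub>R x)) = 1" and fds_line: "fds (range (\<lambda>c. c *\<^sub>R x))"
  using real_vector.dim_span_eq_card_independent[of "{x}"] fds_span[of "{x}"]
  by (simp_all add: real_vector.span_singleton)

lemma dim_functional_kernel:
  fixes f :: "'a::real_vector \<Rightarrow> real"
  assumes "linear f" "fds S" "z \<in> S" "f z \<noteq> 0"
  shows "dim S = Suc (dim {x \<in> S. f x = 0})"
proof -
  have "f ` S = range (\<lambda>c. c *\<^sub>R (1::real))"
  proof
    show "range (\<lambda>c. c *\<^sub>R (1::real)) \<subseteq> f ` S"
    proof
      fix c :: real assume "c \<in> range (\<lambda>c. c *\<^sub>R (1::real))"
      have "(c / f z) *\<^sub>R z \<in> S" using assms fds_lin_subspace lin_subspace_scale by blast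
      moreover have "f ((c / f z) *\<^sub>R z) = c" using assms by (simp add: linear_scale)
      ultimately show "c \<in> f ` S" by force
    qed
  qed auto
  then have "dim (f ` S) = 1" using dim_line[of "1::real"] by simp
  then show ?thesis using rank_nullity[OF assms(1,2)] by simp
qed

text \<open>If \<open>s0\<close> is an eigenvalue, then \<open>T - s0\<close> maps \<open>S\<close>
  onto a smaller invariant subspace. That subspace contains the eigenvectors for every other
  eigenvalue \<open>s\<close>, since \<open>T - s0\<close> multiplies them by
  \<open>s - s0\<close>.\<close>

lemma finite_eigenvalues:
  fixes T :: "'a::real_vector \<Rightarrow> 'a"
  assumes "linear T" "fds S" "T ` S \<subseteq> S"
  shows "finite {s. \<exists>v\<in>S. v \<noteq> 0 \<and> T v = s *\<^sub>R v}"
  using assms(2,3)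
proof (induction "dim S" arbitrary: S rule: less_induct)
  case less
  let ?E = "\<lambda>S. {s. \<exists>v\<in>S. v \<noteq> 0 \<and> T v = s *\<^sub>R v}"
  show ?case
  proof (cases "?E S = {}")
    case False
    then obtain s0 v0 where s0: "v0 \<in> S" "v0 \<noteq> 0" "T v0 = s0 *\<^sub>R v0" by blast
    define f where "f x = T x - s0 *\<^sub>R x" for x
    have f: "linear f" unfolding f_def
      by (rule linearI) (simp_all add: linear_add[OF assms(1)] linear_scale[OF assms(1)] algebra_simps)
    have sS: "lin_subspace S" using less fds_lin_subspace by blast
    have fdsf: "fds (f ` S)" using fds_image f less by blast
    have "v0 \<in> {x \<in> S. f x = 0}" using s0 by (simp add: f_def)
    moreover have "fds {x \<in> S. f x = 0}"
      using fds_subset(1)[OF less.prems(1) lin_subspace_kernel[OF f sS]] by auto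
    ultimately have "dim {x \<in> S. f x = 0} \<noteq> 0" using dim_zero_iff s0(2) by blast
    then have lt: "dim (f ` S) < dim S" using rank_nullity[OF f less.prems(1)] by simp
    have "T (f x) = f (T x)" for x
      by (simp add: f_def linear_diff[OF assms(1)] linear_scale[OF assms(1)])
    then have "T ` f ` S \<subseteq> f ` S" using less.prems(2) by fastforce
    then have fin: "finite (?E (f ` S))" using less.hyps[OF lt fdsf] by blast
    have "?E S \<subseteq> insert s0 (?E (f ` S))"
    proof
      fix s assume "s \<in> ?E S"
      then obtain v where v: "v \<in> S" "v \<noteq> 0" "T v = s *\<^sub>R v" by blast
      have "f v = (s - s0) *\<^sub>R v" using v by (simp add: f_def algebra_simps)
      then have "s \<noteq> s0 \<Longrightarrow> v = f ((1 / (s - s0)) *\<^sub>R v)"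
        by (simp add: linear_scale[OF f])
      moreover have "(1 / (s - s0)) *\<^sub>R v \<in> S" using v sS lin_subspace_scale by blast
      ultimately show "s \<in> insert s0 (?E (f ` S))" using v by blast
    qed
    then show ?thesis using fin finite_subset by blast
  next
    case True
    then show ?thesis by (metis finite.emptyI)
  qed
qed

text \<open>A real vector space is not a finite union of proper hyperplanes. If \<open>x\<close>
  works for \<open>I\<close> but \<open>f j x = 0\<close>, then \<open>z + t x\<close> with
  \<open>f j z \<noteq> 0\<close> works as soon as \<open>t\<close> avoids one value for each
  \<open>i\<close> in \<open>I\<close>.\<close>

lemma functionals_avoid:
  fixes f :: "'i \<Rightarrow> 'a::real_vector \<Rightarrow> real"
  assumes "finite I" "lin_subspace S" "\<And>i. i \<in> I \<Longrightarrow> linear (f i) \<and> (\<exists>z\<in>S. f i z \<noteq> 0)"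
  shows "\<exists>x\<in>S. \<forall>i\<in>I. f i x \<noteq> 0"
  using assms(1,3)
proof (induction I)
  case empty
  then show ?case using lin_subspace_0[OF assms(2)] by blast
next
  case (insert j I)
  then obtain x z where x: "x \<in> S" "\<forall>i\<in>I. f i x \<noteq> 0" and z: "z \<in> S" "f j z \<noteq> 0" by blast
  have lin: "linear (f i)" if "i \<in> insert j I" for i using insert.prems that by blast
  show ?case
  proof (cases "f j x = 0")
    case False
    then show ?thesis using x by blast
  next
    case True
    have "finite ((\<lambda>i. - (f i z / f i x)) ` I)" using insert.hyps by simp
    then obtain t where t: "t \<notin> (\<lambda>i. - (f i z / f i x)) ` I"
      using ex_new_if_finite[OF infinite_UNIV_char_0] by blast
    have "f i (z + t *\<^sub>R x) \<noteq> 0" if "i \<in> insert j I" for i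
    proof (cases "i = j")
      case True
      then show ?thesis using z \<open>f j x = 0\<close> lin[of j] by (simp add: linear_add linear_scale)
    next
      case False
      then have "i \<in> I" "f i x \<noteq> 0" using that x by auto
      then have "t \<noteq> - (f i z / f i x)" using t by blast
      then show ?thesis using \<open>f i x \<noteq> 0\<close> lin[OF that]
        by (simp add: linear_add linear_scale field_simps add_eq_0_iff)
    qed
    moreover have "z + t *\<^sub>R x \<in> S"
      using x z assms(2) by (simp add: lin_subspace_add lin_subspace_scale)
    ultimately show ?thesis by blast
  qed
qed

text \<open>The points of \<open>C\<close> are treated one at a time: evaluation at a point has its
  image in \<open>G\<close>, and its kernel is governed by the remaining points. Finite dimension
  comes out together with the bound.\<close>

lemma dim_eval_bound:
  fixes S :: "('a \<Rightarrow> 'b::real_vector) set"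
  assumes "finite C" "lin_subspace S" "fds G"
    and "\<And>M c. M \<in> S \<Longrightarrow> c \<in> C \<Longrightarrow> M c \<in> G"
    and "\<And>M. M \<in> S \<Longrightarrow> (\<And>c. c \<in> C \<Longrightarrow> M c = 0) \<Longrightarrow> M = 0"
  shows "fds S \<and> dim S \<le> card C * dim G"
  using assms(1,2,4,5)
proof (induction C arbitrary: S)
  case empty
  then have "S = {0}" using lin_subspace_0 by fastforce
  then show ?case using fds_zero by auto
next
  case (insert c C)
  have ev: "linear (\<lambda>M :: 'a \<Rightarrow> 'b. M c)" by (rule linearI) auto
  let ?K = "{M \<in> S. M c = 0}"
  have K: "fds ?K \<and> dim ?K \<le> card C * dim G"
  proof (rule insert.IH)
    show "lin_subspace ?K" using lin_subspace_kernel[OF ev insert.prems(1)] .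
    show "M = 0" if "M \<in> ?K" "\<And>c. c \<in> C \<Longrightarrow> M c = 0" for M
      by (rule insert.prems(3)) (use that in auto)
  qed (use insert.prems in auto)
  have sub: "(\<lambda>M. M c) ` S \<subseteq> G" using insert.prems by auto
  have im: "fds ((\<lambda>M. M c) ` S)" "dim ((\<lambda>M. M c) ` S) \<le> dim G"
    using fds_subset[OF assms(3) lin_subspace_image[OF ev insert.prems(1)] sub] by auto
  have "fds S" "dim S = dim ((\<lambda>M. M c) ` S) + dim ?K"
    using rank_nullity_gen[OF ev insert.prems(1) im(1)] K by auto
  then show ?case using K im insert.hyps by simp
qed

section \<open>Spaces of operators with trivial spectrum\<close>

lemma separating_functional:
  fixes x :: "'a::real_vector"
  assumes "lin_subspace S" "x \<notin> S"
  obtains \<phi> :: "'a \<Rightarrow> real" where "linear \<phi>" "\<phi> x = 1" "\<And>s. s \<in> S \<Longrightarrow> \<phi> s = 0"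
proof -
  obtain B where B: "B \<subseteq> S" "independent B" "S \<subseteq> span B" using basis_exists[of S] by metis
  have "span B = S" using B(1,3) assms(1) span_mono[of B S] unfolding lin_subspace_iff by blast
  then have xB: "x \<notin> span B" using assms by blast
  then have "independent (insert x B)" using B(2) by (rule real_vector.independent_insertI)
  then obtain \<phi> :: "'a \<Rightarrow> real" where \<phi>: "linear \<phi>" "\<forall>b\<in>insert x B. \<phi> b = (if b = x then 1 else 0)"
    using real_vector.linear_independent_extend[of "insert x B" "\<lambda>b. if b = x then 1 else 0"] by blast
  have "x \<notin> B" using xB span_superset by blast
  have "\<phi> s = (\<lambda>_. 0) s" if "s \<in> S" for s
  proof (rule real_vector.linear_eq_on[OF \<phi>(1)])
    show "s \<in> span B" using that B(3) by blast
    show "\<phi> b = 0" if "b \<in> B" for b using \<phi>(2) that \<open>x \<notin> B\<close> by auto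
  qed (auto intro: linearI)
  then show ?thesis using that \<phi> by auto
qed

locale fin_projector =
  fixes P :: "'a::real_vector \<Rightarrow> 'a"
  assumes lin_P: "linear P" and idem_P: "P (P x) = P x" and fds_P: "fds (range P)"
begin

lemma in_range_iff: "x \<in> range P \<longleftrightarrow> P x = x"
  by (metis idem_P imageE rangeI)

lemma sub_P: "lin_subspace (range P)"
  using fds_P by (rule fds_lin_subspace)

text \<open>A projector \<open>g\<close> of the ambient space onto \<open>G\<close> is composed with
  \<open>P\<close>. Then \<open>\<gamma>\<close> absorbs \<open>P\<close> on both sides, so
  \<open>P - \<gamma>\<close> is again a projector; its range is a complement of \<open>G\<close> in
  \<open>range P\<close> and stands for the quotient.\<close>

lemma projector_complement:
  assumes "lin_subspace G" "G \<subseteq> range P"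
  obtains \<gamma> where "fin_projector \<gamma>" "range \<gamma> = G" "\<And>x. P (\<gamma> x) = \<gamma> x" "\<And>x. \<gamma> (P x) = \<gamma> x"
    "fin_projector (\<lambda>x. P x - \<gamma> x)" "dim (range P) = dim G + dim (range (\<lambda>x. P x - \<gamma> x))"
proof -
  obtain A where A: "A \<subseteq> G" "independent A" "G \<subseteq> span A" using basis_exists[of G] by metis
  have SA: "span A = G" using A(1,3) assms(1) span_mono[of A G] unfolding lin_subspace_iff by blast
  obtain g where g: "linear g" "\<forall>a\<in>A. g a = a" "range g = span A"
    using real_vector.linear_independent_extend_subspace[OF A(2), of "\<lambda>a. a"] by auto
  have gG: "g x = x" if "x \<in> G" for x
  proof -
    have "g x = (\<lambda>x. x) x"
      by (rule real_vector.linear_eq_on[OF g(1)]) (use that A(3) g(2) in \<open>auto intro: linearI\<close>)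
    then show ?thesis by simp
  qed
  define \<gamma> where "\<gamma> x = g (P x)" for x
  have PG: "P x = x" if "x \<in> G" for x using that assms(2) in_range_iff by blast
  have gin: "g x \<in> G" for x using g(3) SA by blast
  have \<gamma>G: "\<gamma> x = x" if "x \<in> G" for x using that by (simp add: \<gamma>_def PG gG)
  have rng: "range \<gamma> = G" using gin \<gamma>G by (auto simp: \<gamma>_def) (metis \<gamma>G \<gamma>_def rangeI)
  have lin\<gamma>: "linear \<gamma>" unfolding \<gamma>_def
    by (rule linearI) (simp_all add: linear_add linear_scale g(1) lin_P)
  have P\<gamma>: "P (\<gamma> x) = \<gamma> x" and \<gamma>P: "\<gamma> (P x) = \<gamma> x" and \<gamma>\<gamma>: "\<gamma> (\<gamma> x) = \<gamma> x" for x
    using gin PG by (simp_all add: \<gamma>_def idem_P gG)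
  have fp\<gamma>: "fin_projector \<gamma>"
    using lin\<gamma> \<gamma>\<gamma> fds_subset(1)[OF fds_P assms] rng by (intro fin_projector.intro) auto
  define \<delta> where "\<delta> x = P x - \<gamma> x" for x
  have lin\<delta>: "linear \<delta>" unfolding \<delta>_def
    by (rule linearI) (simp_all add: linear_add linear_scale lin\<gamma> lin_P algebra_simps)
  have \<delta>\<delta>: "\<delta> (\<delta> x) = \<delta> x" for x
    by (simp add: \<delta>_def linear_diff[OF lin_P] linear_diff[OF lin\<gamma>] P\<gamma> \<gamma>P \<gamma>\<gamma> idem_P)
  have r\<delta>: "range \<delta> = {x \<in> range P. \<gamma> x = 0}"
  proof safe
    fix x
    have "P (\<delta> x) = \<delta> x" by (simp add: \<delta>_def linear_diff[OF lin_P] P\<gamma> idem_P)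
    then show "\<delta> x \<in> range P" by (simp add: in_range_iff)
    show "\<gamma> (\<delta> x) = 0" by (simp add: \<delta>_def linear_diff[OF lin\<gamma>] \<gamma>P \<gamma>\<gamma>)
  next
    fix x assume "\<gamma> (P x) = 0"
    then have "\<delta> (P x) = P x" by (simp add: \<delta>_def idem_P)
    then show "P x \<in> range \<delta>" by (metis rangeI)
  qed
  have fds\<delta>: "fds (range \<delta>)" unfolding r\<delta>
    by (rule fds_subset(1)[OF fds_P lin_subspace_kernel[OF lin\<gamma> sub_P]]) auto
  have fp\<delta>: "fin_projector \<delta>" using lin\<delta> \<delta>\<delta> fds\<delta> by (intro fin_projector.intro) auto
  have "\<gamma> ` range P = G" using rng \<gamma>P by (metis (no_types, lifting) image_cong image_image)
  then have "dim (range P) = dim G + dim (range \<delta>)"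
    using rank_nullity[OF lin\<gamma> fds_P] r\<delta> by simp
  then show ?thesis using that[of \<gamma>] fp\<gamma> rng P\<gamma> \<gamma>P fp\<delta> unfolding \<delta>_def by blast
qed

text \<open>What is subtracted from \<open>P\<close> is the projector onto the line of
  \<open>x\<close> along the kernel of \<open>\<phi>\<close>. The remaining projector represents the
  quotient of \<open>range P\<close> by that line.\<close>

lemma fin_projector_deflate:
  assumes "linear \<phi>" "\<And>v. \<phi> (P v) = \<phi> v" "P x = x" "\<phi> x = (1::real)"
  shows "fin_projector (\<lambda>v. P v - \<phi> v *\<^sub>R x)"
    and "range (\<lambda>v. P v - \<phi> v *\<^sub>R x) = {v \<in> range P. \<phi> v = 0}"
    and "dim (range P) = Suc (dim (range (\<lambda>v. P v - \<phi> v *\<^sub>R x)))"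
proof -
  let ?Q = "\<lambda>v. P v - \<phi> v *\<^sub>R x"
  have lin: "linear ?Q"
    by (rule linearI) (simp_all add: linear_add linear_scale assms lin_P algebra_simps)
  have \<phi>Q: "\<phi> (?Q v) = 0" for v by (simp add: linear_diff linear_scale assms)
  have PQ: "P (?Q v) = ?Q v" for v
    by (simp add: linear_diff[OF lin_P] linear_scale[OF lin_P] idem_P assms(3))
  show rng: "range ?Q = {v \<in> range P. \<phi> v = 0}"
  proof (rule Set.set_eqI)
    fix v show "v \<in> range ?Q \<longleftrightarrow> v \<in> {v \<in> range P. \<phi> v = 0}"
    proof
      assume "v \<in> range ?Q"
      then show "v \<in> {v \<in> range P. \<phi> v = 0}" using \<phi>Q PQ in_range_iff by auto
    next
      assume "v \<in> {v \<in> range P. \<phi> v = 0}"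
      then have "v = ?Q v" by (simp add: in_range_iff)
      then show "v \<in> range ?Q" by (rule range_eqI)
    qed
  qed
  have "fds (range ?Q)" unfolding rng
    by (rule fds_subset(1)[OF fds_P lin_subspace_kernel[OF assms(1) sub_P]]) auto
  then show "fin_projector ?Q"
    using lin \<phi>Q PQ by (intro fin_projector.intro) auto
  show "dim (range P) = Suc (dim (range ?Q))"
    unfolding rng by (rule dim_functional_kernel[OF assms(1) fds_P, of x]) (use assms in_range_iff in auto)
qed

end

text \<open>Because \<open>V\<close> is closed under scaling, \<open>no_fix\<close> says that 0 is
  the only possible real eigenvalue of an element of \<open>V\<close>.\<close>

locale trivial_spectrum = fin_projector P for P :: "'a::real_vector \<Rightarrow> 'a" +
  fixes V :: "('a \<Rightarrow> 'a) set"
  assumes sub_V: "lin_subspace V"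
    and lin_V: "M \<in> V \<Longrightarrow> linear M"
    and ran_V: "M \<in> V \<Longrightarrow> P (M x) = M x"
    and dom_V: "M \<in> V \<Longrightarrow> M (P x) = M x"
    and no_fix: "M \<in> V \<Longrightarrow> M x = x \<Longrightarrow> x = 0"
begin

lemma zero_V: "(\<lambda>_. 0) \<in> V"
  using lin_subspace_0[OF sub_V] by (simp add: zero_fun_def)

lemma add_V: "M \<in> V \<Longrightarrow> N \<in> V \<Longrightarrow> (\<lambda>x. M x + N x) \<in> V"
  using lin_subspace_add[OF sub_V, of M N] by (simp add: plus_fun_def)

lemma scale_V: "M \<in> V \<Longrightarrow> (\<lambda>x. c *\<^sub>R M x) \<in> V"
  using lin_subspace_scale[OF sub_V, of M c] by (simp add: scaleR_fun_def)

lemma diff_V: "M \<in> V \<Longrightarrow> N \<in> V \<Longrightarrow> (\<lambda>x. M x - N x) \<in> V"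
  using lin_subspace_diff[OF sub_V, of M N] by (simp add: fun_diff_def)

lemma eval_image:
  shows "lin_subspace ((\<lambda>M. M x) ` V)" "(\<lambda>M. M x) ` V \<subseteq> range P"
    "x \<noteq> 0 \<Longrightarrow> x \<notin> (\<lambda>M. M x) ` V"
proof -
  have "linear (\<lambda>M::'a\<Rightarrow>'a. M x)" by (rule linearI) auto
  then show "lin_subspace ((\<lambda>M. M x) ` V)" using sub_V by (rule lin_subspace_image)
  show "(\<lambda>M. M x) ` V \<subseteq> range P" using ran_V in_range_iff by auto
  show "x \<noteq> 0 \<Longrightarrow> x \<notin> (\<lambda>M. M x) ` V" using no_fix by (metis imageE)
qed

text \<open>No nonzero vector is fixed by \<open>c M\<close>, so \<open>1 - c M\<close> is injective
  on the finite-dimensional \<open>range P\<close> and hence onto.\<close>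

lemma resolvent:
  assumes "M \<in> V" "P z = z"
  obtains w where "P w = w" "w - c *\<^sub>R M w = z"
proof -
  let ?f = "\<lambda>w. w - c *\<^sub>R M w"
  have "linear ?f"
    by (rule linearI) (simp_all add: linear_add linear_scale lin_V[OF assms(1)] algebra_simps)
  moreover have "?f ` range P \<subseteq> range P"
    using assms by (auto simp: in_range_iff idem_P linear_diff[OF lin_P] linear_scale[OF lin_P] ran_V)
  moreover have "x = 0" if "?f x = 0" for x
    using no_fix[OF scale_V[OF assms(1), of c]] that by auto
  ultimately have "?f ` range P = range P" using fds_P by (intro image_eq_if_inj) auto
  then have "z \<in> ?f ` range P" using assms(2) by (simp add: in_range_iff)
  then obtain w where "w \<in> range P" "z = ?f w" by (rule imageE)
  then show ?thesis using that[of w] by (simp add: in_range_iff)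
qed

text \<open>If \<open>e \<otimes> \<psi>\<^sub>e \<in> V\<close> with \<open>\<psi>\<^sub>e \<noteq> 0\<close> for every \<open>e\<close> of a basis, and \<open>x = \<Sum>a\<^sub>e e\<close> avoids the kernels
  of all \<open>\<psi>\<^sub>e\<close>, then the element \<open>\<Sum>(a\<^sub>e / \<psi>\<^sub>e x) e \<otimes> \<psi>\<^sub>e\<close> of \<open>V\<close> fixes \<open>x\<close>.\<close>

lemma adapted_vector:
  assumes "range P \<noteq> {0}"
  obtains x where "P x = x" "x \<noteq> 0" "\<And>\<psi>. linear \<psi> \<Longrightarrow> (\<lambda>v. \<psi> v *\<^sub>R x) \<in> V \<Longrightarrow> \<psi> = (\<lambda>_. 0)"
proof (rule ccontr)
  note ex = that
  assume no: "\<not> thesis"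
  have neg: "\<exists>\<psi>. linear \<psi> \<and> (\<lambda>v. \<psi> v *\<^sub>R x) \<in> V \<and> \<psi> \<noteq> (\<lambda>_. 0)" if x: "P x = x" "x \<noteq> 0" for x
    using no ex[OF x] by blast
  obtain B where B: "finite B" "independent B" "span B = range P" using fds_basis[OF fds_P] by metis
  have BP: "P e = e" "e \<noteq> 0" if "e \<in> B" for e
    using that B span_superset[of B] in_range_iff real_vector.dependent_zero by blast+
  then obtain \<psi> where \<psi>: "\<And>e. e \<in> B \<Longrightarrow> linear (\<psi> e) \<and> (\<lambda>v. \<psi> e v *\<^sub>R e) \<in> V \<and> \<psi> e \<noteq> (\<lambda>_. 0)"
    using neg by metis
  have ex: "linear (\<psi> e) \<and> (\<exists>z\<in>range P. \<psi> e z \<noteq> 0)" if e: "e \<in> B" for e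
  proof -
    obtain v where "\<psi> e v \<noteq> 0" using \<psi>[OF e] by force
    moreover have "\<psi> e (P v) = \<psi> e v" using dom_V[of "\<lambda>v. \<psi> e v *\<^sub>R e" v] \<psi>[OF e] BP[OF e] by simp
    ultimately show ?thesis using \<psi>[OF e] by (metis rangeI)
  qed
  obtain x where x: "x \<in> range P" "\<forall>e\<in>B. \<psi> e x \<noteq> 0"
    using functionals_avoid[OF B(1) sub_P, of \<psi>, OF ex] by metis
  then have "x \<in> range (\<lambda>a. \<Sum>e\<in>B. a e *\<^sub>R e)"
    by (simp only: real_vector.span_finite[OF B(1), symmetric] B(3))
  then obtain a where a: "x = (\<Sum>e\<in>B. a e *\<^sub>R e)" by (rule rangeE)
  define M where "M = (\<Sum>e\<in>B. (a e / \<psi> e x) *\<^sub>R (\<lambda>v. \<psi> e v *\<^sub>R e))"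
  have "M \<in> V" unfolding M_def using \<psi> sub_V by (intro lin_subspace_sum lin_subspace_scale) auto
  moreover have "M x = (\<Sum>e\<in>B. a e *\<^sub>R e)"
    unfolding M_def sum_fun_apply by (rule sum.cong) (use x in auto)
  ultimately have "x = 0" using no_fix a by simp
  moreover have "B \<noteq> {}" using B(3) assms by auto
  ultimately show False using x(2) \<psi> linear_0 by blast
qed

lemma eval_dim:
  assumes "x \<noteq> 0" "P x = x"
  shows "fds ((\<lambda>M. M x) ` V)" "dim ((\<lambda>M. M x) ` V) < dim (range P)"
proof -
  show "fds ((\<lambda>M. M x) ` V)" using fds_subset(1)[OF fds_P eval_image(1,2)] .
  have "dim ((\<lambda>M. M x) ` V) \<noteq> dim (range P)"
    using fds_dim_eq[OF fds_P eval_image(1,2)[of x]] eval_image(3)[OF assms(1)] assms(2) in_range_iff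
    by auto
  then show "dim ((\<lambda>M. M x) ` V) < dim (range P)"
    using fds_subset(2)[OF fds_P eval_image(1,2)[of x]] by simp
qed

text \<open>An \<open>M\<close> that annihilates \<open>x\<close> acts on the quotient by the line
  of \<open>x\<close>, and the new operator is this action on the complement. If it fixes
  \<open>v\<close>, then \<open>M v = v + c x\<close> with \<open>c = \<phi> (M v)\<close>, so
  \<open>M\<close> fixes \<open>v + c x\<close>.\<close>

lemma deflated_trivial_spectrum:
  assumes \<phi>: "linear \<phi>" "\<And>v. \<phi> (P v) = \<phi> v" and x: "P x = x" "\<phi> x = (1::real)"
  shows "trivial_spectrum (\<lambda>v. P v - \<phi> v *\<^sub>R x) ((\<lambda>M v. M v - \<phi> (M v) *\<^sub>R x) ` {M \<in> V. M x = 0})"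
proof -
  let ?Q = "\<lambda>v. P v - \<phi> v *\<^sub>R x"
  let ?F = "\<lambda>M v. M v - \<phi> (M v) *\<^sub>R x"
  interpret Q: fin_projector ?Q using fin_projector_deflate(1)[OF \<phi> x] .
  have linF: "linear ?F"
    by (rule linearI) (simp_all add: fun_eq_iff linear_add linear_scale \<phi> algebra_simps)
  have ev: "linear (\<lambda>M::'a\<Rightarrow>'a. M x)" by (rule linearI) auto
  show ?thesis
  proof (intro trivial_spectrum.intro trivial_spectrum_axioms.intro)
    show "fin_projector ?Q" ..
    show "lin_subspace (?F ` {M \<in> V. M x = 0})"
      by (rule lin_subspace_image[OF linF lin_subspace_kernel[OF ev sub_V]])
    fix N assume "N \<in> ?F ` {M \<in> V. M x = 0}"
    then obtain M where M: "M \<in> V" "M x = 0" "N = ?F M" by blast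
    note linM = lin_V[OF M(1)]
    show "linear N" unfolding M(3)
      by (rule linearI) (simp_all add: linear_add linear_scale \<phi> linM algebra_simps)
    fix v
    show "?Q (N v) = N v" unfolding M(3)
      by (simp add: linear_diff[OF lin_P] linear_scale[OF lin_P] ran_V M x linear_diff[OF \<phi>(1)]
          linear_scale[OF \<phi>(1)])
    show "N (?Q v) = N v" unfolding M(3)
      by (simp add: linear_diff[OF linM] linear_scale[OF linM] dom_V M)
    assume Nv: "N v = v"
    then have "M (v + \<phi> (M v) *\<^sub>R x) = v + \<phi> (M v) *\<^sub>R x"
      using M(2,3) by (simp add: linear_add[OF linM] linear_scale[OF linM]) (metis diff_eq_eq)
    then have v: "v = - \<phi> (M v) *\<^sub>R x" using no_fix[OF M(1)] by (metis eq_neg_iff_add_eq_0 scaleR_minus_left)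
    then have "M v = 0" using M(2) by (metis linear_scale[OF linM] scaleR_zero_right)
    then show "v = 0" using v linear_0[OF \<phi>(1)] by simp
  qed
qed

text \<open>An operator that becomes zero on the quotient has its image in the line of
  \<open>x\<close>, which for an adapted \<open>x\<close> happens only for the zero
  operator.\<close>

lemma deflation_inj:
  assumes \<phi>: "linear \<phi>"
    and ad: "\<And>\<psi>. linear \<psi> \<Longrightarrow> (\<lambda>v. \<psi> v *\<^sub>R x) \<in> V \<Longrightarrow> \<psi> = (\<lambda>_. 0)"
    and M: "M \<in> V" "(\<lambda>v. M v - \<phi> (M v) *\<^sub>R x) = 0"
  shows "M = 0"
proof -
  have eq: "M v = \<phi> (M v) *\<^sub>R x" for v using M(2) by (simp add: fun_eq_iff)
  then have "M = (\<lambda>v. \<phi> (M v) *\<^sub>R x)" by blast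
  then have "(\<lambda>v. \<phi> (M v) *\<^sub>R x) \<in> V" using M(1) by simp
  moreover have "linear (\<lambda>v. \<phi> (M v))"
    by (rule linearI) (use M in \<open>simp_all add: linear_add linear_scale \<phi> lin_V\<close>)
  ultimately have "(\<lambda>v. \<phi> (M v)) = (\<lambda>_. 0)" by (rule ad[rotated])
  then have "M v = 0" for v using eq[of v] by (metis scaleR_zero_left)
  then show ?thesis by (simp add: fun_eq_iff)
qed

end

text \<open>Finite dimension is part of the claim. It passes from the action on the quotient to the
  stabiliser of \<open>x\<close>, because deflation is injective, and from there to
  \<open>V\<close>, because the values at \<open>x\<close> lie in \<open>range P\<close>.\<close>

lemma trivial_spectrum_dim_bound:
  assumes "trivial_spectrum P V" "dim (range P) = n"
  shows "fds V \<and> dim V \<le> n choose 2"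
  using assms
proof (induction n arbitrary: P V)
  case 0
  then interpret trivial_spectrum P V by simp
  have "range P = {0}" using 0 dim_zero_iff[OF fds_P] by simp
  then have "M = 0" if "M \<in> V" for M
    using ran_V[OF that] by (metis UNIV_I ext image_eqI singletonD zero_fun_def)
  then have "V = {0}" using lin_subspace_0[OF sub_V] by blast
  then show ?case by (metis fds_zero le0)
next
  case (Suc n)
  then interpret trivial_spectrum P V by simp
  have "range P \<noteq> {0}" using Suc.prems(2) by (metis fds_zero(2) nat.distinct(1))
  then obtain x where x: "P x = x" "x \<noteq> 0"
    and ad: "\<And>\<psi>. linear \<psi> \<Longrightarrow> (\<lambda>v. \<psi> v *\<^sub>R x) \<in> V \<Longrightarrow> \<psi> = (\<lambda>_. 0)"
    using adapted_vector by metis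
  obtain \<phi>0 where \<phi>0: "linear \<phi>0" "\<phi>0 x = (1::real)"
    using separating_functional[of "{0}" x] x by (metis fds_lin_subspace fds_zero(1) singletonD)
  define \<phi> where "\<phi> v = \<phi>0 (P v)" for v
  have \<phi>: "linear \<phi>" unfolding \<phi>_def
    by (rule linearI) (simp_all add: linear_add linear_scale \<phi>0 lin_P)
  have \<phi>P: "\<phi> (P v) = \<phi> v" "\<phi> x = 1" for v unfolding \<phi>_def by (simp_all add: idem_P x \<phi>0)
  let ?F = "\<lambda>(M::'a\<Rightarrow>'a) v. M v - \<phi> (M v) *\<^sub>R x"
  let ?U = "{M \<in> V. M x = 0}"
  have dn: "dim (range (\<lambda>v. P v - \<phi> v *\<^sub>R x)) = n"
    using fin_projector_deflate(3)[OF \<phi> \<phi>P(1) x(1) \<phi>P(2)] Suc.prems(2) by simp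
  have IH: "fds (?F ` ?U)" "dim (?F ` ?U) \<le> n choose 2"
    using Suc.IH[OF deflated_trivial_spectrum[OF \<phi> \<phi>P(1) x(1) \<phi>P(2)] dn] by auto
  have linF: "linear ?F"
    by (rule linearI) (simp_all add: fun_eq_iff linear_add linear_scale \<phi> algebra_simps)
  have ev: "linear (\<lambda>M::'a\<Rightarrow>'a. M x)" by (rule linearI) auto
  have sU: "lin_subspace ?U" by (rule lin_subspace_kernel[OF ev sub_V])
  have "M = 0" if "M \<in> ?U" "?F M = 0" for M
    using deflation_inj[OF \<phi> ad] that by blast
  then have ker: "{M \<in> ?U. ?F M = 0} = {0}"
    using lin_subspace_0[OF sU] linear_0[OF linF] by blast
  have fker: "fds {M \<in> ?U. ?F M = 0}" unfolding ker by (rule fds_zero(1))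
  have dker: "dim {M \<in> ?U. ?F M = 0} = 0" unfolding ker by (rule fds_zero(2))
  have U: "fds ?U" "dim ?U \<le> n choose 2"
    using rank_nullity_gen[OF linF sU IH(1) fker] IH(2) unfolding dker by simp_all
  have "fds V" "dim V = dim ((\<lambda>M. M x) ` V) + dim ?U"
    by (rule rank_nullity_gen[OF ev sub_V eval_dim(1)[OF x(2,1)] U(1)])+
  moreover have "dim ((\<lambda>M. M x) ` V) \<le> n" using eval_dim(2)[OF x(2,1)] Suc.prems(2) by simp
  moreover have "Suc n choose 2 = n + (n choose 2)" by (simp add: numeral_2_eq_2)
  ultimately show ?case using U(2) by linarith
qed

section \<open>The case of maximal dimension\<close>

locale max_trivial_spectrum = trivial_spectrum +
  assumes dim_V: "dim V = dim (range P) choose 2"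
begin

lemma fds_V: "fds V"
  using trivial_spectrum_dim_bound trivial_spectrum_axioms by blast

text \<open>A space that attains the bound cannot be enlarged. This turns an inclusion of
  \<open>V\<close> in a space of skew operators into an equality.\<close>

lemma superset_eq:
  assumes "trivial_spectrum P W" "V \<subseteq> W"
  shows "V = W"
  using assms trivial_spectrum_dim_bound[OF assms(1) refl] sub_V dim_V by (intro fds_dim_eq) auto

text \<open>Otherwise \<open>V (x + t y)\<close> is the whole space for generic \<open>t\<close>, hence contains \<open>x + t y\<close>.\<close>

lemma annihilator_stable:
  assumes \<phi>: "linear \<phi>" "\<phi> x = (1::real)"
    and Vx: "(\<lambda>M. M x) ` V = {v \<in> range P. \<phi> v = 0}" and x: "P x = x"
    and M: "M \<in> V" "M x = 0"
  shows "\<phi> (M y) = 0"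
proof (rule ccontr)
  assume "\<phi> (M y) \<noteq> 0"
  define w where "w = M (P y)"
  define y' where "y' = P y"
  have w: "w = M y'" "\<phi> w \<noteq> 0" "P w = w" 
    using \<open>\<phi> (M y) \<noteq> 0\<close> by (simp_all add: w_def y'_def dom_V[OF M(1)] ran_V[OF M(1)])
  have Py': "P y' = y'" by (simp add: y'_def idem_P)
  have ev: "linear (\<lambda>M::'a\<Rightarrow>'a. M x)" by (rule linearI) auto
  \<comment> \<open>A linear section of evaluation at \<open>x\<close>: an operator in
    \<open>V\<close> with a prescribed value at \<open>x\<close>, depending linearly on that
    value.\<close>
  have "\<exists>g. range g \<subseteq> V \<and> linear g \<and> (\<forall>v\<in>(\<lambda>M. M x) ` V. g v x = v)"
    by (rule real_vector.linear_exists_right_inverse_on[OF ev sub_V[unfolded lin_subspace_iff span_eq_iff]])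
  then obtain g :: "'a \<Rightarrow> 'a \<Rightarrow> 'a" where "range g \<subseteq> V \<and> linear g \<and> (\<forall>v\<in>(\<lambda>M. M x) ` V. g v x = v)"
    by (rule exE)
  then have g: "linear g" "range g \<subseteq> V" "\<forall>v\<in>(\<lambda>M. M x) ` V. g v x = v" by simp_all
  have gadd: "g (a + b) v = g a v + g b v" and gsc: "g (c *\<^sub>R a) v = c *\<^sub>R g a v" for a b c v
    by (simp_all add: linear_add[OF g(1)] linear_scale[OF g(1)])
  \<comment> \<open>The splitting \<open>z = h z + c z w\<close> along the kernel of
    \<open>\<phi>\<close> and the line of \<open>w\<close>. The first part will be reached through
    the section \<open>g\<close> at \<open>x\<close>, the second through \<open>M\<close> at
    \<open>y'\<close>.\<close>
  define c where "c z = \<phi> z / \<phi> w" for z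
  define h where "h z = z - c z *\<^sub>R w" for z
  define B where "B z = g (h z) y'" for z
  have lc: "c (a + b) = c a + c b" "c (r *\<^sub>R a) = r * c a" for a b r
    by (simp_all add: c_def linear_add[OF \<phi>(1)] linear_scale[OF \<phi>(1)] add_divide_distrib)
  have lh: "h (a + b) = h a + h b" "h (r *\<^sub>R a) = r *\<^sub>R h a" for a b r
    by (simp_all add: h_def lc algebra_simps)
  have linB: "linear B" by (rule linearI) (simp_all add: B_def lh gadd gsc)
  have gV: "g v \<in> V" for v using g(2) by blast
  have BP: "B ` range P \<subseteq> range P" using ran_V[OF gV] in_range_iff by (auto simp: B_def)
  have "finite (insert 0 {s. \<exists>v\<in>range P. v \<noteq> 0 \<and> B v = s *\<^sub>R v})"
    using finite_eigenvalues[OF linB fds_P BP] by simp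
  then obtain s where "s \<notin> insert 0 {s. \<exists>v\<in>range P. v \<noteq> 0 \<and> B v = s *\<^sub>R v}"
    using ex_new_if_finite[OF infinite_UNIV_char_0] by meson
  then have s: "s \<noteq> 0" "\<And>v. v \<in> range P \<Longrightarrow> B v = s *\<^sub>R v \<Longrightarrow> v = 0" by auto
  \<comment> \<open>As \<open>s\<close> is no eigenvalue of \<open>B\<close> on
    \<open>range P\<close>, the map \<open>1 + t B\<close> is invertible there for this
    \<open>t\<close>.\<close>
  define t where "t = - (1 / s)"
  have t: "t \<noteq> 0" using s by (simp add: t_def)
  let ?A = "\<lambda>z. z + t *\<^sub>R B z"
  have "linear ?A" by (rule linearI) (simp_all add: linear_add[OF linB] linear_scale[OF linB] algebra_simps)
  moreover have "?A ` range P \<subseteq> range P"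
    using BP sub_P by (auto intro!: lin_subspace_add lin_subspace_scale)
  moreover have "z = 0" if "z \<in> range P" "?A z = 0" for z
  proof -
    have "s *\<^sub>R (z + t *\<^sub>R B z) = 0" using that by simp
    then have "B z = s *\<^sub>R z" using s(1) by (simp add: t_def algebra_simps)
    then show ?thesis using s(2) that by blast
  qed
  ultimately have "?A ` range P = range P" using fds_P by (intro image_eq_if_inj) auto
  moreover have "x + t *\<^sub>R y' \<in> range P"
    by (simp add: in_range_iff linear_add[OF lin_P] linear_scale[OF lin_P] x Py')
  ultimately obtain z where z: "z \<in> range P" "x + t *\<^sub>R y' = z + t *\<^sub>R B z" by (metis (no_types, lifting) imageE)
  have "h z \<in> {v \<in> range P. \<phi> v = 0}"
    using z(1) w by (simp add: h_def c_def in_range_iff linear_diff[OF lin_P] linear_scale[OF lin_P]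
        linear_diff[OF \<phi>(1)] linear_scale[OF \<phi>(1)])
  then have gh: "g (h z) x = h z" using g(3) Vx by blast
  \<comment> \<open>Because \<open>M x = 0\<close> and \<open>M y' = w\<close>, this operator sends
    \<open>x + t y'\<close> to \<open>h z + t B z + c z w = z + t B z\<close>, and \<open>z\<close>
    was chosen so that this is \<open>x + t y'\<close> itself.\<close>
  let ?N = "\<lambda>v. g (h z) v + (c z / t) *\<^sub>R M v"
  have NV: "?N \<in> V" using add_V[OF gV scale_V[OF M(1)]] .
  have "?N (x + t *\<^sub>R y') = g (h z) x + t *\<^sub>R g (h z) y' + (c z / t) *\<^sub>R (M x + t *\<^sub>R M y')"
    by (simp add: linear_add[OF lin_V[OF gV]] linear_scale[OF lin_V[OF gV]] linear_add[OF lin_V[OF M(1)]]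
        linear_scale[OF lin_V[OF M(1)]])
  also have "\<dots> = z + t *\<^sub>R B z" using gh M(2) t by (simp add: B_def h_def w(1))
  finally have "x + t *\<^sub>R y' = 0" using no_fix[OF NV] z(2) by metis
  then have "M (x + t *\<^sub>R y') = 0" using linear_0[OF lin_V[OF M(1)]] by simp
  then have "t *\<^sub>R w = 0" using M(2) by (simp add: w(1) linear_add[OF lin_V[OF M(1)]] linear_scale[OF lin_V[OF M(1)]])
  then show False using t w(2) linear_0[OF \<phi>(1)] by simp
qed

text \<open>Equality in the dimension bound forces equality for the values at \<open>x\<close> and
  for the stabiliser separately. The functional is chosen to vanish on the values at
  \<open>x\<close>, so they form the complement that represents the quotient. By
  \<open>annihilator_stable\<close> the stabiliser already maps into this complement, so deflation
  leaves its elements unchanged.\<close>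

lemma hyperplane_reduction:
  assumes "range P \<noteq> {0}"
  obtains x \<phi> where "P x = x" "linear \<phi>" "\<And>v. \<phi> (P v) = \<phi> v" "\<phi> x = (1::real)"
    "(\<lambda>M. M x) ` V = {v \<in> range P. \<phi> v = 0}"
    "\<And>M v. M \<in> V \<Longrightarrow> M x = 0 \<Longrightarrow> \<phi> (M v) = 0"
    "max_trivial_spectrum (\<lambda>v. P v - \<phi> v *\<^sub>R x) {M \<in> V. M x = 0}"
proof -
  obtain x where x: "P x = x" "x \<noteq> 0"
    and ad: "\<And>\<psi>. linear \<psi> \<Longrightarrow> (\<lambda>v. \<psi> v *\<^sub>R x) \<in> V \<Longrightarrow> \<psi> = (\<lambda>_. 0)"
    using adapted_vector[OF assms] by metis
  obtain \<phi>0 where \<phi>0: "linear \<phi>0" "\<phi>0 x = (1::real)" "\<And>v. v \<in> (\<lambda>M. M x) ` V \<Longrightarrow> \<phi>0 v = 0"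
    using separating_functional[OF eval_image(1) eval_image(3)[OF x(2)]] by metis
  define \<phi> where "\<phi> v = \<phi>0 (P v)" for v
  have \<phi>: "linear \<phi>" unfolding \<phi>_def
    by (rule linearI) (simp_all add: linear_add linear_scale \<phi>0 lin_P)
  have \<phi>P: "\<phi> (P v) = \<phi> v" and \<phi>x: "\<phi> x = 1" for v unfolding \<phi>_def by (simp_all add: idem_P x \<phi>0)
  have \<phi>V: "\<phi> (M x) = 0" if "M \<in> V" for M using \<phi>0(3)[of "M x"] that by (simp add: \<phi>_def ran_V)
  let ?Q = "\<lambda>v. P v - \<phi> v *\<^sub>R x"
  let ?F = "\<lambda>(M::'a\<Rightarrow>'a) v. M v - \<phi> (M v) *\<^sub>R x"
  let ?U = "{M \<in> V. M x = 0}"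
  let ?e = "\<lambda>M::'a\<Rightarrow>'a. M x"
  have Q: "dim (range P) = Suc (dim (range ?Q))"
    using fin_projector_deflate(3)[OF \<phi> \<phi>P x(1) \<phi>x] .
  have rQ: "range ?Q = {v \<in> range P. \<phi> v = 0}" using fin_projector_deflate(2)[OF \<phi> \<phi>P x(1) \<phi>x] .
  interpret Q: fin_projector ?Q using fin_projector_deflate(1)[OF \<phi> \<phi>P x(1) \<phi>x] .
  have tsQ: "trivial_spectrum ?Q (?F ` ?U)" by (rule deflated_trivial_spectrum[OF \<phi> \<phi>P x(1) \<phi>x])
  have linF: "linear ?F"
    by (rule linearI) (simp_all add: fun_eq_iff linear_add linear_scale \<phi> algebra_simps)
  have ev: "linear ?e" by (rule linearI) auto
  have sU: "lin_subspace ?U" by (rule lin_subspace_kernel[OF ev sub_V])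
  have fU: "fds ?U" using fds_subset(1)[OF fds_V sU] by blast
  have "dim (?F ` ?U) = dim ?U"
    by (rule dim_image_inj[OF linF fU]) (use deflation_inj[OF \<phi> ad] in blast)
  then have dU: "dim ?U \<le> dim (range ?Q) choose 2" using trivial_spectrum_dim_bound[OF tsQ refl] by simp
  have "?e ` V \<subseteq> range ?Q" using \<phi>V ran_V unfolding rQ by (auto simp: in_range_iff)
  note dVx = fds_subset(2)[OF Q.fds_P eval_image(1) this]
  have "dim V = dim (?e ` V) + dim ?U" using rank_nullity[OF ev fds_V] .
  moreover have "Suc k choose 2 = k + (k choose 2)" for k by (simp add: numeral_2_eq_2)
  ultimately have dims: "dim (?e ` V) = dim (range ?Q)" "dim ?U = dim (range ?Q) choose 2"
    using dim_V dU dVx unfolding Q by simp_all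
  have Vx: "?e ` V = {v \<in> range P. \<phi> v = 0}"
    unfolding rQ[symmetric]
    by (rule fds_dim_eq[OF Q.fds_P eval_image(1) \<open>?e ` V \<subseteq> range ?Q\<close>]) (simp add: dims(1))
  have stab: "\<phi> (M v) = 0" if "M \<in> V" "M x = 0" for M v
    using annihilator_stable[OF \<phi> \<phi>x Vx x(1) that] .
  then have "?F ` ?U = ?U" by force
  then have "trivial_spectrum ?Q ?U" using tsQ by simp
  then have "max_trivial_spectrum ?Q ?U"
    using dims(2) by (intro max_trivial_spectrum.intro max_trivial_spectrum_axioms.intro)
  then show ?thesis using that[of x \<phi>] x(1) \<phi> \<phi>P \<phi>x Vx stab by blast
qed

end

section \<open>Spaces with an invariant subspace\<close>

lemma choose_two_add: "(a + b) choose 2 = (a choose 2) + (b choose 2) + b * a"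
proof (induction b)
  case (Suc b)
  have "Suc k choose 2 = k + (k choose 2)" for k by (simp add: numeral_2_eq_2)
  then show ?case using Suc by simp
qed simp

context max_trivial_spectrum
begin

text \<open>Restriction to \<open>G\<close>, action on the quotient and maps from the quotient into
  \<open>G\<close> contribute to \<open>dim V\<close> at most the three terms of
  \<open>choose_two_add\<close>. As the sum is attained, so is each term: the operators vanishing on
  \<open>G\<close> realise every action on the quotient (\<open>f2K1\<close>), and all of
  \<open>Hom\<close> lies in \<open>V\<close> (\<open>K2\<close>). Hence the three blocks can be
  prescribed independently.\<close>

lemma invariant_subspace_split:
  assumes G: "lin_subspace G" "G \<subseteq> range P" and "\<forall>M\<in>V. \<forall>v\<in>G. M v \<in> G"
  obtains \<gamma> \<delta> where "fin_projector \<gamma>" "range \<gamma> = G" "\<forall>v. P v = \<gamma> v + \<delta> v"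
    "\<forall>v. \<gamma> (\<delta> v) = 0" "\<forall>v. \<delta> (\<gamma> v) = 0" "dim (range P) = dim (range \<gamma>) + dim (range \<delta>)"
    "max_trivial_spectrum \<gamma> ((\<lambda>M v. M (\<gamma> v)) ` V)"
    "max_trivial_spectrum \<delta> ((\<lambda>M v. \<delta> (M (\<delta> v))) ` V)"
    "\<forall>X. linear X \<and> (\<forall>v. \<gamma> (X v) = X v) \<and> (\<forall>v. X (\<delta> v) = X v) \<longrightarrow>
       (\<forall>M\<in>V. \<forall>N\<in>V. (\<lambda>v. M (\<gamma> v) + \<delta> (N (\<delta> v)) + X v) \<in> V)"
proof -
  have inv: "M v \<in> G" if "M \<in> V" "v \<in> G" for M v using assms(3) that by blast
  obtain \<gamma> where fp\<gamma>: "fin_projector \<gamma>" and r\<gamma>: "range \<gamma> = G" and P\<gamma>: "\<And>x. P (\<gamma> x) = \<gamma> x"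
    and \<gamma>P: "\<And>x. \<gamma> (P x) = \<gamma> x" and fp\<delta>: "fin_projector (\<lambda>x. P x - \<gamma> x)"
    and dims: "dim (range P) = dim G + dim (range (\<lambda>x. P x - \<gamma> x))"
    using projector_complement[OF G] by blast
  define \<delta> where "\<delta> = (\<lambda>x. P x - \<gamma> x)"
  interpret \<gamma>: fin_projector \<gamma> by (rule fp\<gamma>)
  interpret \<delta>: fin_projector \<delta> unfolding \<delta>_def by (rule fp\<delta>)
  have dec: "P v = \<gamma> v + \<delta> v" for v by (simp add: \<delta>_def)
  have \<gamma>\<delta>: "\<gamma> (\<delta> v) = 0" for v by (simp add: \<delta>_def linear_diff[OF \<gamma>.lin_P] \<gamma>P \<gamma>.idem_P)
  have \<delta>\<gamma>: "\<delta> (\<gamma> v) = 0" for v by (simp add: \<delta>_def P\<gamma> \<gamma>.idem_P)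
  have P\<delta>: "P (\<delta> v) = \<delta> v" for v
    by (simp add: \<delta>_def linear_diff[OF lin_P] P\<gamma> idem_P)
  have inG: "v \<in> G \<longleftrightarrow> \<gamma> v = v" for v using \<gamma>.in_range_iff r\<gamma> by simp
  have \<gamma>M\<gamma>: "\<gamma> (M (\<gamma> v)) = M (\<gamma> v)" if "M \<in> V" for M v
    using inv[OF that, of "\<gamma> v"] inG \<gamma>.idem_P by blast
  have Mdec: "M v = M (\<gamma> v) + M (\<delta> v)" if "M \<in> V" for M v
    using dom_V[OF that, of v] by (simp add: dec linear_add[OF lin_V[OF that]])
  let ?f1 = "\<lambda>(M::'a\<Rightarrow>'a) v. M (\<gamma> v)"
  let ?f2 = "\<lambda>(M::'a\<Rightarrow>'a) v. \<delta> (M (\<delta> v))"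
  have l1: "linear ?f1" by (rule linearI) (simp_all add: fun_eq_iff)
  have l2: "linear ?f2" by (rule linearI) (simp_all add: fun_eq_iff linear_add[OF \<delta>.lin_P] linear_scale[OF \<delta>.lin_P])
  have ts1: "trivial_spectrum \<gamma> (?f1 ` V)"
  proof (intro trivial_spectrum.intro trivial_spectrum_axioms.intro)
    show "fin_projector \<gamma>" ..
    show "lin_subspace (?f1 ` V)" by (rule lin_subspace_image[OF l1 sub_V])
    fix N assume "N \<in> ?f1 ` V"
    then obtain M where M: "M \<in> V" "N = ?f1 M" by blast
    show "linear N" unfolding M(2)
      by (rule linearI) (simp_all add: linear_add linear_scale \<gamma>.lin_P lin_V M(1))
    fix v
    show "\<gamma> (N v) = N v" "N (\<gamma> v) = N v" unfolding M(2) using \<gamma>M\<gamma>[OF M(1)] by (simp_all add: \<gamma>.idem_P)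
    assume "N v = v"
    then have v: "M (\<gamma> v) = v" by (simp add: M(2))
    then have "\<gamma> v = v" using \<gamma>M\<gamma>[OF M(1)] by metis
    then show "v = 0" using v no_fix[OF M(1)] by simp
  qed
  have ts2: "trivial_spectrum \<delta> (?f2 ` V)"
  proof (intro trivial_spectrum.intro trivial_spectrum_axioms.intro)
    show "fin_projector \<delta>" ..
    show "lin_subspace (?f2 ` V)" by (rule lin_subspace_image[OF l2 sub_V])
    fix N assume "N \<in> ?f2 ` V"
    then obtain M where M: "M \<in> V" "N = ?f2 M" by blast
    show "linear N" unfolding M(2)
      by (rule linearI) (simp_all add: linear_add linear_scale \<delta>.lin_P lin_V M(1))
    fix v
    show "\<delta> (N v) = N v" "N (\<delta> v) = N v" unfolding M(2) by (simp_all add: \<delta>.idem_P)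
    assume "N v = v"
    then have v: "\<delta> (M (\<delta> v)) = v" by (simp add: M(2))
    then have \<delta>v: "\<delta> v = v" using \<delta>.idem_P by metis
    \<comment> \<open>A vector \<open>v\<close> fixed on the quotient satisfies
      \<open>v - M v \<in> G\<close>. Since \<open>1 - M\<close> maps \<open>G\<close> onto itself,
      \<open>v - M v = g - M g\<close> for some \<open>g \<in> G\<close>, and then \<open>M\<close>
      fixes \<open>v - g\<close>.\<close>
    let ?D = "\<lambda>w. w - M w"
    have linD: "linear ?D"
      by (rule linearI) (simp_all add: linear_add linear_scale lin_V[OF M(1)] algebra_simps)
    have "?D ` G = G"
    proof (rule image_eq_if_inj[OF linD])
      show "fds G" using \<gamma>.fds_P r\<gamma> by simp
      show "?D ` G \<subseteq> G" using inv[OF M(1)] G(1) by (auto intro: lin_subspace_diff)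
      show "w = 0" if "?D w = 0" for w using that no_fix[OF M(1), of w] by simp
    qed
    moreover have "\<delta> (?D v) = 0" using v \<delta>v by (simp add: linear_diff[OF \<delta>.lin_P])
    then have "?D v = \<gamma> (?D v)"
      using dec[of "?D v"] \<delta>v P\<delta>[of v] by (simp add: linear_diff[OF lin_P] ran_V[OF M(1)])
    then have "?D v \<in> G" using inG by metis
    ultimately obtain g where g: "g \<in> G" "?D v = ?D g" by (metis (no_types, lifting) imageE)
    then have "?D (v - g) = 0" using linear_diff[OF linD, of v g] by simp
    then have "v = g" using no_fix[OF M(1), of "v - g"] by simp
    then have "\<gamma> v = v" using g(1) inG by simp
    then show "v = 0" using \<delta>v \<gamma>\<delta> by metis
  qed
  let ?K1 = "{M \<in> V. ?f1 M = 0}"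
  let ?K2 = "{M \<in> ?K1. ?f2 M = 0}"
  define Hom where "Hom = {X::'a\<Rightarrow>'a. linear X \<and> (\<forall>v. \<gamma> (X v) = X v) \<and> (\<forall>v. X (\<delta> v) = X v)}"
  have sHom: "lin_subspace Hom"
    by (rule lin_subspaceI)
       (auto simp: Hom_def linear_0[OF \<gamma>.lin_P] linear_add[OF \<gamma>.lin_P] linear_scale[OF \<gamma>.lin_P]
         plus_fun_def zero_fun_def scaleR_fun_def real_vector.module_hom_add
         real_vector.module_hom_scale real_vector.module_hom_zero)
  have "fds Hom \<and> dim Hom \<le> dim (range \<delta>) * dim G"
  proof -
    obtain C where C: "finite C" "independent C" "span C = range \<delta>" "card C = dim (range \<delta>)"
      using fds_basis[OF \<delta>.fds_P] by metis
    have "fds Hom \<and> dim Hom \<le> card C * dim G"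
    proof (rule dim_eval_bound[OF C(1) sHom])
      show "fds G" using \<gamma>.fds_P r\<gamma> by simp
      show "M c \<in> G" if "M \<in> Hom" for M c using that inG unfolding Hom_def by simp
      fix M assume M: "M \<in> Hom" "\<And>c. c \<in> C \<Longrightarrow> M c = 0"
      have "M v = 0" for v
      proof -
        have "M (\<delta> v) = (\<lambda>_. 0) (\<delta> v)"
          by (rule real_vector.linear_eq_on[of M _ _ C])
             (use M C(3) in \<open>auto simp: Hom_def intro: linearI\<close>)
        then show ?thesis using M(1) unfolding Hom_def by simp
      qed
      then show "M = 0" by (simp add: fun_eq_iff)
    qed
    then show ?thesis using C(4) by simp
  qed
  then have fHom: "fds Hom" and dHom: "dim Hom \<le> dim (range \<delta>) * dim G" by auto
  have sK1: "lin_subspace ?K1" by (rule lin_subspace_kernel[OF l1 sub_V])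
  have sK2: "lin_subspace ?K2" by (rule lin_subspace_kernel[OF l2 sK1])
  have fK1: "fds ?K1" using fds_subset(1)[OF fds_V sK1] by blast
  have K2Hom: "?K2 \<subseteq> Hom"
  proof
    fix M assume "M \<in> ?K2"
    then have M: "M \<in> V" "\<And>v. M (\<gamma> v) = 0" "\<And>v. \<delta> (M (\<delta> v)) = 0" by (auto simp: fun_eq_iff)
    then have M\<delta>: "M (\<delta> v) = M v" for v using Mdec[OF M(1), of v] by simp
    have "\<gamma> (M v) = M v" for v using dec[of "M v"] M(3)[of v] ran_V[OF M(1)] by (simp add: M\<delta>)
    then show "M \<in> Hom" using M\<delta> lin_V[OF M(1)] unfolding Hom_def by blast
  qed
  have b1: "dim (?f1 ` V) \<le> dim G choose 2" using trivial_spectrum_dim_bound[OF ts1 refl] r\<gamma> by simp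
  have f2V: "fds (?f2 ` V)" and b2: "dim (?f2 ` V) \<le> dim (range \<delta>) choose 2"
    using trivial_spectrum_dim_bound[OF ts2 refl] by auto
  have sf2: "lin_subspace (?f2 ` ?K1)" by (rule lin_subspace_image[OF l2 sK1])
  have sub2: "?f2 ` ?K1 \<subseteq> ?f2 ` V" by blast
  have b2': "dim (?f2 ` ?K1) \<le> dim (?f2 ` V)" using fds_subset(2)[OF f2V sf2 sub2] .
  have b3: "dim ?K2 \<le> dim Hom" using fds_subset(2)[OF fHom sK2 K2Hom] .
  have "dim V = dim (?f1 ` V) + (dim (?f2 ` ?K1) + dim ?K2)"
    using rank_nullity[OF l1 fds_V] rank_nullity[OF l2 fK1] by simp
  moreover have "dim V = (dim G choose 2) + (dim (range \<delta>) choose 2) + dim (range \<delta>) * dim G"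
    using dim_V dims choose_two_add unfolding \<delta>_def by simp
  ultimately have eqs: "dim (?f1 ` V) = dim G choose 2" "dim (?f2 ` V) = dim (range \<delta>) choose 2"
    "dim (?f2 ` V) \<le> dim (?f2 ` ?K1)" "dim Hom \<le> dim ?K2"
    using b1 b2 b2' b3 dHom by linarith+
  have f2K1: "?f2 ` ?K1 = ?f2 ` V" using fds_dim_eq[OF f2V sf2 sub2 eqs(3)] .
  have K2: "?K2 = Hom" using fds_dim_eq[OF fHom sK2 K2Hom eqs(4)] .
  have HomV: "X \<in> V" if "X \<in> Hom" for X using that K2 by blast
  have all: "(\<lambda>v. M (\<gamma> v) + \<delta> (N (\<delta> v)) + X v) \<in> V"
    if X: "linear X" "\<And>v. \<gamma> (X v) = X v" "\<And>v. X (\<delta> v) = X v" and MN: "M \<in> V" "N \<in> V" for X M N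
  proof -
    obtain N' where N': "N' \<in> V" "?f1 N' = 0" "?f2 N' = ?f2 (\<lambda>v. N v - M v)"
    proof -
      have "?f2 (\<lambda>v. N v - M v) \<in> ?f2 ` ?K1" unfolding f2K1 using diff_V[OF MN(2,1)] by (rule imageI)
      then obtain N' where "N' \<in> ?K1" "?f2 (\<lambda>v. N v - M v) = ?f2 N'" by (rule imageE)
      then show ?thesis using that[of N'] by simp
    qed
    have N'1: "N' (\<gamma> v) = 0" "N' (\<delta> v) = N' v" for v
      using fun_cong[OF N'(2), of v] Mdec[OF N'(1), of v] by simp_all
    have N'2: "\<delta> (N' v) = \<delta> (N (\<delta> v)) - \<delta> (M (\<delta> v))" for v
      using fun_cong[OF N'(3), of v] N'1(2)[of v] by (simp add: linear_diff[OF \<delta>.lin_P])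
    \<comment> \<open>The diagonal blocks of \<open>M + N'\<close> are already the desired ones;
      adding \<open>Y\<close> replaces its off-diagonal block by \<open>X\<close>.\<close>
    define Y where "Y v = X v - \<gamma> (M (\<delta> v)) - \<gamma> (N' v)" for v
    have "Y \<in> Hom"
      using X unfolding Hom_def Y_def
      by (auto intro!: linearI simp: linear_add linear_scale \<gamma>.lin_P \<delta>.lin_P lin_V[OF MN(1)] lin_V[OF N'(1)]
          linear_diff[OF \<gamma>.lin_P] \<gamma>.idem_P \<delta>.idem_P N'1 algebra_simps)
    then have "(\<lambda>v. M v + N' v + Y v) \<in> V" by (intro add_V HomV MN N')
    moreover have "M v + N' v + Y v = M (\<gamma> v) + \<delta> (N (\<delta> v)) + X v" for v
    proof -
      have "M v = M (\<gamma> v) + (\<gamma> (M (\<delta> v)) + \<delta> (M (\<delta> v)))"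
        using Mdec[OF MN(1), of v] dec[of "M (\<delta> v)"] ran_V[OF MN(1)] by simp
      moreover have "N' v = \<gamma> (N' v) + \<delta> (N' v)" using dec[of "N' v"] ran_V[OF N'(1)] by simp
      moreover have "m + n + (x - b - e) = a + k + x"
        if "m = a + (b + d)" "n = e + f" "f = k - d" for m n x a b d e f k :: 'a
        using that by simp
      ultimately show ?thesis using N'2[of v] unfolding Y_def by blast
    qed
    ultimately show ?thesis by simp
  qed
  have m1: "max_trivial_spectrum \<gamma> (?f1 ` V)"
    using ts1 eqs(1) r\<gamma> by (intro max_trivial_spectrum.intro max_trivial_spectrum_axioms.intro) simp_all
  have m2: "max_trivial_spectrum \<delta> (?f2 ` V)"
    using ts2 eqs(2) by (intro max_trivial_spectrum.intro max_trivial_spectrum_axioms.intro) simp_all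
  have "dim (range P) = dim (range \<gamma>) + dim (range \<delta>)" using dims r\<gamma> unfolding \<delta>_def by simp
  then show ?thesis
    by (intro that[of \<gamma> \<delta>] fp\<gamma> r\<gamma> m1 m2 allI impI ballI)
       (use dec \<gamma>\<delta> \<delta>\<gamma> all in auto)
qed

end

section \<open>Skew operators and irreducibility\<close>

definition bilin :: "('a::real_vector \<Rightarrow> 'a \<Rightarrow> real) \<Rightarrow> bool" where
  "bilin b \<longleftrightarrow> (\<forall>u. linear (b u)) \<and> (\<forall>v. linear (\<lambda>u. b u v))"

lemma bilin_simps:
  assumes "bilin b"
  shows "b (u + u') v = b u v + b u' v" "b u (v + v') = b u v + b u v'"
    "b (u - u') v = b u v - b u' v" "b u (v - v') = b u v - b u v'"
    "b (c *\<^sub>R u) v = c * b u v" "b u (c *\<^sub>R v) = c * b u v" "b 0 v = 0" "b u 0 = 0"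
proof -
  have l: "linear (b u)" and r: "linear (\<lambda>u. b u v)" for u v using assms by (auto simp: bilin_def)
  show "b (u + u') v = b u v + b u' v" using linear_add[OF r] .
  show "b u (v + v') = b u v + b u v'" using linear_add[OF l] .
  show "b (u - u') v = b u v - b u' v" using linear_diff[OF r] .
  show "b u (v - v') = b u v - b u v'" using linear_diff[OF l] .
  show "b (c *\<^sub>R u) v = c * b u v" using linear_scale[OF r] by simp
  show "b u (c *\<^sub>R v) = c * b u v" using linear_scale[OF l] by simp
  show "b 0 v = 0" using linear_0[OF r] .
  show "b u 0 = 0" using linear_0[OF l] .
qed

text \<open>No sign is fixed here; \<open>definite_sign\<close> shows that \<open>b v v\<close> has
  a constant one.\<close>

definition definite_on :: "('a::real_vector \<Rightarrow> 'a) \<Rightarrow> ('a \<Rightarrow> 'a \<Rightarrow> real) \<Rightarrow> bool" where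
  "definite_on P b \<longleftrightarrow> (\<forall>v. P v = v \<longrightarrow> b v v = 0 \<longrightarrow> v = 0)"

text \<open>As \<open>b\<close> may be asymmetric, the condition says that \<open>b u (M v)\<close>
  is alternating on \<open>range P\<close>. In general this differs from being skew-adjoint for the
  symmetric part of \<open>b\<close>.\<close>

definition skew_ops :: "('a::real_vector \<Rightarrow> 'a) \<Rightarrow> ('a \<Rightarrow> 'a \<Rightarrow> real) \<Rightarrow> ('a \<Rightarrow> 'a) set" where
  "skew_ops P b = {M. linear M \<and> (\<forall>v. P (M v) = M v) \<and> (\<forall>v. M (P v) = M v) \<and>
                      (\<forall>v. P v = v \<longrightarrow> b v (M v) = 0)}"

lemma skew_ops_trivial_spectrum:
  assumes "fin_projector P" "bilin b" "definite_on P b"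
  shows "trivial_spectrum P (skew_ops P b)"
proof (intro trivial_spectrum.intro trivial_spectrum_axioms.intro assms(1))
  interpret fin_projector P by (rule assms(1))
  show "lin_subspace (skew_ops P b)"
    by (rule lin_subspaceI)
       (auto simp: skew_ops_def linear_0[OF lin_P] linear_add[OF lin_P] linear_scale[OF lin_P]
         plus_fun_def zero_fun_def scaleR_fun_def real_vector.module_hom_add bilin_simps[OF assms(2)]
         real_vector.module_hom_scale real_vector.module_hom_zero)
  fix M assume M: "M \<in> skew_ops P b"
  then show "linear M" "\<And>v. P (M v) = M v" "\<And>v. M (P v) = M v" by (auto simp: skew_ops_def)
  fix v assume "M v = v"
  moreover have "P (M v) = M v" "P v = v \<longrightarrow> b v (M v) = 0" using M unfolding skew_ops_def by auto
  ultimately have "P v = v" "b v v = 0" by simp_all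
  then show "v = 0" using assms(3) unfolding definite_on_def by blast
qed

text \<open>The rank two operator that sends \<open>z\<close> to \<open>b z u\<close> times
  \<open>w\<close> minus \<open>b z w\<close> times \<open>u\<close> is skew for any bilinear form.
  Divided by \<open>b u u\<close> it maps \<open>u\<close> to \<open>w\<close>. So orthogonality to
  \<open>u\<close> is the only restriction on the value of a skew operator at a nonzero
  \<open>u\<close>.\<close>

lemma skew_ops_transitive:
  assumes "fin_projector P" "bilin b" "definite_on P b" "P u = u" "P w = w" "u \<noteq> 0" "b u w = 0"
  obtains N where "N \<in> skew_ops P b" "N u = w"
proof -
  interpret fin_projector P by (rule assms(1))
  note bs = bilin_simps[OF assms(2)]
  have uu: "b u u \<noteq> 0" using assms(3,4,6) unfolding definite_on_def by blast
  define N where "N z = (b (P z) u / b u u) *\<^sub>R w - (b (P z) w / b u u) *\<^sub>R u" for z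
  have "linear N" unfolding N_def
    by (rule linearI)
       (simp_all add: linear_add[OF lin_P] linear_scale[OF lin_P] bs add_divide_distrib algebra_simps)
  then have "N \<in> skew_ops P b"
    by (auto simp: skew_ops_def N_def linear_diff[OF lin_P] linear_scale[OF lin_P] assms(4,5) idem_P bs)
  moreover have "N u = w" using uu assms(4,7) by (simp add: N_def)
  ultimately show ?thesis by (rule that)
qed

section \<open>From the hyperplane of values at \<open>x\<close> back to the whole space\<close>

locale hyperplane_split = max_trivial_spectrum P V for P :: "'a::real_vector \<Rightarrow> 'a" and V +
  fixes x :: 'a and \<phi> :: "'a \<Rightarrow> real" and Q :: "'a \<Rightarrow> 'a" and U :: "('a \<Rightarrow> 'a) set"
  assumes Q_def: "Q = (\<lambda>v. P v - \<phi> v *\<^sub>R x)" and U_def: "U = {M \<in> V. M x = 0}"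
    and Px: "P x = x" and lin_\<phi>: "linear \<phi>" and \<phi>P: "\<phi> (P v) = \<phi> v" and \<phi>x: "\<phi> x = 1"
    and Vx: "(\<lambda>M. M x) ` V = {v \<in> range P. \<phi> v = 0}"
    and \<phi>U: "M \<in> V \<Longrightarrow> M x = 0 \<Longrightarrow> \<phi> (M v) = 0"
    and max_U: "max_trivial_spectrum Q U"
begin

sublocale U: max_trivial_spectrum Q U by (rule max_U)

lemma P_eq: "P v = Q v + \<phi> v *\<^sub>R x"
  by (simp add: Q_def)

lemma \<phi>Q: "\<phi> (Q v) = 0" and Qx: "Q x = 0"
  by (simp_all add: Q_def linear_diff[OF lin_\<phi>] linear_scale[OF lin_\<phi>] \<phi>P \<phi>x Px)

lemma PQ: "P (Q v) = Q v" and QP: "Q (P v) = Q v"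
  by (simp_all add: Q_def linear_diff[OF lin_P] linear_scale[OF lin_P] idem_P Px \<phi>P)

lemma Q_fixed_iff: "Q v = v \<longleftrightarrow> P v = v \<and> \<phi> v = 0"
  by (metis PQ P_eq \<phi>Q add.right_neutral scaleR_zero_left)

lemma Vx_iff: "Q v = v \<longleftrightarrow> (\<exists>M\<in>V. v = M x)"
proof -
  have "v \<in> (\<lambda>M. M x) ` V \<longleftrightarrow> v \<in> {v \<in> range P. \<phi> v = 0}" unfolding Vx ..
  then show ?thesis by (auto simp: Q_fixed_iff in_range_iff)
qed

text \<open>Let \<open>M x \<notin> G\<close> and \<open>t \<noteq> 0\<close>. If \<open>w - t M w = g \<in> G\<close>, then \<open>w \<in> G + \<real> x\<close>, since otherwise a rank one
  operator in \<open>U\<close> that maps \<open>w\<close> to \<open>g\<close> could be added to \<open>t M\<close> to fix \<open>w\<close>. Hence the preimage of \<open>G\<close> under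
  \<open>1 - t M\<close> is the space of all \<open>w \<in> G + \<real> x\<close> with \<open>M w \<in> G + \<real> x\<close>, whatever \<open>t\<close> is, and comparing \<open>t = 1\<close>
  with \<open>t = 2\<close> identifies it with \<open>G\<close>.\<close>

lemma invariant_of_reduced:
  assumes G: "lin_subspace G" "G \<subseteq> range Q" "G \<noteq> range Q"
    and inv: "\<forall>M\<in>U. \<forall>v\<in>G. M v \<in> G"
    and M: "M \<in> V" and v: "v \<in> G"
  shows "M v \<in> G"
proof -
  obtain \<gamma> \<delta> where fp\<gamma>: "fin_projector \<gamma>" and r\<gamma>: "range \<gamma> = G" and dec: "\<forall>v. Q v = \<gamma> v + \<delta> v"
    and \<gamma>\<delta>: "\<forall>v. \<gamma> (\<delta> v) = 0" and \<delta>\<gamma>: "\<forall>v. \<delta> (\<gamma> v) = 0"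
    and "dim (range Q) = dim (range \<gamma>) + dim (range \<delta>)"
    and "max_trivial_spectrum \<gamma> ((\<lambda>M v. M (\<gamma> v)) ` U)"
    and m\<delta>: "max_trivial_spectrum \<delta> ((\<lambda>M v. \<delta> (M (\<delta> v))) ` U)"
    and all: "\<forall>X. linear X \<and> (\<forall>v. \<gamma> (X v) = X v) \<and> (\<forall>v. X (\<delta> v) = X v) \<longrightarrow>
       (\<forall>M\<in>U. \<forall>N\<in>U. (\<lambda>v. M (\<gamma> v) + \<delta> (N (\<delta> v)) + X v) \<in> U)"
    by (rule U.invariant_subspace_split[OF G(1,2) inv])
  note dec = dec[rule_format] and \<gamma>\<delta> = \<gamma>\<delta>[rule_format] and \<delta>\<gamma> = \<delta>\<gamma>[rule_format]
  interpret \<gamma>: fin_projector \<gamma> by (rule fp\<gamma>)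
  interpret \<delta>: max_trivial_spectrum \<delta> "(\<lambda>M v. \<delta> (M (\<delta> v))) ` U" by (rule m\<delta>)
  have inG: "v \<in> G \<longleftrightarrow> \<gamma> v = v" for v using \<gamma>.in_range_iff r\<gamma> by simp
  have \<delta>G: "\<delta> v = 0" if "v \<in> G" for v using that inG \<delta>\<gamma> by metis
  have GP: "P v = v" "\<phi> v = 0" if "v \<in> G" for v
    using that G(2) U.in_range_iff Q_fixed_iff by blast+
  have inG': "v \<in> G" if "P v = v" "\<phi> v = 0" "\<delta> v = 0" for v
    using that dec[of v] Q_fixed_iff[of v] inG[of v] by (metis add.right_neutral)
  have \<delta>x: "\<delta> x = 0"
  proof -
    have "\<delta> (Q x) = \<delta> (\<gamma> x) + \<delta> (\<delta> x)" unfolding dec by (rule linear_add[OF \<delta>.lin_P])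
    then show ?thesis by (simp add: Qx linear_0[OF \<delta>.lin_P] \<delta>\<gamma> \<delta>.idem_P)
  qed
  \<comment> \<open>Since \<open>U\<close> is maximal on \<open>range Q\<close>, it contains every
    map from the quotient by \<open>G\<close> into \<open>G\<close>. Such a map factors through
    \<open>\<delta>\<close>, so it vanishes on \<open>G\<close> and at \<open>x\<close>.\<close>
  have HomV: "X \<in> V" if "linear X" "\<And>v. \<gamma> (X v) = X v" "\<And>v. X (\<delta> v) = X v" for X
  proof -
    have "(\<lambda>v. (\<lambda>_. 0) (\<gamma> v) + \<delta> ((\<lambda>_. 0) (\<delta> v)) + X v) \<in> U"
      by (rule all[rule_format]) (use that U.zero_V in auto)
    then show ?thesis by (simp add: linear_0[OF \<delta>.lin_P] U_def)
  qed
  have key: "M v \<in> G" if M: "M \<in> V" "M x \<notin> G" and v: "v \<in> G" for M v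
  proof -
    note linM = lin_V[OF M(1)]
    \<comment> \<open>\<open>GX\<close> is the sum of \<open>G\<close> and the line of
      \<open>x\<close>, because within \<open>range P\<close> this is where \<open>\<delta>\<close>
      vanishes; \<open>K\<close> consists of the vectors of \<open>GX\<close> that \<open>M\<close>
      maps back into \<open>GX\<close>.\<close>
    define GX where "GX = {w \<in> range P. \<delta> w = 0}"
    define K where "K = {w \<in> GX. \<delta> (M w) = 0}"
    have sGX: "lin_subspace GX" unfolding GX_def by (rule lin_subspace_kernel[OF \<delta>.lin_P sub_P])
    have fGX: "fds GX" by (rule fds_subset(1)[OF fds_P sGX]) (auto simp: GX_def)
    have l\<delta>M: "linear (\<lambda>w. \<delta> (M w))"
      by (rule linearI) (simp_all add: linear_add linear_scale linM \<delta>.lin_P)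
    have sK: "lin_subspace K" unfolding K_def by (rule lin_subspace_kernel[OF l\<delta>M sGX])
    have fK: "fds K" by (rule fds_subset(1)[OF fGX sK]) (auto simp: K_def)
    have "\<delta> (M x) \<noteq> 0"
    proof
      assume "\<delta> (M x) = 0"
      moreover have "P (M x) = M x" "\<phi> (M x) = 0" using Vx_iff[of "M x"] M(1) Q_fixed_iff by auto
      ultimately show False using inG' M(2) by blast
    qed
    then have xK: "x \<notin> K" by (simp add: K_def)
    have xGX: "x \<in> GX" using \<delta>x Px by (simp add: GX_def in_range_iff)
    have "{w \<in> GX. \<phi> w = 0} = G"
      using inG' GP \<delta>G by (auto simp: GX_def in_range_iff)
    then have dGX: "dim GX = Suc (dim G)"
      using dim_functional_kernel[OF lin_\<phi> fGX xGX] \<phi>x by simp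
    have "dim K \<noteq> dim GX" using fds_dim_eq[OF fGX sK] xK xGX by (auto simp: K_def)
    moreover have "dim K \<le> dim GX" by (rule fds_subset(2)[OF fGX sK]) (auto simp: K_def)
    ultimately have dK: "dim K \<le> dim G" using dGX by simp
    \<comment> \<open>The preimage of \<open>G\<close> under the bijection \<open>1 - t M\<close>
      has the dimension of \<open>G\<close>, while \<open>K\<close> is a proper subspace of
      \<open>GX\<close> and has at most that dimension. So the inclusion of the preimage in
      \<open>K\<close> gives equality, and \<open>K\<close> does not involve
      \<open>t\<close>.\<close>
    have KS: "K = {w \<in> range P. w - t *\<^sub>R M w \<in> G} \<and> dim K = dim G" if t: "t \<noteq> 0" for t
    proof -
      let ?D = "\<lambda>w. w - t *\<^sub>R M w"
      let ?S = "{w \<in> range P. ?D w \<in> G}"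
      have linD: "linear ?D" by (rule linearI) (simp_all add: linear_add[OF linM] linear_scale[OF linM] algebra_simps)
      have sS: "lin_subspace ?S"
        using sub_P G(1) by (intro lin_subspaceI)
          (auto simp only: mem_Collect_eq linear_0[OF linD] linear_add[OF linD] linear_scale[OF linD]
            intro: lin_subspace_0 lin_subspace_add lin_subspace_scale)
      have fS: "fds ?S" by (rule fds_subset(1)[OF fds_P sS]) auto
      have inj: "w = 0" if "?D w = 0" for w using no_fix[OF scale_V[OF M(1), of t], of w] that by simp
      have "?D ` ?S = G"
      proof
        show "G \<subseteq> ?D ` ?S"
        proof
          fix g assume g: "g \<in> G"
          obtain w where "P w = w" "?D w = g" using resolvent[OF M(1) GP(1)[OF g]] by metis
          then have "w \<in> ?S" "g = ?D w" using g by (auto simp: in_range_iff)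
          then show "g \<in> ?D ` ?S" by (rule rev_image_eqI)
        qed
      qed auto
      then have dS: "dim G = dim ?S" using dim_image_inj[OF linD fS inj] by simp
      have "?S \<subseteq> K"
      proof
        fix w assume "w \<in> ?S"
        then have w: "P w = w" "?D w \<in> G" by (auto simp: in_range_iff)
        have \<delta>w: "\<delta> w = 0"
        proof (rule ccontr)
          assume nz: "\<delta> w \<noteq> 0"
          obtain \<psi> where \<psi>: "linear \<psi>" "\<psi> (\<delta> w) = (1::real)"
            using separating_functional[of "{0}" "\<delta> w"] nz fds_lin_subspace[OF fds_zero(1)] by blast
          define X where "X v = \<psi> (\<delta> v) *\<^sub>R ?D w" for v
          have "X \<in> V"
          proof (rule HomV)
            show "linear X" unfolding X_def
              by (rule linearI) (simp_all add: linear_add linear_scale \<psi>(1) \<delta>.lin_P algebra_simps)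
            show "\<gamma> (X v) = X v" for v
              using w(2) unfolding inG X_def by (simp only: linear_scale[OF \<gamma>.lin_P])
            show "X (\<delta> v) = X v" for v by (simp add: X_def \<delta>.idem_P)
          qed
          then have "(\<lambda>v. X v + t *\<^sub>R M v) \<in> V" using scale_V[OF M(1)] by (rule add_V)
          moreover have "X w + t *\<^sub>R M w = w" by (simp add: X_def \<psi>)
          ultimately have "w = 0" by (rule no_fix)
          then show False using nz linear_0[OF \<delta>.lin_P] by simp
        qed
        have "\<delta> (?D w) = 0" using \<delta>G w(2) .
        then have "\<delta> (M w) = 0" using \<delta>w t
          by (simp add: linear_diff[OF \<delta>.lin_P] linear_scale[OF \<delta>.lin_P])
        then show "w \<in> K" using w(1) \<delta>w by (simp add: K_def GX_def in_range_iff)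
      qed
      then have "?S = K" by (rule fds_dim_eq[OF fK sS]) (use dK dS in simp)
      then show ?thesis using dS by simp
    qed
    have "w \<in> G" if "w \<in> K" for w
    proof -
      have "w - 1 *\<^sub>R M w \<in> G" "w - 2 *\<^sub>R M w \<in> G" using that KS[of 1] KS[of 2] by auto
      then have "2 *\<^sub>R (w - 1 *\<^sub>R M w) - (w - 2 *\<^sub>R M w) \<in> G"
        by (rule lin_subspace_diff[OF G(1) lin_subspace_scale[OF G(1)]])
      then show ?thesis by (simp add: algebra_simps scaleR_2)
    qed
    moreover have "fds G" using \<gamma>.fds_P r\<gamma> by simp
    ultimately have "K = G" using fds_dim_eq[of G K] sK KS[of 1] by (metis order_refl subsetI zero_neq_one)
    then have "v - 1 *\<^sub>R M v \<in> G" using v KS[of 1] by auto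
    then have "v - (v - 1 *\<^sub>R M v) \<in> G" using v G(1) lin_subspace_diff by blast
    then show ?thesis by simp
  qed
  show ?thesis
  proof (cases "M x \<in> G")
    case True
    \<comment> \<open>An operator with \<open>M x \<in> G\<close> is the difference of two operators
      whose values at \<open>x\<close> lie outside \<open>G\<close>, to which \<open>key\<close>
      applies.\<close>
    obtain h where h: "h \<in> range Q" "h \<notin> G" using G(2,3) by blast
    then obtain M0 where M0: "M0 \<in> V" "M0 x = h" using Vx_iff[of h] U.in_range_iff by metis
    have "M x + M0 x \<notin> G"
    proof
      assume "M x + M0 x \<in> G"
      then have "M x + M0 x - M x \<in> G" using True G(1) lin_subspace_diff by blast
      then show False using h M0 by simp
    qed
    then have "M v + M0 v \<in> G" using key[OF add_V[OF M M0(1)] _ v] by blast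
    moreover have "M0 v \<in> G" using key[OF M0(1) _ v] h M0 by simp
    ultimately have "M v + M0 v - M0 v \<in> G" using G(1) lin_subspace_diff by blast
    then show ?thesis by simp
  next
    case False
    then show ?thesis using key M v by blast
  qed
qed

end

context hyperplane_split
begin

lemma section_exists:
  obtains g where "linear g" "\<And>v. g v \<in> V" "\<And>v. Q v = v \<Longrightarrow> g v x = v"
proof -
  have ev: "linear (\<lambda>M::'a\<Rightarrow>'a. M x)" by (rule linearI) auto
  have "\<exists>g. range g \<subseteq> V \<and> linear g \<and> (\<forall>v\<in>(\<lambda>M. M x) ` V. g v x = v)"
    by (rule real_vector.linear_exists_right_inverse_on[OF ev sub_V[unfolded lin_subspace_iff span_eq_iff]])
  then obtain g :: "'a \<Rightarrow> 'a \<Rightarrow> 'a" where "range g \<subseteq> V \<and> linear g \<and> (\<forall>v\<in>(\<lambda>M. M x) ` V. g v x = v)"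
    by (rule exE)
  then have g: "linear g" "range g \<subseteq> V" "\<forall>v\<in>(\<lambda>M. M x) ` V. g v x = v" by simp_all
  have "g v x = v" if "Q v = v" for v
    using g(3) that unfolding Vx by (simp add: Q_fixed_iff in_range_iff)
  then show ?thesis using that[of g] g by blast
qed

lemma U_iff: "M \<in> U \<longleftrightarrow> M \<in> V \<and> M x = 0"
  by (simp add: U_def)

end

text \<open>Each \<open>M \<in> V\<close> is \<open>g (M x)\<close> plus a \<open>q\<close>-skew
  operator of the hyperplane. What remains unknown, for \<open>u\<close> and \<open>h\<close> in the
  hyperplane, is the component \<open>\<phi> (g h u)\<close> along \<open>x\<close> and the part
  \<open>Q (g h u)\<close>; the latter is controlled through \<open>q u (Q (g h u))\<close>, which
  is unaffected by skew operators.\<close>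

locale skew_reduced = hyperplane_split P V x \<phi> Q U
  for P :: "'a::real_vector \<Rightarrow> 'a" and V x \<phi> Q U +
  fixes q :: "'a \<Rightarrow> 'a \<Rightarrow> real" and g :: "'a \<Rightarrow> 'a \<Rightarrow> 'a"
  assumes bil: "bilin q" and dfn: "definite_on Q q" and U_skew: "U = skew_ops Q q"
    and lin_g: "linear g" and gV: "g v \<in> V" and gx: "Q v = v \<Longrightarrow> g v x = v"
begin

lemmas qs = bilin_simps[OF bil]

lemma q_nz: "Q u = u \<Longrightarrow> u \<noteq> 0 \<Longrightarrow> q u u \<noteq> 0"
  using dfn unfolding definite_on_def by blast

lemma gs: "g (a + b) v = g a v + g b v" "g (a - b) v = g a v - g b v" "g (c *\<^sub>R a) v = c *\<^sub>R g a v"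
  "g v (a + b) = g v a + g v b" "g v (a - b) = g v a - g v b" "g v (c *\<^sub>R a) = c *\<^sub>R g v a"
  by (simp_all add: linear_add[OF lin_g] linear_diff[OF lin_g] linear_scale[OF lin_g]
      linear_add[OF lin_V[OF gV]] linear_diff[OF lin_V[OF gV]] linear_scale[OF lin_V[OF gV]])

lemmas fs = linear_add[OF lin_\<phi>] linear_diff[OF lin_\<phi>] linear_scale[OF lin_\<phi>]

lemmas Qs = linear_add[OF U.lin_P] linear_diff[OF U.lin_P] linear_scale[OF U.lin_P]

text \<open>Otherwise \<open>g h\<close> plus a suitable skew operator fixes \<open>\<phi> (g h u) x + u\<close>.\<close>

lemma no_solution:
  assumes u: "Q u = u" "u \<noteq> 0" and h: "Q h = h"
  shows "\<phi> (g h u) * q u h + q u (Q (g h u)) \<noteq> q u u"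
proof
  assume eq: "\<phi> (g h u) * q u h + q u (Q (g h u)) = q u u"
  define w where "w = u - \<phi> (g h u) *\<^sub>R h - Q (g h u)"
  have w: "Q w = w" by (simp add: w_def Qs u h U.idem_P)
  \<comment> \<open>The excluded equation is precisely the orthogonality under which some skew
    operator maps \<open>u\<close> to \<open>w\<close>.\<close>
  have "q u w = 0" using eq by (simp add: w_def qs)
  then obtain N where N: "N \<in> U" "N u = w"
    using skew_ops_transitive[OF U.fin_projector_axioms bil dfn u(1) w u(2)] unfolding U_skew by metis
  have NV: "N \<in> V" "N x = 0" using N(1) U_iff by auto
  define v where "v = \<phi> (g h u) *\<^sub>R x + u"
  have "g h u = Q (g h u) + \<phi> (g h u) *\<^sub>R x"
    using P_eq[of "g h u"] ran_V[OF gV] by simp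
  moreover have "N v = w" using NV N(2)
    by (simp add: v_def linear_add[OF lin_V[OF NV(1)]] linear_scale[OF lin_V[OF NV(1)]])
  moreover have "g h v = \<phi> (g h u) *\<^sub>R h + g h u" by (simp add: v_def gs gx[OF h])
  moreover have "a + k + w' = f + u'" if "k = b + f" "w' = u' - a - b" for a k w' f u' b :: 'a
    using that by simp
  ultimately have "g h v + N v = v" unfolding v_def w_def by metis
  then have "v = 0" using no_fix[OF add_V[OF gV NV(1)]] by blast
  then have "Q v = 0" using linear_0[OF U.lin_P] by simp
  then show False using u by (simp add: v_def Qs Qx)
qed

text \<open>For fixed \<open>u\<close>, the three terms \<open>\<phi> (g h u)\<close>,
  \<open>q u (Q (g h u))\<close> and \<open>q u h\<close> are linear in \<open>h\<close>, and by
  \<open>no_solution\<close> the first times the third plus the second never equals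
  \<open>q u u\<close>. If the first or the second did not vanish on the kernel of the third, moving
  \<open>h\<close> along that kernel would produce this value.\<close>

lemma proportional:
  assumes u: "Q u = u" "u \<noteq> 0"
  obtains k r where "\<forall>h. Q h = h \<longrightarrow> \<phi> (g h u) = k * q u h \<and> q u (Q (g h u)) = r * q u h"
proof -
  have quu: "q u u \<noteq> 0" using q_nz u by blast
  define h1 where "h1 = (1 / q u u) *\<^sub>R u"
  have h1: "Q h1 = h1" "q u h1 = 1" using u quu by (simp_all add: h1_def Qs qs)
  define a1 where "a1 = \<phi> (g h1 u)"
  define r1 where "r1 = q u (Q (g h1 u))"
  have ker: "\<phi> (g h0 u) = 0 \<and> q u (Q (g h0 u)) = 0" if h0: "Q h0 = h0" "q u h0 = 0" for h0
  proof -
    define a0 where "a0 = \<phi> (g h0 u)"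
    define r0 where "r0 = q u (Q (g h0 u))"
    have "a0 = 0"
    proof (rule ccontr)
      assume nz: "a0 \<noteq> 0"
      \<comment> \<open>For \<open>h = s h0 + \<tau> h1\<close> the forbidden expression is affine
        in \<open>s\<close> with slope \<open>\<tau> a0 + r0\<close>. This choice makes the slope 1,
        and \<open>s\<close> is then the solution of the excluded equation.\<close>
      define \<tau> where "\<tau> = (1 - r0) / a0"
      have \<tau>: "\<tau> * a0 + r0 = 1" using nz by (simp add: \<tau>_def)
      define s where "s = q u u - \<tau> * \<tau> * a1 - \<tau> * r1"
      define h where "h = s *\<^sub>R h0 + \<tau> *\<^sub>R h1"
      have "Q h = h" by (simp add: h_def Qs h0 h1)
      moreover have "q u h = \<tau>" by (simp add: h_def qs h0 h1)
      moreover have "\<phi> (g h u) = s * a0 + \<tau> * a1" by (simp add: h_def gs fs a0_def a1_def)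
      moreover have "q u (Q (g h u)) = s * r0 + \<tau> * r1" by (simp add: h_def gs Qs qs r0_def r1_def)
      moreover have "(s * a0 + \<tau> * a1) * \<tau> + (s * r0 + \<tau> * r1) = s * (\<tau> * a0 + r0) + \<tau> * \<tau> * a1 + \<tau> * r1"
        by (simp add: algebra_simps)
      then have "(s * a0 + \<tau> * a1) * \<tau> + (s * r0 + \<tau> * r1) = q u u" unfolding \<tau> by (simp add: s_def)
      ultimately show False using no_solution[OF u, of h] by simp
    qed
    moreover have "r0 = 0"
    proof (rule ccontr)
      assume nz: "r0 \<noteq> 0"
      define h where "h = (q u u / r0) *\<^sub>R h0"
      have "Q h = h" by (simp add: h_def Qs h0)
      moreover have "q u h = 0" by (simp add: h_def qs h0)
      moreover have "q u (Q (g h u)) = q u u" using nz by (simp add: h_def gs Qs qs r0_def[symmetric])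
      ultimately show False using no_solution[OF u, of h] by simp
    qed
    ultimately show ?thesis by (simp add: a0_def r0_def)
  qed
  have "\<phi> (g h u) = a1 * q u h \<and> q u (Q (g h u)) = r1 * q u h" if h: "Q h = h" for h
  proof -
    define h0 where "h0 = h - q u h *\<^sub>R h1"
    have "Q h0 = h0" "q u h0 = 0" by (simp_all add: h0_def Qs qs h h1)
    then have "\<phi> (g h0 u) = 0" "q u (Q (g h0 u)) = 0" using ker by auto
    then show ?thesis by (simp add: h0_def gs fs Qs qs a1_def r1_def)
  qed
  then show ?thesis using that by blast
qed

text \<open>Supplies one \<open>h\<close> at which proportionality factors belonging to several
  \<open>u\<close> can be compared by cancelling \<open>q u h\<close>.\<close>

lemma common_nonzero:
  assumes "finite I" "\<forall>u\<in>I. Q u = u \<and> u \<noteq> 0"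
  shows "\<exists>h. Q h = h \<and> (\<forall>u\<in>I. q u h \<noteq> 0)"
proof -
  have "\<exists>h\<in>range Q. \<forall>u\<in>I. q u h \<noteq> 0"
  proof (rule functionals_avoid[OF assms(1) U.sub_P])
    fix u assume "u \<in> I"
    then have u: "Q u = u" "u \<noteq> 0" using assms(2) by auto
    have "linear (q u)" using bil by (simp add: bilin_def)
    moreover have "u \<in> range Q" using u U.in_range_iff by blast
    ultimately show "linear (q u) \<and> (\<exists>z\<in>range Q. q u z \<noteq> 0)" using q_nz[OF u] by blast
  qed
  then show ?thesis using U.in_range_iff by blast
qed

text \<open>Each \<open>u\<close> has its own factor by \<open>proportional\<close>. To compare
  \<open>u\<close> with \<open>u0\<close>, a combination \<open>v\<close> of both is made orthogonal
  to \<open>h'\<close>; then \<open>\<phi> (g h' v)\<close> vanishes, which equates the factors. On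
  the zero space any factor will do, and the value 1 reserves \<open>k = 0\<close> for the case of a
  nonzero invariant hyperplane.\<close>

lemma coefficient:
  obtains k where "\<forall>u h. Q u = u \<longrightarrow> Q h = h \<longrightarrow> \<phi> (g h u) = k * q u h"
    "range Q = {0} \<longrightarrow> k = 1"
proof (cases "range Q = {0}")
  case True
  then have "u = 0" if "Q u = u" for u using that U.in_range_iff by blast
  then have "\<forall>u h. Q u = u \<longrightarrow> Q h = h \<longrightarrow> \<phi> (g h u) = 1 * q u h"
    by (metis linear_0 lin_\<phi> lin_V gV qs(7) mult_zero_right)
  then show ?thesis using that by blast
next
  case False
  then obtain u0 where u0: "Q u0 = u0" "u0 \<noteq> 0"
    using U.in_range_iff lin_subspace_0[OF U.sub_P] by blast
  obtain k where k: "\<And>h. Q h = h \<Longrightarrow> \<phi> (g h u0) = k * q u0 h" using proportional[OF u0] by metis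
  have z: "\<phi> (g h v) = 0" if "Q v = v" "Q h = h" "q v h = 0" for v h
  proof (cases "v = 0")
    case True
    then show ?thesis using linear_0[OF lin_V[OF gV]] linear_0[OF lin_\<phi>] by simp
  next
    case False
    then show ?thesis using proportional[OF that(1) False] that by (metis mult_zero_right)
  qed
  have "\<phi> (g h u) = k * q u h" if u: "Q u = u" and h: "Q h = h" for u h
  proof (cases "u = 0")
    case True
    then show ?thesis using linear_0[OF lin_V[OF gV]] linear_0[OF lin_\<phi>] by (simp add: qs)
  next
    case False
    obtain k' where k': "\<And>h. Q h = h \<Longrightarrow> \<phi> (g h u) = k' * q u h" using proportional[OF u False] by metis
    obtain h' where h': "Q h' = h'" "q u h' \<noteq> 0" "q u0 h' \<noteq> 0"
      using common_nonzero[of "{u, u0}"] u u0 False by auto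
    define v where "v = q u0 h' *\<^sub>R u - q u h' *\<^sub>R u0"
    have "Q v = v" "q v h' = 0" by (simp_all add: v_def Qs qs u u0)
    then have "\<phi> (g h' v) = 0" using z h'(1) by blast
    then have "q u0 h' * (k' * q u h') = q u h' * (k * q u0 h')"
      using k[OF h'(1)] k'[OF h'(1)] by (simp add: v_def gs fs)
    then have "k' = k" using h' by simp
    then show ?thesis using k'[OF h] by simp
  qed
  then show ?thesis using that[of k] False by blast
qed

text \<open>The left side is quadratic in \<open>u\<close> and \<open>q u h\<close> is linear, so
  the factor has degree one; at \<open>u = 0\<close> it is set to 0. For additivity,
  \<open>v = l' u - l u'\<close> is orthogonal to \<open>h\<close>, so the quadratic expression
  vanishes at \<open>v\<close>, and this determines its mixed term \<open>C\<close>.\<close>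

lemma linear_ratio:
  obtains R where "linear (\<lambda>v. R (Q v))" "\<forall>u h. Q u = u \<longrightarrow> Q h = h \<longrightarrow> q u (Q (g h u)) = R u * q u h"
proof -
  have "\<exists>r. u \<noteq> 0 \<longrightarrow> Q u = u \<longrightarrow> (\<forall>h. Q h = h \<longrightarrow> q u (Q (g h u)) = r * q u h)" for u
    using proportional[of u] by metis
  then obtain r where r: "\<And>u h. u \<noteq> 0 \<Longrightarrow> Q u = u \<Longrightarrow> Q h = h \<Longrightarrow> q u (Q (g h u)) = r u * q u h"
    by metis
  define R where "R u = (if u = 0 then 0 else r u)" for u
  have R: "q u (Q (g h u)) = R u * q u h" if "Q u = u" "Q h = h" for u h
    using r[of u h] that by (simp add: R_def qs)
  have R0: "R 0 = 0" by (simp add: R_def)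
  have Rsc: "R (c *\<^sub>R u) = c * R u" if u: "Q u = u" for c u
  proof (cases "c = 0 \<or> u = 0")
    case False
    then obtain h where h: "Q h = h" "q u h \<noteq> 0" using common_nonzero[of "{u}"] u by auto
    have "R (c *\<^sub>R u) * q (c *\<^sub>R u) h = c * c * (R u * q u h)"
      using R[of "c *\<^sub>R u" h] R[OF u h(1)] u h(1) by (auto simp: Qs gs qs)
    then show ?thesis using False h by (simp add: qs)
  qed (auto simp: R0)
  have Radd: "R (u + u') = R u + R u'" if u: "Q u = u" and u': "Q u' = u'" for u u'
  proof (cases "u = 0 \<or> u' = 0 \<or> u + u' = 0")
    case True
    then consider "u = 0" | "u' = 0" | "u' = (-1) *\<^sub>R u" 
      by (metis minus_unique scaleR_minus1_left)
    then show ?thesis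
    proof cases
      case 3
      then show ?thesis using Rsc[OF u, of "-1"] by (simp add: R0)
    qed (simp_all add: R0)
  next
    case False
    have uu': "Q (u + u') = u + u'" by (simp add: Qs u u')
    obtain h where h: "Q h = h" "q u h \<noteq> 0" "q u' h \<noteq> 0" "q (u + u') h \<noteq> 0"
      using common_nonzero[of "{u, u', u + u'}"] u u' uu' False by auto
    define l where "l = q u h"
    define l' where "l' = q u' h"
    define C where "C = q u (Q (g h u')) + q u' (Q (g h u))"
    have S: "q u (Q (g h u)) = R u * l" "q u' (Q (g h u')) = R u' * l'"
      using R[OF u h(1)] R[OF u' h(1)] by (simp_all add: l_def l'_def)
    define v where "v = l' *\<^sub>R u - l *\<^sub>R u'"
    have "Q v = v" "q v h = 0" by (simp_all add: v_def Qs qs u u' l_def l'_def)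
    then have "q v (Q (g h v)) = 0" using R[of v h] h(1) by simp
    then have "l' * l' * (R u * l) + l * l * (R u' * l') - l * l' * C = 0"
      by (simp add: v_def gs Qs qs S C_def algebra_simps)
    then have "l * l' * (l' * R u + l * R u' - C) = 0" by (simp add: algebra_simps)
    then have C: "C = l' * R u + l * R u'" using h by (simp add: l_def l'_def)
    have "R (u + u') * (l + l') = R u * l + R u' * l' + C"
      using R[OF uu' h(1)] S by (simp add: Qs gs qs l_def l'_def C_def)
    then have "(R (u + u') - (R u + R u')) * (l + l') = 0" by (simp add: C algebra_simps)
    then show ?thesis using h(4) by (simp add: qs l_def l'_def)
  qed
  have "linear (\<lambda>v. R (Q v))"
    by (rule linearI) (simp_all add: Qs Radd Rsc U.idem_P)
  then show ?thesis using that R by blast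
qed

lemma decompose:
  assumes "M \<in> V"
  shows "(\<lambda>v. M v - g (M x) v) \<in> U"
proof -
  have "Q (M x) = M x" using Vx_iff[of "M x"] assms by blast
  then show ?thesis using diff_V[OF assms gV, of "M x"] gx[of "M x"] by (simp add: U_iff)
qed

lemma invariant_or_skew:
  "(range Q \<noteq> {0} \<and> (\<forall>M\<in>V. \<forall>v\<in>range Q. M v \<in> range Q)) \<or>
   (\<exists>b. bilin b \<and> definite_on P b \<and> V = skew_ops P b)"
proof -
  obtain k where k: "\<And>u h. Q u = u \<Longrightarrow> Q h = h \<Longrightarrow> \<phi> (g h u) = k * q u h"
    and k1: "range Q = {0} \<Longrightarrow> k = 1" using coefficient by metis
  obtain R where linR: "linear (\<lambda>v. R (Q v))"
    and R: "\<And>u h. Q u = u \<Longrightarrow> Q h = h \<Longrightarrow> q u (Q (g h u)) = R u * q u h" using linear_ratio by metis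
  have Mx: "Q (M x) = M x" if "M \<in> V" for M using that Vx_iff by blast
  have \<phi>M: "\<phi> (M v) = \<phi> (g (M x) v)" if "M \<in> V" for M v
  proof -
    have "\<phi> (M v - g (M x) v) = 0"
      using decompose[OF that] \<phi>U[of "\<lambda>v. M v - g (M x) v"] U_iff by blast
    then show ?thesis by (simp add: fs)
  qed
  show ?thesis
  proof (cases "k = 0")
    case True
    then have "range Q \<noteq> {0}" using k1 by force
    moreover have "M v \<in> range Q" if M: "M \<in> V" and v: "v \<in> range Q" for M v
    proof -
      have "\<phi> (M v) = 0" using \<phi>M[OF M] k[OF _ Mx[OF M], of v] True v U.in_range_iff by simp
      then show ?thesis using ran_V[OF M] U.in_range_iff Q_fixed_iff by simp
    qed
    ultimately show ?thesis by blast
  next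
    case False
    \<comment> \<open>For \<open>M \<in> V\<close>, \<open>h = M x\<close> and
      \<open>u = Q v\<close> one has \<open>\<phi> (M v) = k * q u h\<close> and
      \<open>q u (Q (M v)) = (\<phi> v + R u) * q u h\<close>. Eliminating \<open>q u h\<close>
      leaves a bilinear relation between \<open>v\<close> and \<open>M v\<close>, namely
      \<open>b v (M v) = 0\<close>.\<close>
    define b where "b z z' = q (Q z) (Q z') - (1 / k) * (\<phi> z + R (Q z)) * \<phi> z'" for z z'
    have bilb: "bilin b"
      unfolding bilin_def b_def
      by (auto intro!: linearI simp: Qs qs fs linear_add[OF linR, simplified Qs]
          linear_scale[OF linR, simplified Qs] algebra_simps add_divide_distrib)
    have defb: "definite_on P b"
      unfolding definite_on_def
    proof (intro allI impI)
      fix z assume z: "P z = z" "b z z = 0"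
      define u where "u = Q z"
      have Qu: "Q u = u" by (simp add: u_def U.idem_P)
      have eq: "q u u = (1 / k) * (\<phi> z + R u) * \<phi> z" using z(2) by (simp add: b_def u_def)
      have "u = 0"
      proof (rule ccontr)
        assume nz: "u \<noteq> 0"
        have quu: "q u u \<noteq> 0" using q_nz Qu nz by blast
        \<comment> \<open>Scaled so that \<open>q u h = \<phi> z / k\<close>. With this
          \<open>h\<close> the relation \<open>b z z = 0\<close> becomes the equation excluded by
          \<open>no_solution\<close>.\<close>
        define h where "h = (\<phi> z / k / q u u) *\<^sub>R u"
        have h: "Q h = h" "q u h = \<phi> z / k" using Qu quu by (simp_all add: h_def Qs qs)
        have "\<phi> (g h u) * q u h + q u (Q (g h u)) = k * (\<phi> z / k) * (\<phi> z / k) + R u * (\<phi> z / k)"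
          by (simp only: k[OF Qu h(1)] R[OF Qu h(1)] h(2))
        also have "\<dots> = q u u" unfolding eq using False by (simp add: field_simps)
        finally show False using no_solution[OF Qu nz h(1)] by blast
      qed
      moreover from this have "\<phi> z = 0"
        using eq False linear_0[OF linR] linear_0[OF U.lin_P] by (simp add: qs)
      ultimately show "z = 0" using P_eq[of z] z(1) by (simp add: u_def)
    qed
    have "V \<subseteq> skew_ops P b"
    proof
      fix M assume M: "M \<in> V"
      have "b v (M v) = 0" if v: "P v = v" for v
      proof -
        define h where "h = M x"
        define u where "u = Q v"
        define N where "N v = M v - g h v" for v
        have h: "Q h = h" using Mx[OF M] by (simp add: h_def)
        have Qu: "Q u = u" by (simp add: u_def U.idem_P)
        have veq: "v = u + \<phi> v *\<^sub>R x" using P_eq[of v] v by (simp add: u_def)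
        have N: "N \<in> U" using decompose[OF M] unfolding N_def h_def by simp
        have Nv: "N v = N u"
          using U_iff N by (subst veq) (simp add: linear_add[OF U.lin_V[OF N]] linear_scale[OF U.lin_V[OF N]])
        have qN: "q u (N u) = 0" using N Qu unfolding U_skew skew_ops_def by blast
        have QN: "Q (N u) = N u" using U.ran_V[OF N] .
        have Mv: "M v = \<phi> v *\<^sub>R h + g h u + N u"
        proof -
          have "M v = g h v + N v" by (simp add: N_def)
          moreover have "g h v = g h u + \<phi> v *\<^sub>R h" by (subst veq) (simp add: gs gx[OF h])
          ultimately show ?thesis by (simp add: Nv)
        qed
        have \<phi>Mv: "\<phi> (M v) = k * q u h"
          using k[OF Qu h] \<phi>U[of N u] N U_iff Q_fixed_iff[of h] h by (simp add: Mv fs)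
        have "q u (Q (M v)) = \<phi> v * q u h + R u * q u h"
          using R[OF Qu h] by (simp add: Mv Qs qs h QN qN)
        then show ?thesis using False \<phi>Mv unfolding b_def u_def[symmetric] by (simp add: field_simps)
      qed
      then show "M \<in> skew_ops P b"
        using lin_V[OF M] ran_V[OF M] dom_V[OF M] by (simp add: skew_ops_def)
    qed
    then have "V = skew_ops P b"
      by (intro superset_eq skew_ops_trivial_spectrum fin_projector_axioms bilb defb)
    then show ?thesis using bilb defb by blast
  qed
qed

end

lemma max_trivial_spectrum_dichotomy:
  assumes "max_trivial_spectrum P V"
  shows "(\<exists>G. lin_subspace G \<and> G \<subseteq> range P \<and> G \<noteq> {0} \<and> G \<noteq> range P \<and> (\<forall>M\<in>V. \<forall>v\<in>G. M v \<in> G)) \<or>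
         (\<exists>b. bilin b \<and> definite_on P b \<and> V = skew_ops P b)"
  using assms
proof (induction "dim (range P)" arbitrary: P V)
  case 0
  then interpret max_trivial_spectrum P V by simp
  have "range P = {0}" using 0 dim_zero_iff[OF fds_P] by simp
  then have P0: "v = 0" if "P v = v" for v using that in_range_iff by blast
  \<comment> \<open>On the zero space even the zero form is definite.\<close>
  have "bilin (\<lambda>_ _. 0)" by (auto simp: bilin_def intro: linearI)
  moreover have "definite_on P (\<lambda>_ _. 0)" using P0 by (auto simp: definite_on_def)
  moreover from calculation have "V = skew_ops P (\<lambda>_ _. 0)"
  proof (intro superset_eq skew_ops_trivial_spectrum fin_projector_axioms)
    show "V \<subseteq> skew_ops P (\<lambda>_ _. 0)" using lin_V ran_V dom_V by (auto simp: skew_ops_def)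
  qed
  ultimately show ?case by blast
next
  case (Suc n)
  then interpret max_trivial_spectrum P V by simp
  have "range P \<noteq> {0}" using Suc.hyps(2) by (metis fds_zero(2) nat.distinct(1))
  then obtain x \<phi> where h: "P x = x" "linear \<phi>" "\<And>v. \<phi> (P v) = \<phi> v" "\<phi> x = (1::real)"
    "(\<lambda>M. M x) ` V = {v \<in> range P. \<phi> v = 0}"
    "\<And>M v. M \<in> V \<Longrightarrow> M x = 0 \<Longrightarrow> \<phi> (M v) = 0"
    "max_trivial_spectrum (\<lambda>v. P v - \<phi> v *\<^sub>R x) {M \<in> V. M x = 0}"
    by (rule hyperplane_reduction) blast
  define Q where "Q = (\<lambda>v. P v - \<phi> v *\<^sub>R x)"
  define U where "U = {M \<in> V. M x = 0}"
  interpret hyperplane_split P V x \<phi> Q U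
  proof (intro hyperplane_split.intro hyperplane_split_axioms.intro max_trivial_spectrum_axioms)
    show "max_trivial_spectrum Q U" unfolding Q_def U_def by (rule h(7))
  qed (fact Q_def U_def h)+
  have "n = dim (range Q)"
    using fin_projector_deflate(3)[OF h(2) h(3) h(1) h(4)] Suc.hyps(2) by (simp add: Q_def)
  note IH = Suc.hyps(1)[OF this max_U]
  have xQ: "x \<notin> range Q" using \<phi>Q \<phi>x by (metis imageE zero_neq_one)
  have xP: "x \<in> range P" using Px by (metis rangeI)
  have QP: "range Q \<subseteq> range P" using PQ in_range_iff by auto
  show ?case
  proof (cases "\<exists>b. bilin b \<and> definite_on Q b \<and> U = skew_ops Q b")
    case True
    then obtain b where b: "bilin b" "definite_on Q b" "U = skew_ops Q b" by blast
    obtain g where g: "linear g" "\<And>v. g v \<in> V" "\<And>v. Q v = v \<Longrightarrow> g v x = v"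
      using section_exists by blast
    interpret skew_reduced P V x \<phi> Q U b g 
      by (intro skew_reduced.intro skew_reduced_axioms.intro hyperplane_split_axioms) (use b g in auto)
    show ?thesis using invariant_or_skew U.sub_P QP xQ xP by metis
  next
    case False
    then obtain G where G: "lin_subspace G" "G \<subseteq> range Q" "G \<noteq> {0}" "G \<noteq> range Q"
      "\<forall>M\<in>U. \<forall>v\<in>G. M v \<in> G" using IH by blast
    have "\<forall>M\<in>V. \<forall>v\<in>G. M v \<in> G" using invariant_of_reduced[OF G(1,2,4,5)] by blast
    moreover have "G \<noteq> range P" using G(2) xQ xP by blast
    moreover have "G \<subseteq> range P" using G(2) QP by (rule order_trans)
    ultimately show ?thesis using G(1,3) by blast
  qed
qed

section \<open>Matrix form\<close>

text \<open>The matrices of the operators \<open>1 + M\<close> between the bases given by \<open>s\<close> and by \<open>r\<close>. There is no need to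
  require that these are bases: this is automatic once the identity matrix occurs.\<close>

definition op_mats :: "nat \<Rightarrow> (nat \<Rightarrow> 'a::real_vector) \<Rightarrow> (nat \<Rightarrow> 'a \<Rightarrow> real) \<Rightarrow> ('a \<Rightarrow> 'a) set \<Rightarrow> real mat set" where
  "op_mats n s r V = (\<lambda>M. mat n n (\<lambda>(i, j). r i (s j + M (s j)))) ` V"

section \<open>Skew matrices, joins and translates by the identity matrix\<close>

lemma skew_mats_iff:
  "A \<in> skew_mats n \<longleftrightarrow> A \<in> carrier_mat n n \<and> (\<forall>i<n. \<forall>j<n. A $$ (j, i) = - A $$ (i, j))"
  unfolding skew_mats_def
proof safe
  fix i j assume A: "A \<in> carrier_mat n n" "transpose_mat A = - A" and ij: "i < n" "j < n"
  have "transpose_mat A $$ (i, j) = (- A) $$ (i, j)" by (simp only: A(2))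
  then show "A $$ (j, i) = - A $$ (i, j)" using A(1) ij by simp
next
  assume A: "A \<in> carrier_mat n n" "\<forall>i<n. \<forall>j<n. A $$ (j, i) = - A $$ (i, j)"
  show "transpose_mat A = - A"
  proof (rule eq_matI)
    fix i j assume "i < dim_row (- A)" "j < dim_col (- A)"
    then have ij: "i < n" "j < n" using A(1) by auto
    then show "transpose_mat A $$ (i, j) = (- A) $$ (i, j)"
      using A(1) A(2)[rule_format, OF ij] by simp
  qed (use A(1) in auto)
qed

lemma zero_in_skew_join: "0\<^sub>m (sum_list ns) (sum_list ns) \<in> skew_join ns"
proof (induction ns)
  case (Cons m ms)
  have "0\<^sub>m (m + sum_list ms) (m + sum_list ms) =
      four_block_mat (0\<^sub>m m m) (0\<^sub>m m (sum_list ms)) (0\<^sub>m (sum_list ms) m) (0\<^sub>m (sum_list ms) (sum_list ms))"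
    by (intro eq_matI) auto
  moreover have "0\<^sub>m m m \<in> skew_mats m" by (simp add: skew_mats_iff)
  moreover have "0\<^sub>m m (sum_list ms) \<in> carrier_mat m (sum_list ms)" by simp
  ultimately show ?case using Cons unfolding skew_join.simps join_mats_def sum_list.Cons by blast
qed simp

lemma one_in_translate_skew_join: "1\<^sub>m (sum_list ns) \<in> translate_mat (1\<^sub>m (sum_list ns)) (skew_join ns)"
proof -
  have "(1\<^sub>m (sum_list ns) :: real mat) = 1\<^sub>m (sum_list ns) + 0\<^sub>m (sum_list ns) (sum_list ns)"
    by (intro eq_matI) auto
  then show ?thesis unfolding translate_mat_def using zero_in_skew_join by blast
qed

lemma join_mats_empty:
  assumes "W \<subseteq> carrier_mat k k"
  shows "join_mats 0 k (carrier_mat 0 0) W = W"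
proof -
  have *: "four_block_mat A B (0\<^sub>m k 0) C = C"
    if "A \<in> carrier_mat 0 0" "C \<in> carrier_mat k k" for A B C :: "real mat"
    using that by (intro eq_matI) auto
  show ?thesis
  proof
    show "join_mats 0 k (carrier_mat 0 0) W \<subseteq> W"
      using * assms unfolding join_mats_def by auto
    show "W \<subseteq> join_mats 0 k (carrier_mat 0 0) W"
    proof
      fix C assume "C \<in> W"
      moreover from this have "C = four_block_mat (0\<^sub>m 0 0) (0\<^sub>m 0 k) (0\<^sub>m k 0) C" using * assms by (metis subsetD zero_carrier_mat)
      ultimately show "C \<in> join_mats 0 k (carrier_mat 0 0) W" unfolding join_mats_def
        by (metis (mono_tags, lifting) mem_Collect_eq zero_carrier_mat)
    qed
  qed
qed

lemma skew_join_append: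
  "skew_join (as @ bs) = join_mats (sum_list as) (sum_list bs) (skew_join as) (skew_join bs)"
proof (induction as)
  case Nil
  then show ?case using join_mats_empty[OF skew_join_carrier] by simp
next
  case (Cons a as)
  have "skew_mats a \<subseteq> carrier_mat a a" by (auto simp: skew_mats_def)
  then show ?case using Cons skew_join_carrier[of as] skew_join_carrier[of bs]
    by (simp add: join_mats_assoc)
qed

lemma join_mats_translate_one:
  assumes "X \<subseteq> carrier_mat a a" "Y \<subseteq> carrier_mat b b"
  shows "join_mats a b (translate_mat (1\<^sub>m a) X) (translate_mat (1\<^sub>m b) Y) =
         translate_mat (1\<^sub>m (a + b)) (join_mats a b X Y)"
proof -
  have *: "four_block_mat (1\<^sub>m a + A) B (0\<^sub>m b a) (1\<^sub>m b + C) = 1\<^sub>m (a + b) + four_block_mat A B (0\<^sub>m b a) C"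
    if "A \<in> X" "B \<in> carrier_mat a b" "C \<in> Y" for A B C
    using that subsetD[OF assms(1) that(1)] subsetD[OF assms(2) that(3)] by (intro eq_matI) auto
  show ?thesis
  proof
    show "join_mats a b (translate_mat (1\<^sub>m a) X) (translate_mat (1\<^sub>m b) Y) \<subseteq>
        translate_mat (1\<^sub>m (a + b)) (join_mats a b X Y)"
      unfolding join_mats_def translate_mat_def using * by blast
    show "translate_mat (1\<^sub>m (a + b)) (join_mats a b X Y) \<subseteq>
        join_mats a b (translate_mat (1\<^sub>m a) X) (translate_mat (1\<^sub>m b) Y)"
    proof
      fix Z assume "Z \<in> translate_mat (1\<^sub>m (a + b)) (join_mats a b X Y)"
      then obtain A B C where Z: "A \<in> X" "B \<in> carrier_mat a b" "C \<in> Y"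
          "Z = 1\<^sub>m (a + b) + four_block_mat A B (0\<^sub>m b a) C"
        unfolding join_mats_def translate_mat_def by blast
      then have "Z = four_block_mat (1\<^sub>m a + A) B (0\<^sub>m b a) (1\<^sub>m b + C)" using * by simp
      moreover have "1\<^sub>m a + A \<in> translate_mat (1\<^sub>m a) X" "1\<^sub>m b + C \<in> translate_mat (1\<^sub>m b) Y"
        unfolding translate_mat_def using Z by blast+
      ultimately show "Z \<in> join_mats a b (translate_mat (1\<^sub>m a) X) (translate_mat (1\<^sub>m b) Y)"
        unfolding join_mats_def using Z(2) by blast
    qed
  qed
qed

text \<open>If \<open>b v v\<close> is positive and \<open>b w w\<close> negative, the quadratic
  polynomial \<open>b (v + t w) (v + t w)\<close> in \<open>t\<close> has positive discriminant and
  thus a real root. Definiteness gives \<open>v + t w = 0\<close> there, so \<open>v\<close> is a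
  multiple of \<open>w\<close> and cannot have the opposite sign.\<close>

lemma definite_sign:
  assumes "fin_projector P" "bilin b" "definite_on P b"
  obtains \<epsilon> :: real where "\<epsilon> * \<epsilon> = 1" "\<And>v. P v = v \<Longrightarrow> v \<noteq> 0 \<Longrightarrow> 0 < \<epsilon> * b v v"
proof (cases "\<forall>v. P v = v \<longrightarrow> v \<noteq> 0 \<longrightarrow> 0 < b v v")
  case True
  then show ?thesis using that[of 1] by simp
next
  case False
  interpret fin_projector P by (rule assms(1))
  note bs = bilin_simps[OF assms(2)]
  have dfn: "b v v \<noteq> 0" if "P v = v" "v \<noteq> 0" for v using assms(3) that unfolding definite_on_def by blast
  obtain w where w: "P w = w" "w \<noteq> 0" "b w w < 0" using False dfn by (metis linorder_neqE_linordered_idom)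
  have "b v v < 0" if v: "P v = v" "v \<noteq> 0" for v
  proof (rule ccontr)
    assume "\<not> b v v < 0"
    then have pos: "0 < b v v" using dfn[OF v] by simp
    define B where "B = b v w + b w v"
    define D where "D = sqrt (B\<^sup>2 - 4 * b w w * b v v)"
    define t where "t = (- B + D) / (2 * b w w)"
    have "b w w * b v v < 0" using pos w(3) by (simp add: mult_neg_pos)
    then have "0 \<le> B\<^sup>2 - 4 * b w w * b v v" using zero_le_power2[of B] by linarith
    then have "D\<^sup>2 = B\<^sup>2 - 4 * b w w * b v v" by (simp add: D_def)
    then have "(2 * b w w * t + B)\<^sup>2 = B\<^sup>2 - 4 * b w w * b v v" using w(3) by (simp add: t_def)
    then have "4 * b w w * (b w w * t * t + B * t + b v v) = 0"
      by (simp add: power2_eq_square algebra_simps)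
    then have "b w w * t * t + B * t + b v v = 0" using w(3) by simp
    then have "b (v + t *\<^sub>R w) (v + t *\<^sub>R w) = 0" by (simp add: bs B_def algebra_simps)
    moreover have "P (v + t *\<^sub>R w) = v + t *\<^sub>R w" by (simp add: linear_add[OF lin_P] linear_scale[OF lin_P] v w)
    ultimately have "v + t *\<^sub>R w = 0" using dfn by blast
    then have v': "v = (- t) *\<^sub>R w" by (simp add: eq_neg_iff_add_eq_0)
    have "b v v = t * t * b w w" unfolding v' bs by simp
    then show False using pos w(3) mult_nonneg_nonpos[of "t * t" "b w w"] by simp
  qed
  then show ?thesis using that[of "-1"] by simp
qed

text \<open>Gram-Schmidt: a unit vector \<open>z\<close> is split off, and the kernel of
  \<open>c z\<close> in \<open>E\<close> has one dimension less.\<close>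

lemma orthonormal_basis:
  fixes c :: "'a::real_vector \<Rightarrow> 'a \<Rightarrow> real"
  assumes "bilin c" "\<And>u v. c u v = c v u" "fds E" "\<And>v. v \<in> E \<Longrightarrow> v \<noteq> 0 \<Longrightarrow> 0 < c v v"
  shows "\<exists>s. (\<forall>i<dim E. s i \<in> E) \<and> (\<forall>i<dim E. \<forall>j<dim E. c (s i) (s j) = (if i = j then 1 else 0)) \<and>
             (\<forall>z\<in>E. z = (\<Sum>i<dim E. c (s i) z *\<^sub>R s i))"
  using assms(3,4)
proof (induction "dim E" arbitrary: E)
  case 0
  then have "E = {0}" using dim_zero_iff[of E] by simp
  then show ?case using 0(1) by (metis less_nat_zero_code lessThan_0 singletonD sum.empty)
next
  case (Suc n)
  note cs = bilin_simps[OF assms(1)]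
  have sE: "lin_subspace E" using Suc.prems(1) by (rule fds_lin_subspace)
  have "E \<noteq> {0}" using Suc.hyps(2) by (metis fds_zero(2) nat.distinct(1))
  then obtain z0 where z0: "z0 \<in> E" "z0 \<noteq> 0" using lin_subspace_0[OF sE] by blast
  define z where "z = (1 / sqrt (c z0 z0)) *\<^sub>R z0"
  have pos: "0 < c z0 z0" using Suc.prems(2)[OF z0] .
  have z: "z \<in> E" "c z z = 1"
    using z0 sE pos by (simp_all add: z_def lin_subspace_scale cs)
  define F where "F = {w \<in> E. c z w = 0}"
  have lz: "linear (c z)" using assms(1) by (simp add: bilin_def)
  have sF: "lin_subspace F" unfolding F_def by (rule lin_subspace_kernel[OF lz sE])
  have FE: "F \<subseteq> E" by (auto simp: F_def)
  have fF: "fds F" by (rule fds_subset(1)[OF Suc.prems(1) sF FE])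
  have dF: "n = dim F" using dim_functional_kernel[OF lz Suc.prems(1) z(1)] z(2) Suc.hyps(2)
    unfolding F_def by simp
  obtain s where s: "\<And>i. i < n \<Longrightarrow> s i \<in> F"
    "\<And>i j. i < n \<Longrightarrow> j < n \<Longrightarrow> c (s i) (s j) = (if i = j then 1 else 0)"
    "\<And>w. w \<in> F \<Longrightarrow> w = (\<Sum>i<n. c (s i) w *\<^sub>R s i)"
    using Suc.hyps(1)[OF dF fF] Suc.prems(2) FE unfolding dF[symmetric] by (metis subsetD)
  define s' where "s' i = (if i < n then s i else z)" for i
  have zs: "c z (s i) = 0" "c (s i) z = 0" if "i < n" for i
    using s(1)[OF that] assms(2)[of z "s i"] by (auto simp: F_def)
  have "\<forall>i<Suc n. s' i \<in> E" using s(1) FE z(1) by (auto simp: s'_def)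
  moreover have "\<forall>i<Suc n. \<forall>j<Suc n. c (s' i) (s' j) = (if i = j then 1 else 0)"
    using s(2) zs z(2) by (auto simp: s'_def less_Suc_eq)
  moreover have "w = (\<Sum>i<Suc n. c (s' i) w *\<^sub>R s' i)" if w: "w \<in> E" for w
  proof -
    define w' where "w' = w - c z w *\<^sub>R z"
    have "w' \<in> F"
      using w z sE by (simp add: F_def w'_def cs lin_subspace_diff lin_subspace_scale)
    then have "w' = (\<Sum>i<n. c (s i) w' *\<^sub>R s i)" by (rule s(3))
    also have "\<dots> = (\<Sum>i<n. c (s' i) w *\<^sub>R s' i)"
      by (rule sum.cong) (simp_all add: s'_def w'_def cs zs)
    finally show ?thesis by (simp add: w'_def s'_def diff_eq_eq)
  qed
  ultimately show ?case unfolding Suc.hyps(2)[symmetric] by blast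
qed

text \<open>These sequences serve as the model of real \<open>n\<close>-space, with \<open>n\<close>
  an ordinary variable.\<close>

lemma dim_finitely_supported:
  shows "fds {f::nat \<Rightarrow> real. \<forall>i\<ge>n. f i = 0}" "dim {f::nat \<Rightarrow> real. \<forall>i\<ge>n. f i = 0} = n"
proof -
  let ?S = "\<lambda>n. {f::nat \<Rightarrow> real. \<forall>i\<ge>n. f i = 0}"
  have one: "range (\<lambda>c. c *\<^sub>R (1::real)) = UNIV" by auto
  have "fds (UNIV :: real set)" using fds_line[of "1::real"] one by simp
  moreover have "lin_subspace (?S n)" for n by (rule lin_subspaceI) auto
  moreover have "f = 0" if "f \<in> ?S n" "\<And>i. i \<in> {..<n} \<Longrightarrow> f i = 0" for f n
    using that by (auto simp: fun_eq_iff) (metis not_le)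
  ultimately have fds: "fds (?S n)" for n
    using dim_eval_bound[of "{..<n}" "?S n" "UNIV :: real set"] by simp
  then show "fds (?S n)" .
  show "dim (?S n) = n"
  proof (induction n)
    case 0
    have "?S 0 = {0}" by (auto simp: fun_eq_iff)
    then show ?case by (simp add: fds_zero)
  next
    case (Suc n)
    have lin: "linear (\<lambda>f::nat \<Rightarrow> real. f n)" by (rule linearI) auto
    have "{f \<in> ?S (Suc n). f n = 0} = ?S n"
      by auto (metis le_antisym not_less_eq_eq)
    then show ?case
      using dim_functional_kernel[OF lin fds, of "\<lambda>i. if i = n then 1 else 0" "Suc n"] Suc by simp
  qed
qed

text \<open>Up to sign, \<open>s\<close> is orthonormal for the symmetric part \<open>c\<close> of
  the form, while rows are read with \<open>r i = \<epsilon> b (s i)\<close>. Then the Gram matrix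
  \<open>r i (s j)\<close> is the identity plus a skew matrix, and \<open>r i (M (s j))\<close> is
  skew for \<open>M\<close> in \<open>skew_ops P b\<close>, so the asymmetry of \<open>b\<close> is
  absorbed.\<close>

lemma skew_ops_mats:
  assumes fp: "fin_projector P" and bil: "bilin b" and dfn: "definite_on P b" and n: "dim (range P) = n"
  shows "\<exists>s r. (\<forall>j<n. P (s j) = s j) \<and> (\<forall>i. linear (r i)) \<and>
           op_mats n s r (skew_ops P b) = translate_mat (1\<^sub>m n) (skew_mats n)"
proof -
  interpret fin_projector P by (rule fp)
  note bs = bilin_simps[OF bil]
  obtain \<epsilon> :: real where \<epsilon>: "\<epsilon> * \<epsilon> = 1" "\<And>v. P v = v \<Longrightarrow> v \<noteq> 0 \<Longrightarrow> 0 < \<epsilon> * b v v"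
    using definite_sign[OF fp bil dfn] by metis
  define c where "c u v = \<epsilon> * (b u v + b v u) / 2" for u v
  have bilc: "bilin c" unfolding bilin_def c_def
    by (auto intro!: linearI simp: bs algebra_simps add_divide_distrib)
  note cs = bilin_simps[OF bilc]
  have "\<exists>s. (\<forall>i<n. s i \<in> range P) \<and> (\<forall>i<n. \<forall>j<n. c (s i) (s j) = (if i = j then 1 else 0)) \<and>
             (\<forall>z\<in>range P. z = (\<Sum>i<n. c (s i) z *\<^sub>R s i))"
    unfolding n[symmetric] using \<epsilon>(2) fds_P
    by (intro orthonormal_basis bilc) (auto simp: c_def in_range_iff algebra_simps)
  then obtain s where "(\<forall>i<n. s i \<in> range P) \<and>
      (\<forall>i<n. \<forall>j<n. c (s i) (s j) = (if i = j then 1 else 0)) \<and>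
      (\<forall>z\<in>range P. z = (\<Sum>i<n. c (s i) z *\<^sub>R s i))" by (rule exE)
  then have s: "\<And>i. i < n \<Longrightarrow> P (s i) = s i"
    "\<And>i j. i < n \<Longrightarrow> j < n \<Longrightarrow> c (s i) (s j) = (if i = j then 1 else 0)"
    "\<And>z. P z = z \<Longrightarrow> z = (\<Sum>i<n. c (s i) z *\<^sub>R s i)"
    unfolding in_range_iff[symmetric] by blast+
  define r where "r i z = \<epsilon> * b (s i) z" for i z
  have linr: "linear (r i)" for i unfolding r_def by (rule linearI) (simp_all add: bs algebra_simps)
  have rs: "r i (s j) + r j (s i) = (if i = j then 2 else 0)" if "i < n" "j < n" for i j
    using s(2)[OF that] by (auto simp: c_def r_def algebra_simps split: if_splits)
  \<comment> \<open>By definiteness the values \<open>r i w\<close> determine \<open>w\<close>. An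
    injective linear map between spaces of dimension \<open>n\<close> is onto, so these values can
    be prescribed.\<close>
  have representer: "\<exists>w. P w = w \<and> (\<forall>i<n. r i w = a i)" for a :: "nat \<Rightarrow> real"
  proof -
    let ?F = "\<lambda>w i. if i < n then r i w else 0"
    let ?S = "{f::nat \<Rightarrow> real. \<forall>i\<ge>n. f i = 0}"
    have linF: "linear ?F" by (rule linearI) (auto simp: fun_eq_iff linear_add[OF linr] linear_scale[OF linr])
    have "w = 0" if w: "w \<in> range P" "?F w = 0" for w
    proof -
      have ri: "b (s i) w = 0" if "i < n" for i
      proof -
        have "r i w = 0" using fun_cong[OF w(2), of i] that by simp
        then show ?thesis using \<epsilon>(1) by (auto simp: r_def)
      qed
      have lin: "linear (\<lambda>z. b z w)" using bil by (simp add: bilin_def)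
      have Pw: "P w = w" using w(1) in_range_iff by simp
      have "b w w = b (\<Sum>i<n. c (s i) w *\<^sub>R s i) w" using s(3)[OF Pw] by simp
      also have "\<dots> = 0" by (simp add: linear_sum[OF lin] bs ri)
      finally show ?thesis using dfn Pw unfolding definite_on_def by blast
    qed
    then have "dim (?F ` range P) = n" using dim_image_inj[OF linF fds_P] n by simp
    moreover have "?F ` range P \<subseteq> ?S" by auto
    ultimately have "?F ` range P = ?S"
      using dim_finitely_supported[of n] lin_subspace_image[OF linF sub_P] by (intro fds_dim_eq) auto
    moreover have "(\<lambda>i. if i < n then a i else 0) \<in> ?S" by auto
    ultimately have "(\<lambda>i. if i < n then a i else 0) \<in> ?F ` range P" by simp
    then obtain w where w: "w \<in> range P" "(\<lambda>i. if i < n then a i else 0) = ?F w" by (rule imageE)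
    have "r i w = a i" if "i < n" for i using fun_cong[OF w(2), of i] that by simp
    then show ?thesis using w(1) in_range_iff by blast
  qed
  have skew: "r i (M (s j)) = - r j (M (s i))" if M: "M \<in> skew_ops P b" and ij: "i < n" "j < n" for M i j
  proof -
    have linM: "linear M" and z: "\<And>v. P v = v \<Longrightarrow> b v (M v) = 0" using M by (auto simp: skew_ops_def)
    have "b (s i + s j) (M (s i + s j)) = 0" "b (s i) (M (s i)) = 0" "b (s j) (M (s j)) = 0"
      using s(1) ij by (auto intro!: z simp: linear_add[OF lin_P])
    then have "b (s i) (M (s j)) = - b (s j) (M (s i))" by (simp add: linear_add[OF linM] bs)
    then show ?thesis by (simp add: r_def)
  qed
  have "op_mats n s r (skew_ops P b) = translate_mat (1\<^sub>m n) (skew_mats n)"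
  proof
    show "op_mats n s r (skew_ops P b) \<subseteq> translate_mat (1\<^sub>m n) (skew_mats n)"
    proof
      fix Z assume "Z \<in> op_mats n s r (skew_ops P b)"
      then obtain M where M: "M \<in> skew_ops P b" "Z = mat n n (\<lambda>(i, j). r i (s j + M (s j)))"
        unfolding op_mats_def by blast
      define A where "A = mat n n (\<lambda>(i, j). r i (s j + M (s j)) - (if i = j then 1 else 0))"
      have "Z = 1\<^sub>m n + A" unfolding M(2) A_def by (intro eq_matI) auto
      moreover have "A \<in> skew_mats n"
        unfolding skew_mats_iff
      proof (intro conjI allI impI)
        fix i j assume ij: "i < n" "j < n"
        show "A $$ (j, i) = - A $$ (i, j)"
          using skew[OF M(1) ij] rs[OF ij] ij by (auto simp: A_def linear_add[OF linr])
      qed (simp add: A_def)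
      ultimately show "Z \<in> translate_mat (1\<^sub>m n) (skew_mats n)" unfolding translate_mat_def by blast
    qed
    show "translate_mat (1\<^sub>m n) (skew_mats n) \<subseteq> op_mats n s r (skew_ops P b)"
    proof
      fix Z assume "Z \<in> translate_mat (1\<^sub>m n) (skew_mats n)"
      then obtain A where A: "A \<in> skew_mats n" "Z = 1\<^sub>m n + A" unfolding translate_mat_def by blast
      have Ac: "A \<in> carrier_mat n n" and Ask: "\<And>i j. i < n \<Longrightarrow> j < n \<Longrightarrow> A $$ (j, i) = - A $$ (i, j)"
        using A(1) unfolding skew_mats_iff by blast+
      \<comment> \<open>The matrix required of \<open>r i (M (s j))\<close>. It is skew because both
        \<open>A\<close> and the Gram matrix minus the identity are.\<close>
      define K where "K i j = A $$ (i, j) + (if i = j then 1 else 0) - r i (s j)" for i j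
      have K: "K j i = - K i j" if "i < n" "j < n" for i j
        using Ask[OF that] rs[OF that] by (auto simp: K_def)
      obtain w where w: "\<And>j. P (w j) = w j" "\<And>i j. i < n \<Longrightarrow> r i (w j) = K i j"
        using representer[of "\<lambda>i. K i _"] by metis
      define M where "M z = (\<Sum>j<n. c (s j) (P z) *\<^sub>R w j)" for z
      have linM: "linear M" unfolding M_def
        by (rule linearI)
           (simp_all add: linear_add[OF lin_P] linear_scale[OF lin_P] cs scaleR_add_left sum.distrib scaleR_sum_right)
      have Ms: "M (s j) = w j" if "j < n" for j
      proof -
        have "M (s j) = (\<Sum>k<n. if k = j then w j else 0)"
          unfolding M_def using that by (intro sum.cong) (auto simp: s)
        then show ?thesis using that by simp
      qed
      have "b z (M z) = 0" if z: "P z = z" for z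
      proof -
        define a where "a i = c (s i) z" for i
        have z': "z = (\<Sum>i<n. a i *\<^sub>R s i)" using s(3)[OF z] by (simp add: a_def)
        have "\<epsilon> * b z (M z) = (\<Sum>i<n. \<Sum>j<n. a i * a j * K i j)"
        proof -
          have l1: "linear (b z)" and l2: "linear (\<lambda>z. b z v)" for v using bil by (auto simp: bilin_def)
          have "b z (M z) = (\<Sum>j<n. a j * b z (w j))"
            unfolding M_def z a_def by (simp add: linear_sum[OF l1] bs)
          also have "\<dots> = (\<Sum>j<n. a j * (\<Sum>i<n. a i * b (s i) (w j)))"
            by (rule sum.cong[OF refl], subst (1) z') (simp add: linear_sum[OF l2] bs)
          finally have "\<epsilon> * b z (M z) = (\<Sum>j<n. \<Sum>i<n. a i * a j * r i (w j))"
            by (simp add: sum_distrib_left r_def algebra_simps)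
          also have "\<dots> = (\<Sum>j<n. \<Sum>i<n. a i * a j * K i j)" by (simp add: w(2))
          also have "\<dots> = (\<Sum>i<n. \<Sum>j<n. a i * a j * K i j)" by (rule sum.swap)
          finally show ?thesis .
        qed
        also have "\<dots> = 0"
        proof -
          let ?T = "\<Sum>i<n. \<Sum>j<n. a i * a j * K i j"
          have "?T = (\<Sum>i<n. \<Sum>j<n. a j * a i * K j i)" by (rule sum.swap)
          also have "\<dots> = (\<Sum>i<n. \<Sum>j<n. - (a i * a j * K i j))"
          proof (intro sum.cong refl)
            fix i j assume "i \<in> {..<n}" "j \<in> {..<n}"
            then show "a j * a i * K j i = - (a i * a j * K i j)" using K[of i j] by simp
          qed
          finally have "?T = - ?T" by (simp add: sum_negf)
          then show ?thesis by simp
        qed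
        finally show ?thesis using \<epsilon>(1) by auto
      qed
      moreover have "P (M z) = M z" "M (P z) = M z" for z
        by (simp_all add: M_def linear_sum[OF lin_P] linear_scale[OF lin_P] w(1) idem_P)
      ultimately have "M \<in> skew_ops P b" using linM by (simp add: skew_ops_def)
      moreover have "Z = mat n n (\<lambda>(i, j). r i (s j + M (s j)))"
        unfolding A(2) using Ac by (intro eq_matI) (auto simp: linear_add[OF linr] Ms w(2) K_def)
      ultimately show "Z \<in> op_mats n s r (skew_ops P b)" unfolding op_mats_def by blast
    qed
  qed
  then show ?thesis using s(1) linr by blast
qed

text \<open>The identity matrix belongs to the normal form, so some \<open>M \<in> V\<close> makes
  the vectors \<open>s j + M (s j)\<close> dual to the functionals \<open>r i\<close>. This gives
  the dual systems from which operators with prescribed blocks are built.\<close>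

lemma op_mats_dual:
  assumes "op_mats n s r V = translate_mat (1\<^sub>m n) (skew_join ns)" "n = sum_list ns"
  obtains M where "M \<in> V" "\<And>i j. i < n \<Longrightarrow> j < n \<Longrightarrow> r i (s j + M (s j)) = (if i = j then 1 else 0)"
proof -
  have "1\<^sub>m n \<in> op_mats n s r V" using one_in_translate_skew_join assms by simp
  then obtain M where M: "M \<in> V" "1\<^sub>m n = mat n n (\<lambda>(i, j). r i (s j + M (s j)))"
    unfolding op_mats_def by blast
  have "r i (s j + M (s j)) = (if i = j then 1 else 0)" if "i < n" "j < n" for i j
    using arg_cong[OF M(2), of "\<lambda>A. A $$ (i, j)"] that by simp
  then show ?thesis using that M(1) by blast
qed

text \<open>Listing the vectors of the invariant subspace before those of the complement makes the
  matrices block upper triangular. By \<open>all\<close> the diagonal blocks and \<open>X\<close>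
  can be prescribed independently, so the full join is reached once every matrix \<open>B\<close> is
  realised by some \<open>X\<close>.\<close>

lemma op_mats_join:
  fixes P :: "'a::real_vector \<Rightarrow> 'a"
  assumes V: "trivial_spectrum P V" and fp\<gamma>: "fin_projector \<gamma>" and fp\<delta>: "fin_projector \<delta>"
    and \<gamma>\<delta>: "\<forall>v. \<gamma> (\<delta> v) = 0" and \<delta>\<gamma>: "\<forall>v. \<delta> (\<gamma> v) = 0"
    and inv: "\<forall>M\<in>V. \<forall>v. \<gamma> (M (\<gamma> v)) = M (\<gamma> v)"
    and all: "\<forall>X. linear X \<and> (\<forall>v. \<gamma> (X v) = X v) \<and> (\<forall>v. X (\<delta> v) = X v) \<longrightarrow>
       (\<forall>M\<in>V. \<forall>N\<in>V. (\<lambda>v. M (\<gamma> v) + \<delta> (N (\<delta> v)) + X v) \<in> V)"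
    and s1: "\<forall>j<a. \<gamma> (s1 j) = s1 j" and r1: "\<forall>i. linear (r1 i)"
    and V1: "op_mats a s1 r1 ((\<lambda>M v. M (\<gamma> v)) ` V) = translate_mat (1\<^sub>m a) (skew_join as)" and a: "a = sum_list as"
    and s2: "\<forall>j<b. \<delta> (s2 j) = s2 j" and r2: "\<forall>i. linear (r2 i)"
    and V2: "op_mats b s2 r2 ((\<lambda>M v. \<delta> (M (\<delta> v))) ` V) = translate_mat (1\<^sub>m b) (skew_join bs)" and b: "b = sum_list bs"
  defines "s \<equiv> \<lambda>j. if j < a then s1 j else s2 (j - a)"
    and "r \<equiv> \<lambda>i v. if i < a then r1 i (\<gamma> v) else r2 (i - a) (\<delta> v)"
  shows "op_mats (a + b) s r V = translate_mat (1\<^sub>m (a + b)) (skew_join (as @ bs))"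
proof -
  interpret trivial_spectrum P V by (rule V)
  interpret \<gamma>: fin_projector \<gamma> by (rule fp\<gamma>)
  interpret \<delta>: fin_projector \<delta> by (rule fp\<delta>)
  let ?V1 = "(\<lambda>M v. M (\<gamma> v)) ` V" and ?V2 = "(\<lambda>M v. \<delta> (M (\<delta> v))) ` V"
  note \<gamma>\<delta> = \<gamma>\<delta>[rule_format] and \<delta>\<gamma> = \<delta>\<gamma>[rule_format] and inv = inv[rule_format] and s1 = s1[rule_format]
    and s2 = s2[rule_format] and r1 = r1[rule_format] and r2 = r2[rule_format]
  have \<gamma>s2: "\<gamma> (s2 j) = 0" if "j < b" for j using \<gamma>\<delta>[of "s2 j"] s2[OF that] by simp
  have \<delta>s1: "\<delta> (s1 j) = 0" if "j < a" for j using \<delta>\<gamma>[of "s1 j"] s1[OF that] by simp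
  have \<delta>M\<gamma>: "\<delta> (M (\<gamma> v)) = 0" if "M \<in> V" for M v using \<delta>\<gamma>[of "M (\<gamma> v)"] inv[OF that] by simp
  have block: "mat (a + b) (a + b) (\<lambda>(i, j). r i (s j + M (s j))) =
      four_block_mat (mat a a (\<lambda>(i, j). r1 i (s1 j + M (\<gamma> (s1 j)))))
        (mat a b (\<lambda>(i, j). r1 i (\<gamma> (M (s2 j))))) (0\<^sub>m b a)
        (mat b b (\<lambda>(i, j). r2 i (s2 j + \<delta> (M (\<delta> (s2 j))))))" (is "?L = ?R") if M: "M \<in> V" for M
  proof (rule eq_matI)
    fix i j assume "i < dim_row ?R" "j < dim_col ?R"
    then have ij: "i < a + b" "j < a + b" by simp_all
    have M1: "\<gamma> (M (s1 j)) = M (s1 j)" "\<delta> (M (s1 j)) = 0" if "j < a"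
      using inv[OF M, of "s1 j"] \<delta>M\<gamma>[OF M, of "s1 j"] s1[OF that] by simp_all
    show "?L $$ (i, j) = ?R $$ (i, j)"
    proof (cases "i < a"; cases "j < a")
      assume "i < a" "j < a"
      then show ?thesis using ij by (simp add: s_def r_def linear_add[OF \<gamma>.lin_P] s1 M1)
    next
      assume "i < a" "\<not> j < a"
      then show ?thesis using ij by (simp add: s_def r_def linear_add[OF \<gamma>.lin_P] \<gamma>s2)
    next
      assume "\<not> i < a" "j < a"
      then show ?thesis using ij by (simp add: s_def r_def linear_add[OF \<delta>.lin_P] \<delta>s1 M1 linear_0[OF r2])
    next
      assume "\<not> i < a" "\<not> j < a"
      then show ?thesis using ij by (simp add: s_def r_def linear_add[OF \<delta>.lin_P] s2)
    qed
  qed simp_all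
  have "op_mats (a + b) s r V = join_mats a b (op_mats a s1 r1 ?V1) (op_mats b s2 r2 ?V2)"
  proof
    show "op_mats (a + b) s r V \<subseteq> join_mats a b (op_mats a s1 r1 ?V1) (op_mats b s2 r2 ?V2)"
    proof
      fix Z assume "Z \<in> op_mats (a + b) s r V"
      then obtain M where M: "M \<in> V" "Z = mat (a + b) (a + b) (\<lambda>(i, j). r i (s j + M (s j)))"
        unfolding op_mats_def by blast
      have "mat a a (\<lambda>(i, j). r1 i (s1 j + M (\<gamma> (s1 j)))) \<in> op_mats a s1 r1 ?V1"
        "mat b b (\<lambda>(i, j). r2 i (s2 j + \<delta> (M (\<delta> (s2 j))))) \<in> op_mats b s2 r2 ?V2"
        unfolding op_mats_def using M(1) by auto
      moreover have "mat a b (\<lambda>(i, j). r1 i (\<gamma> (M (s2 j)))) \<in> carrier_mat a b" by simp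
      ultimately show "Z \<in> join_mats a b (op_mats a s1 r1 ?V1) (op_mats b s2 r2 ?V2)"
        unfolding join_mats_def M(2) block[OF M(1)] by blast
    qed
    show "join_mats a b (op_mats a s1 r1 ?V1) (op_mats b s2 r2 ?V2) \<subseteq> op_mats (a + b) s r V"
    proof
      fix Z assume "Z \<in> join_mats a b (op_mats a s1 r1 ?V1) (op_mats b s2 r2 ?V2)"
      then obtain M B N where MN: "M \<in> V" "N \<in> V" and B: "B \<in> carrier_mat a b"
        and Z: "Z = four_block_mat (mat a a (\<lambda>(i, j). r1 i (s1 j + M (\<gamma> (s1 j))))) B (0\<^sub>m b a)
                 (mat b b (\<lambda>(i, j). r2 i (s2 j + \<delta> (N (\<delta> (s2 j))))))"
        unfolding join_mats_def op_mats_def by blast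
      obtain M1 where M1: "M1 \<in> ?V1"
          "\<And>i j. i < a \<Longrightarrow> j < a \<Longrightarrow> r1 i (s1 j + M1 (s1 j)) = (if i = j then 1 else 0)"
        using op_mats_dual[OF V1 a] by metis
      obtain M2 where M2: "M2 \<in> ?V2"
          "\<And>i j. i < b \<Longrightarrow> j < b \<Longrightarrow> r2 i (s2 j + M2 (s2 j)) = (if i = j then 1 else 0)"
        using op_mats_dual[OF V2 b] by metis
      obtain M1' where M1': "M1' \<in> V" "M1 = (\<lambda>v. M1' (\<gamma> v))" using M1(1) by blast
      obtain M2' where M2': "M2' \<in> V" "M2 = (\<lambda>v. \<delta> (M2' (\<delta> v)))" using M2(1) by blast
      \<comment> \<open>The vectors \<open>t\<close> are dual to the row functionals
        \<open>r1\<close>, and the functionals \<open>d\<close> below are dual to the column vectors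
        \<open>s2\<close>. Together they yield the operator \<open>X\<close> with matrix
        \<open>B\<close>.\<close>
      define t where "t i = s1 i + M1 (s1 i)" for i
      have \<gamma>t: "\<gamma> (t i) = t i" if "i < a" for i
        using inv[OF M1'(1), of "s1 i"] s1[OF that] by (simp add: t_def linear_add[OF \<gamma>.lin_P] M1'(2))
      define d where "d j v = r2 j (\<delta> v + M2 (\<delta> v))" for j v
      have lind: "linear (d j)" for j unfolding d_def M2'(2)
        by (rule linearI) (simp_all add: linear_add[OF \<delta>.lin_P] linear_scale[OF \<delta>.lin_P]
            linear_add[OF lin_V[OF M2'(1)]] linear_scale[OF lin_V[OF M2'(1)]]
            linear_add[OF r2] linear_scale[OF r2] algebra_simps)
      have ds: "d i (s2 j) = (if i = j then 1 else 0)" if "i < b" "j < b" for i j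
        using M2(2)[OF that] s2[OF that(2)] by (simp add: d_def)
      define X where "X v = (\<Sum>j<b. \<Sum>i<a. (B $$ (i, j) * d j v) *\<^sub>R t i)" for v
      have linX: "linear X" unfolding X_def
        by (rule linearI) (simp_all add: linear_add[OF lind] linear_scale[OF lind] algebra_simps
            sum.distrib scaleR_sum_right)
      have \<gamma>X: "\<gamma> (X v) = X v" for v
        by (simp add: X_def linear_sum[OF \<gamma>.lin_P] linear_scale[OF \<gamma>.lin_P] \<gamma>t)
      have X\<delta>: "X (\<delta> v) = X v" for v by (simp add: X_def d_def \<delta>.idem_P)
      have Xs: "X (s2 k) = (\<Sum>i<a. B $$ (i, k) *\<^sub>R t i)" if k: "k < b" for k
      proof -
        have "X (s2 k) = (\<Sum>j<b. if j = k then (\<Sum>i<a. B $$ (i, k) *\<^sub>R t i) else 0)"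
          unfolding X_def using ds[OF _ k] by (intro sum.cong) auto
        then show ?thesis using k by simp
      qed
      have rX: "r1 l (X (s2 k)) = B $$ (l, k)" if lk: "l < a" "k < b" for l k
      proof -
        have "r1 l (X (s2 k)) = (\<Sum>i<a. B $$ (i, k) * r1 l (t i))"
          by (simp add: Xs[OF lk(2)] linear_sum[OF r1] linear_scale[OF r1])
        also have "\<dots> = (\<Sum>i<a. if i = l then B $$ (l, k) else 0)"
          using M1(2)[OF lk(1)] by (intro sum.cong) (auto simp: t_def)
        finally show ?thesis using lk by simp
      qed
      define W where "W v = M (\<gamma> v) + \<delta> (N (\<delta> v)) + X v" for v
      have W: "W \<in> V" using all linX \<gamma>X X\<delta> MN unfolding W_def by blast
      have W\<gamma>: "W (\<gamma> v) = M (\<gamma> v)" for v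
      proof -
        have "X (\<gamma> v) = 0" using X\<delta>[of "\<gamma> v"] \<delta>\<gamma> linear_0[OF linX] by simp
        then show ?thesis by (simp add: W_def \<gamma>.idem_P \<delta>\<gamma> linear_0[OF lin_V[OF MN(2)]] linear_0[OF \<delta>.lin_P])
      qed
      have \<delta>X: "\<delta> (X v) = 0" for v using \<delta>\<gamma>[of "X v"] \<gamma>X by simp
      have \<delta>W\<delta>: "\<delta> (W (\<delta> v)) = \<delta> (N (\<delta> v))" for v
        by (simp add: W_def linear_add[OF \<delta>.lin_P] \<delta>X \<delta>.idem_P \<delta>M\<gamma>[OF MN(1)])
      have \<gamma>W: "\<gamma> (W (s2 j)) = X (s2 j)" if "j < b" for j
        by (simp add: W_def linear_add[OF \<gamma>.lin_P] \<gamma>s2[OF that] linear_0[OF lin_V[OF MN(1)]]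
            linear_0[OF \<gamma>.lin_P] \<gamma>\<delta> \<gamma>X)
      have "mat a b (\<lambda>(i, j). r1 i (\<gamma> (W (s2 j)))) = B"
        using B by (intro eq_matI) (auto simp: \<gamma>W rX)
      then have "Z = mat (a + b) (a + b) (\<lambda>(i, j). r i (s j + W (s j)))"
        unfolding block[OF W] Z W\<gamma> \<delta>W\<delta> by simp
      then show "Z \<in> op_mats (a + b) s r V" unfolding op_mats_def using W by blast
    qed
  qed
  then show ?thesis unfolding V1 V2
    using join_mats_translate_one[of "skew_join as" a "skew_join bs" b] skew_join_carrier a b
    by (simp add: skew_join_append)
qed

lemma max_trivial_spectrum_mats:
  assumes "max_trivial_spectrum P V" "dim (range P) = n"
  shows "\<exists>ns s r. (\<forall>m\<in>set ns. 0 < m) \<and> n = sum_list ns \<and> (\<forall>j<n. P (s j) = s j) \<and>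
     (\<forall>i. linear (r i)) \<and> op_mats n s r V = translate_mat (1\<^sub>m n) (skew_join ns)"
  using assms
proof (induction n arbitrary: P V rule: less_induct)
  case (less n)
  then interpret max_trivial_spectrum P V by simp
  note dich = max_trivial_spectrum_dichotomy[OF less.prems(1)]
  show ?case
  proof (cases "\<exists>b. bilin b \<and> definite_on P b \<and> V = skew_ops P b")
    case True
    then obtain b where b: "bilin b" "definite_on P b" "V = skew_ops P b" by blast
    \<comment> \<open>Entries must be positive, so dimension 0 requires the empty list; for it the
      join and \<open>skew_mats 0\<close> both consist of the empty matrix.\<close>
    define ns where "ns = (if n = 0 then [] else [n])"
    have ns: "\<forall>m\<in>set ns. 0 < m" "n = sum_list ns" by (simp_all add: ns_def)
    have "skew_mats 0 = carrier_mat 0 0" by (rule Set.set_eqI) (simp only: skew_mats_iff, simp)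
    then have "skew_join ns = skew_mats n"
      using skew_join_singleton[of n] unfolding ns_def by (cases "n = 0") simp_all
    moreover obtain s r where "\<forall>j<n. P (s j) = s j" "\<forall>i. linear (r i)"
        "op_mats n s r V = translate_mat (1\<^sub>m n) (skew_mats n)"
      using skew_ops_mats[OF fin_projector_axioms b(1,2) less.prems(2)] unfolding b(3) by blast
    ultimately show ?thesis using ns by metis
  next
    case False
    then obtain G where G: "lin_subspace G" "G \<subseteq> range P" "G \<noteq> {0}" "G \<noteq> range P"
      "\<forall>M\<in>V. \<forall>v\<in>G. M v \<in> G" using dich by blast
    obtain \<gamma> \<delta> where \<gamma>: "fin_projector \<gamma>" "range \<gamma> = G" "\<forall>v. P v = \<gamma> v + \<delta> v"
      "\<forall>v. \<gamma> (\<delta> v) = 0" "\<forall>v. \<delta> (\<gamma> v) = 0" "dim (range P) = dim (range \<gamma>) + dim (range \<delta>)"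
      "max_trivial_spectrum \<gamma> ((\<lambda>M v. M (\<gamma> v)) ` V)"
      "max_trivial_spectrum \<delta> ((\<lambda>M v. \<delta> (M (\<delta> v))) ` V)"
      "\<forall>X. linear X \<and> (\<forall>v. \<gamma> (X v) = X v) \<and> (\<forall>v. X (\<delta> v) = X v) \<longrightarrow>
         (\<forall>M\<in>V. \<forall>N\<in>V. (\<lambda>v. M (\<gamma> v) + \<delta> (N (\<delta> v)) + X v) \<in> V)"
      by (rule invariant_subspace_split[OF G(1,2,5)])
    interpret \<gamma>: fin_projector \<gamma> by (rule \<gamma>(1))
    interpret \<delta>: max_trivial_spectrum \<delta> "(\<lambda>M v. \<delta> (M (\<delta> v))) ` V" by (rule \<gamma>(8))
    have fG: "fds G" using \<gamma>.fds_P \<gamma>(2) by simp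
    have "dim G \<noteq> 0" using dim_zero_iff[OF fG] G(3) by blast
    moreover have "dim G \<noteq> n" using fds_dim_eq[OF fds_P G(1,2)] G(4) less.prems(2) by auto
    ultimately have lt: "dim (range \<gamma>) < n" "dim (range \<delta>) < n"
      using \<gamma>(2,6) less.prems(2) fds_subset(2)[OF fds_P G(1,2)] by auto
    obtain as s1 r1 where 1: "\<forall>m\<in>set as. 0 < m" "dim (range \<gamma>) = sum_list as"
      "\<forall>j<dim (range \<gamma>). \<gamma> (s1 j) = s1 j" "\<forall>i. linear (r1 i)"
      "op_mats (dim (range \<gamma>)) s1 r1 ((\<lambda>M v. M (\<gamma> v)) ` V) = translate_mat (1\<^sub>m (dim (range \<gamma>))) (skew_join as)"
      using less.IH[OF lt(1) \<gamma>(7) refl] by blast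
    obtain bs s2 r2 where 2: "\<forall>m\<in>set bs. 0 < m" "dim (range \<delta>) = sum_list bs"
      "\<forall>j<dim (range \<delta>). \<delta> (s2 j) = s2 j" "\<forall>i. linear (r2 i)"
      "op_mats (dim (range \<delta>)) s2 r2 ((\<lambda>M v. \<delta> (M (\<delta> v))) ` V) = translate_mat (1\<^sub>m (dim (range \<delta>))) (skew_join bs)"
      using less.IH[OF lt(2) \<gamma>(8) refl] by blast
    define s where "s = (\<lambda>j. if j < dim (range \<gamma>) then s1 j else s2 (j - dim (range \<gamma>)))"
    define r where "r = (\<lambda>i v. if i < dim (range \<gamma>) then r1 i (\<gamma> v) else r2 (i - dim (range \<gamma>)) (\<delta> v))"
    have inv: "\<forall>M\<in>V. \<forall>v. \<gamma> (M (\<gamma> v)) = M (\<gamma> v)"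
      using G(5) \<gamma>.in_range_iff unfolding \<gamma>(2)[symmetric] by blast
    have nn: "n = dim (range \<gamma>) + dim (range \<delta>)" using \<gamma>(6) less.prems(2) by simp
    have "op_mats n s r V = translate_mat (1\<^sub>m n) (skew_join (as @ bs))"
      unfolding nn s_def r_def
      by (rule op_mats_join[OF trivial_spectrum_axioms \<gamma>(1) \<delta>.fin_projector_axioms \<gamma>(4,5) inv \<gamma>(9)
            1(3,4,5,2) 2(3,4,5,2)])
    moreover have "\<forall>m\<in>set (as @ bs). 0 < m" using 1(1) 2(1) by auto
    moreover have "n = sum_list (as @ bs)" using nn 1(2) 2(2) by simp
    moreover have "P (s j) = s j" if "j < n" for j
    proof (cases "j < dim (range \<gamma>)")
      case True
      then have "\<gamma> (s j) = s j" using 1(3) by (simp add: s_def)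
      then show ?thesis using \<gamma>(3,5) by (metis add.right_neutral)
    next
      case False
      then have "\<delta> (s j) = s j" using 2(3) that nn by (simp add: s_def)
      then show ?thesis using \<gamma>(3,4) by (metis add.left_neutral)
    qed
    moreover have "linear (r i)" for i
      unfolding r_def using 1(4) 2(4)
      by (auto intro!: linearI simp: linear_add[OF \<gamma>.lin_P] linear_scale[OF \<gamma>.lin_P]
          linear_add[OF \<delta>.lin_P] linear_scale[OF \<delta>.lin_P] linear_add linear_scale)
    ultimately show ?thesis by blast
  qed
qed

section \<open>Existence\<close>

definition trunc :: "nat \<Rightarrow> (nat \<Rightarrow> real) \<Rightarrow> nat \<Rightarrow> real" where
  "trunc n f = (\<lambda>i. if i < n then f i else 0)"

definition mat_op :: "nat \<Rightarrow> real mat \<Rightarrow> (nat \<Rightarrow> real) \<Rightarrow> nat \<Rightarrow> real" where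
  "mat_op n A f = (\<lambda>i. if i < n then \<Sum>j<n. A $$ (i, j) * f j else 0)"

lemma range_trunc: "range (trunc n) = {f. \<forall>i\<ge>n. f i = 0}"
proof
  show "{f. \<forall>i\<ge>n. f i = 0} \<subseteq> range (trunc n)"
  proof
    fix f :: "nat \<Rightarrow> real" assume "f \<in> {f. \<forall>i\<ge>n. f i = 0}"
    then have "f = trunc n f" by (auto simp: trunc_def)
    then show "f \<in> range (trunc n)" by (metis rangeI)
  qed
qed (auto simp: trunc_def)

lemma fin_projector_trunc: "fin_projector (trunc n)"
proof (rule fin_projector.intro)
  show "linear (trunc n)" by (rule linearI) (auto simp: trunc_def fun_eq_iff)
  show "trunc n (trunc n f) = trunc n f" for f by (simp add: trunc_def fun_eq_iff)
  show "fds (range (trunc n))" unfolding range_trunc by (rule dim_finitely_supported(1))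
qed

lemma dim_range_trunc: "dim (range (trunc n)) = n"
  unfolding range_trunc by (rule dim_finitely_supported(2))

lemma linear_mat_op: "linear (mat_op n A)"
  by (rule linearI) (auto simp: mat_op_def fun_eq_iff algebra_simps sum.distrib sum_distrib_left)

lemma trunc_mat_op: "trunc n (mat_op n A f) = mat_op n A f" "mat_op n A (trunc n f) = mat_op n A f"
  by (auto simp: trunc_def mat_op_def fun_eq_iff)

lemma mat_op_add:
  assumes "A \<in> carrier_mat n n" "B \<in> carrier_mat n n"
  shows "mat_op n (A + B) = mat_op n A + mat_op n B"
  using assms by (auto simp: mat_op_def fun_eq_iff algebra_simps sum.distrib)

lemma mat_op_smult:
  assumes "A \<in> carrier_mat n n"
  shows "mat_op n (c \<cdot>\<^sub>m A) = c *\<^sub>R mat_op n A"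
  using assms by (auto simp: mat_op_def fun_eq_iff sum_distrib_left mult.assoc)

lemma mat_op_zero: "mat_op n (0\<^sub>m n n) = 0"
  by (auto simp: mat_op_def fun_eq_iff)

lemma mat_op_one: "mat_op n (1\<^sub>m n) f = trunc n f"
proof
  fix i
  have "(\<Sum>j<n. 1\<^sub>m n $$ (i, j) * f j) = (\<Sum>j<n. if j = i then f i else 0)" if "i < n"
    using that by (intro sum.cong) auto
  then show "mat_op n (1\<^sub>m n) f i = trunc n f i" by (simp add: mat_op_def trunc_def)
qed

lemma mat_mult_entry:
  assumes "A \<in> carrier_mat n n" "B \<in> carrier_mat n n" "i < n" "j < n"
  shows "(A * B) $$ (i, j) = (\<Sum>k<n. A $$ (i, k) * B $$ (k, j))"
  using assms by (auto simp: scalar_prod_def atLeast0LessThan intro!: sum.cong)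

lemma mat_op_mult:
  assumes "A \<in> carrier_mat n n" "B \<in> carrier_mat n n"
  shows "mat_op n (A * B) f = mat_op n A (mat_op n B f)"
proof
  fix i
  show "mat_op n (A * B) f i = mat_op n A (mat_op n B f) i"
  proof (cases "i < n")
    case True
    have "mat_op n (A * B) f i = (\<Sum>j<n. (\<Sum>k<n. A $$ (i, k) * B $$ (k, j)) * f j)"
      using True by (simp add: mat_op_def mat_mult_entry[OF assms])
    also have "\<dots> = (\<Sum>k<n. A $$ (i, k) * (\<Sum>j<n. B $$ (k, j) * f j))"
      unfolding sum_distrib_right sum_distrib_left by (subst sum.swap) (simp add: mult.assoc)
    also have "\<dots> = mat_op n A (mat_op n B f) i" using True by (simp add: mat_op_def)
    finally show ?thesis .
  qed (simp add: mat_op_def)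
qed

lemma mat_op_unit: "j < n \<Longrightarrow> i < n \<Longrightarrow> mat_op n A (\<lambda>k. if k = j then 1 else 0) i = A $$ (i, j)"
proof -
  assume ij: "j < n" "i < n"
  have "(\<Sum>k<n. A $$ (i, k) * (if k = j then 1 else 0)) = (\<Sum>k<n. if k = j then A $$ (i, j) else 0)"
    by (intro sum.cong) auto
  then show ?thesis using ij by (simp add: mat_op_def)
qed

lemma mat_op_inj:
  assumes "A \<in> carrier_mat n n" "B \<in> carrier_mat n n" "mat_op n A = mat_op n B"
  shows "A = B"
proof (rule eq_matI)
  fix i j assume "i < dim_row B" "j < dim_col B"
  then show "A $$ (i, j) = B $$ (i, j)" using assms mat_op_unit[of j n i A] mat_op_unit[of j n i B] by auto
qed (use assms in auto)

lemma GL_inverse: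
  assumes "A \<in> GL n"
  obtains B where "B \<in> carrier_mat n n" "A * B = 1\<^sub>m n" "B * A = 1\<^sub>m n"
proof -
  have A: "A \<in> carrier_mat n n" using assms by (simp add: GL_def)
  obtain B where B: "A * B = 1\<^sub>m n" "B * A = 1\<^sub>m (dim_row B)"
    using assms A unfolding GL_def invertible_mat_def inverts_mat_def by auto
  have "dim_col B = n" using arg_cong[OF B(1), of dim_col] by simp
  moreover have "dim_row B = n" using arg_cong[OF B(2), of dim_col] A by simp
  ultimately show ?thesis using that[of B] B by auto
qed

text \<open>Allows the invertibility of factors to be read off from a product of
  determinants.\<close>

lemma GL_det: "A \<in> GL n \<longleftrightarrow> A \<in> carrier_mat n n \<and> det A \<noteq> 0"
proof
  assume A: "A \<in> GL n"
  then obtain B where B: "B \<in> carrier_mat n n" "A * B = 1\<^sub>m n" "B * A = 1\<^sub>m n" by (rule GL_inverse)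
  have Ac: "A \<in> carrier_mat n n" using A by (simp add: GL_def)
  have "det A * det B = 1" using det_mult[OF Ac B(1)] B(2) by simp
  then show "A \<in> carrier_mat n n \<and> det A \<noteq> 0" using Ac by auto
next
  assume A: "A \<in> carrier_mat n n \<and> det A \<noteq> 0"
  then have "A \<in> Units (ring_mat TYPE(real) n ())" using det_non_zero_imp_unit[of A n] by simp
  then obtain B where "B \<in> carrier_mat n n" "A * B = 1\<^sub>m n" "B * A = 1\<^sub>m n"
    unfolding Units_def by (auto simp: ring_mat_simps)
  then show "A \<in> GL n" using A unfolding GL_def invertible_mat_def inverts_mat_def by auto
qed

lemma subspace_matD:
  assumes "VectorSpace.subspace class_ring W (module_mat TYPE(real) n n)"
  shows "W \<subseteq> carrier_mat n n" "0\<^sub>m n n \<in> W" "A \<in> W \<Longrightarrow> B \<in> W \<Longrightarrow> A + B \<in> W" "A \<in> W \<Longrightarrow> c \<cdot>\<^sub>m A \<in> W"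
proof -
  interpret vectorspace class_ring "module_mat TYPE(real) n n" by (rule matrix_vs)
  have sub: "submodule class_ring W (module_mat TYPE(real) n n)"
    using assms by (rule VectorSpace.subspace.submod)
  then show "W \<subseteq> carrier_mat n n" "0\<^sub>m n n \<in> W" "A \<in> W \<Longrightarrow> B \<in> W \<Longrightarrow> A + B \<in> W" "A \<in> W \<Longrightarrow> c \<cdot>\<^sub>m A \<in> W"
    unfolding submodule_def by (auto simp: module_mat_simps class_ring_simps)
qed

text \<open>The dimension on the left is the least size of a finite spanning set, and preimages of a
  basis of the image of \<open>F\<close> span \<open>W\<close>. Together with
  \<open>trivial_spectrum_dim_bound\<close> this shows that the space of operators attains the
  bound.\<close>

lemma subspace_dim_le:
  fixes F :: "real mat \<Rightarrow> 'b::real_vector"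
  assumes W: "VectorSpace.subspace class_ring W (module_mat TYPE(real) n n)"
    and F0: "F (0\<^sub>m n n) = 0"
    and Fadd: "\<And>A B. A \<in> W \<Longrightarrow> B \<in> W \<Longrightarrow> F (A + B) = F A + F B"
    and Fsc: "\<And>A c. A \<in> W \<Longrightarrow> F (c \<cdot>\<^sub>m A) = c *\<^sub>R F A"
    and Finj: "inj_on F W" and fds: "fds (F ` W)"
  shows "vectorspace.dim class_ring ((module_mat TYPE(real) n n)\<lparr>carrier := W\<rparr>) \<le> dim (F ` W)"
proof -
  let ?M = "module_mat TYPE(real) n n"
  let ?N = "?M\<lparr>carrier := W\<rparr>"
  note Ws = subspace_matD[OF W]
  interpret M: vectorspace class_ring ?M by (rule matrix_vs)
  interpret N: vectorspace class_ring ?N by (rule M.subspace_is_vs[OF W])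
  obtain B where B: "finite B" "span B = F ` W" "card B = dim (F ` W)"
    using fds_basis[OF fds] by metis
  have "B \<subseteq> F ` W" using B(2) span_superset[of B] by simp
  define C where "C = inv_into W F ` B"
  have CW: "C \<subseteq> W" unfolding C_def using \<open>B \<subseteq> F ` W\<close> by (auto intro: inv_into_into)
  have finC: "finite C" unfolding C_def using B(1) by simp
  have FC: "F ` C = B" unfolding C_def using \<open>B \<subseteq> F ` W\<close>
    by (metis image_inv_into_cancel)
  have cardC: "card C \<le> dim (F ` W)" unfolding C_def B(3)[symmetric] using B(1) by (rule card_image_le)
  have fin_sum: "N.lincomb a D \<in> W \<and> F (N.lincomb a D) = (\<Sum>c\<in>D. a c *\<^sub>R F c)"
    if "finite D" "D \<subseteq> W" for a D
    using that
  proof (induction D)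
    case empty
    then show ?case using Ws(2) F0 by (simp add: N.lincomb_def module_mat_simps)
  next
    case (insert c D)
    have cW: "c \<in> W" "D \<subseteq> W" using insert.prems by auto
    have "N.lincomb a (insert c D) = a c \<cdot>\<^sub>m c + N.lincomb a D"
      unfolding N.lincomb_def
      using insert.hyps cW Ws(4)
      by (subst N.finsum_insert) (auto simp: module_mat_simps)
    then show ?case using insert.IH[OF cW(2)] insert.hyps Ws(3,4) cW Fadd Fsc by simp
  qed
  have "N.span C = W"
  proof
    show "N.span C \<subseteq> W"
    proof
      fix X assume "X \<in> N.span C"
      then obtain a A where "X = N.lincomb a A" "finite A" "A \<subseteq> C" unfolding N.span_def by blast
      then show "X \<in> W" using fin_sum[of A a] CW by auto
    qed
    show "W \<subseteq> N.span C"
    proof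
      fix X assume X: "X \<in> W"
      then have "F X \<in> span B" using B(2) by simp
      then obtain u where u: "F X = (\<Sum>b\<in>B. u b *\<^sub>R b)"
        unfolding real_vector.span_finite[OF B(1)] by (rule rangeE)
      have "inj_on F C" using Finj CW inj_on_subset by blast
      then have "(\<Sum>b\<in>B. u b *\<^sub>R b) = (\<Sum>c\<in>C. u (F c) *\<^sub>R F c)"
        unfolding FC[symmetric] by (simp add: sum.reindex)
      then have "F X = F (N.lincomb (\<lambda>c. u (F c)) C)" using fin_sum[OF finC CW, of "\<lambda>c. u (F c)"] u by simp
      then have "X = N.lincomb (\<lambda>c. u (F c)) C"
        using inj_onD[OF Finj _ X] fin_sum[OF finC CW, of "\<lambda>c. u (F c)"] by blast
      moreover have "(\<lambda>c. u (F c)) \<in> C \<rightarrow> carrier class_ring" by (simp add: class_ring_simps)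
      ultimately show "X \<in> N.span C" unfolding N.span_def using finC by blast
    qed
  qed
  then have "\<exists>A. finite A \<and> card A = card C \<and> A \<subseteq> carrier ?N \<and> N.span A = carrier ?N"
    using finC CW by auto
  then have "N.dim \<le> card C" unfolding N.dim_def by (rule Least_le)
  then show ?thesis using cardC by simp
qed

lemma functional_expand:
  fixes r :: "(nat \<Rightarrow> real) \<Rightarrow> real"
  assumes "linear r" "trunc n f = f"
  shows "r f = (\<Sum>k<n. r (\<lambda>i. if i = k then 1 else 0) * f k)"
proof -
  have *: "f i = (\<Sum>k<n. f k * (if i = k then 1 else 0))" for i
  proof -
    have "(\<Sum>k<n. f k * (if i = k then 1 else 0)) = (\<Sum>k<n. if k = i then f i else 0)"
      by (intro sum.cong) auto
    then show ?thesis using fun_cong[OF assms(2), of i] by (simp add: trunc_def split: if_splits)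
  qed
  have "f = (\<Sum>k<n. f k *\<^sub>R (\<lambda>i. if i = k then 1 else 0))"
    by (rule ext) (simp only: sum_fun_apply scaleR_fun_apply real_scaleR_def, rule *)
  then have "r f = r (\<Sum>k<n. f k *\<^sub>R (\<lambda>i. if i = k then 1 else 0))" by (rule arg_cong)
  also have "\<dots> = (\<Sum>k<n. f k * r (\<lambda>i. if i = k then 1 else 0))"
    by (simp add: linear_sum[OF assms(1)] linear_scale[OF assms(1)])
  finally show ?thesis by (simp add: mult.commute)
qed

lemma mult_col_mat:
  assumes "X \<in> carrier_mat n n" "k < n" "j < n"
  shows "(X * mat n n (\<lambda>(k, j). s j k)) $$ (k, j) = mat_op n X (s j) k"
  using assms by (subst mat_mult_entry[of _ n]) (simp_all add: mat_op_def)

text \<open>With \<open>R\<close> the inverse of the base point \<open>P\<close>, the operators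
  \<open>R A\<close> have trivial spectrum: \<open>R A v = v\<close> means
  \<open>(P - A) v = 0\<close>, and \<open>P - A\<close> is an invertible element of
  \<open>V\<close>. The vectors \<open>s\<close> become the columns of \<open>Sm\<close> and the
  functionals \<open>r\<close> the rows of \<open>Rm\<close>.\<close>

lemma normal_form_exists:
  assumes aff: "affine_subspace_mat n V" and GL: "V \<subseteq> GL n" and dimV: "affine_dim_mat n V = n choose 2"
  shows "\<exists>ns. (\<forall>m \<in> set ns. 0 < m) \<and> n = sum_list ns \<and>
           equiv_mats n V (translate_mat (1\<^sub>m n) (skew_join ns))"
proof -
  obtain P W where P: "P \<in> carrier_mat n n" and W: "VectorSpace.subspace class_ring W (module_mat TYPE(real) n n)"
    and V: "V = translate_mat P W" using aff unfolding affine_subspace_mat_def by blast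
  note Ws = subspace_matD[OF W]
  have dW: "vectorspace.dim class_ring ((module_mat TYPE(real) n n)\<lparr>carrier := W\<rparr>) = n choose 2"
    using dimV direction_translate_mat[OF P W] unfolding affine_dim_mat_def V by simp
  have PV: "P + A \<in> V" if "A \<in> W" for A using that unfolding V translate_mat_def by blast
  have "P + 0\<^sub>m n n \<in> V" using PV Ws(2) by blast
  then have "P \<in> GL n" using GL P by auto
  then obtain R where R: "R \<in> carrier_mat n n" "P * R = 1\<^sub>m n" "R * P = 1\<^sub>m n" by (rule GL_inverse)
  define F where "F A = mat_op n (R * A)" for A
  have Wc: "A \<in> carrier_mat n n" if "A \<in> W" for A using that Ws(1) by blast
  have RWc: "R * A \<in> carrier_mat n n" if "A \<in> W" for A using R(1) Wc[OF that] by simp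
  have F0: "F (0\<^sub>m n n) = 0" using R(1) by (simp add: F_def mat_op_zero)
  have Fadd: "F (A + B) = F A + F B" if "A \<in> W" "B \<in> W" for A B
    using mult_add_distrib_mat[OF R(1) Wc[OF that(1)] Wc[OF that(2)]] RWc that by (simp add: F_def mat_op_add)
  have Fsc: "F (c \<cdot>\<^sub>m A) = c *\<^sub>R F A" if "A \<in> W" for c A
    using mult_smult_distrib[OF R(1) Wc[OF that]] RWc[OF that] by (simp add: F_def mat_op_smult)
  have P_R: "mat_op n P (mat_op n R f) = trunc n f" for f
    using mat_op_mult[OF P R(1)] R(2) by (simp add: mat_op_one)
  have Finj: "inj_on F W"
  proof (rule inj_onI)
    fix A B assume AB: "A \<in> W" "B \<in> W" "F A = F B"
    have "mat_op n A f = mat_op n B f" for f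
    proof -
      have eq: "mat_op n R (mat_op n A f) = mat_op n R (mat_op n B f)"
        using fun_cong[OF AB(3), of f] mat_op_mult[OF R(1) Wc] AB by (simp add: F_def)
      have "mat_op n A f = mat_op n P (mat_op n R (mat_op n A f))" by (simp only: P_R trunc_mat_op)
      also have "\<dots> = mat_op n B f" by (simp only: eq P_R trunc_mat_op)
      finally show ?thesis .
    qed
    then show "A = B" using mat_op_inj[OF Wc Wc] AB by (simp add: fun_eq_iff)
  qed
  have ts: "trivial_spectrum (trunc n) (F ` W)"
  proof (intro trivial_spectrum.intro trivial_spectrum_axioms.intro fin_projector_trunc)
    show "lin_subspace (F ` W)"
    proof (rule lin_subspaceI)
      show "0 \<in> F ` W" using F0 Ws(2) by (metis imageI)
      show "x + y \<in> F ` W" if "x \<in> F ` W" "y \<in> F ` W" for x y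
      proof -
        from that obtain A B where "A \<in> W" "B \<in> W" "x = F A" "y = F B" by blast
        then show ?thesis using Fadd Ws(3) by (intro image_eqI[of _ _ "A + B"]) simp_all
      qed
      show "c *\<^sub>R x \<in> F ` W" if "x \<in> F ` W" for c x
      proof -
        from that obtain A where "A \<in> W" "x = F A" by blast
        then show ?thesis using Fsc Ws(4) by (intro image_eqI[of _ _ "c \<cdot>\<^sub>m A"]) simp_all
      qed
    qed
    fix M assume "M \<in> F ` W"
    then obtain A where A: "A \<in> W" "M = mat_op n (R * A)" unfolding F_def by blast
    show "linear M" unfolding A(2) by (rule linear_mat_op)
    show "trunc n (M f) = M f" "M (trunc n f) = M f" for f unfolding A(2) by (rule trunc_mat_op)+
    fix v assume v: "M v = v"
    have tv: "trunc n v = v" using trunc_mat_op(1)[of n "R * A" v] v A(2) by simp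
    have "mat_op n P v = mat_op n P (mat_op n R (mat_op n A v))"
      using v mat_op_mult[OF R(1) Wc[OF A(1)], of v] A(2) by simp
    then have Pv: "mat_op n P v = mat_op n A v" by (simp add: P_R trunc_mat_op)
    define X where "X = P + (-1) \<cdot>\<^sub>m A"
    have "X \<in> GL n" using PV[OF Ws(4)[OF A(1)]] GL unfolding X_def by blast
    then obtain Y where Y: "Y \<in> carrier_mat n n" "Y * X = 1\<^sub>m n" using GL_inverse by metis
    have Xc: "X \<in> carrier_mat n n" using P Wc[OF A(1)] by (simp add: X_def)
    have "mat_op n X v = 0"
      using Pv P Wc[OF A(1)] by (simp add: X_def mat_op_add mat_op_smult)
    then have "mat_op n (Y * X) v = 0"
      using mat_op_mult[OF Y(1) Xc] linear_0[OF linear_mat_op] by simp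
    then show "v = 0" using Y(2) tv by (simp add: mat_op_one)
  qed
  have bound: "fds (F ` W)" "dim (F ` W) \<le> n choose 2"
    using trivial_spectrum_dim_bound[OF ts dim_range_trunc] by auto
  have "n choose 2 \<le> dim (F ` W)"
    using subspace_dim_le[OF W F0 Fadd Fsc Finj bound(1)] dW by simp
  then have "max_trivial_spectrum (trunc n) (F ` W)"
    using ts bound(2) by (intro max_trivial_spectrum.intro max_trivial_spectrum_axioms.intro)
      (simp_all add: dim_range_trunc)
  then obtain ns s r where ns: "\<forall>m\<in>set ns. 0 < m" "n = sum_list ns"
    and s: "\<forall>j<n. trunc n (s j) = s j" and r: "\<forall>i. linear (r i)"
    and om: "op_mats n s r (F ` W) = translate_mat (1\<^sub>m n) (skew_join ns)"
    using max_trivial_spectrum_mats[OF _ dim_range_trunc] by blast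
  define Rm where "Rm = mat n n (\<lambda>(i, k). r i (\<lambda>i. if i = k then 1 else 0))"
  define Sm where "Sm = mat n n (\<lambda>(k, j). s j k)"
  have Rmc: "Rm \<in> carrier_mat n n" and Smc: "Sm \<in> carrier_mat n n" by (simp_all add: Rm_def Sm_def)
  have ent: "mat n n (\<lambda>(i, j). r i (s j + F A (s j))) = (Rm * R) * (P + A) * Sm" if A: "A \<in> W" for A
  proof -
    note Ac = Wc[OF A]
    have RPA: "R * (P + A) = 1\<^sub>m n + R * A" using mult_add_distrib_mat[OF R(1) P Ac] R(3) by simp
    have "(Rm * R) * (P + A) * Sm = Rm * ((1\<^sub>m n + R * A) * Sm)"
      using Rmc Smc R(1) P Ac by (simp add: assoc_mult_mat[of _ n n _ n _ n] RPA[symmetric])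
    also have "\<dots> = mat n n (\<lambda>(i, j). r i (s j + F A (s j)))" (is "?L = ?R")
    proof (rule eq_matI)
      fix i j assume "i < dim_row ?R" "j < dim_col ?R"
      then have ij: "i < n" "j < n" by simp_all
      have c1: "1\<^sub>m n + R * A \<in> carrier_mat n n" using RWc[OF A] by simp
      have col: "((1\<^sub>m n + R * A) * Sm) $$ (k, j) = (s j + F A (s j)) k" if k: "k < n" for k
        using mult_col_mat[OF c1 k ij(2), of s] RWc[OF A] s ij
        by (simp add: Sm_def mat_op_add mat_op_one F_def)
      have tr: "trunc n (s j + F A (s j)) = s j + F A (s j)"
        using s ij trunc_mat_op(1)[of n "R * A" "s j"] linear_add[OF fin_projector.lin_P[OF fin_projector_trunc]]
        by (simp add: F_def)
      have "?L $$ (i, j) = (\<Sum>k<n. Rm $$ (i, k) * ((1\<^sub>m n + R * A) * Sm) $$ (k, j))"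
        using mat_mult_entry[OF Rmc mult_carrier_mat[OF c1 Smc] ij] .
      also have "\<dots> = (\<Sum>k<n. r i (\<lambda>i. if i = k then 1 else 0) * (s j + F A (s j)) k)"
        using ij by (intro sum.cong refl) (simp add: col, simp add: Rm_def)
      also have "\<dots> = r i (s j + F A (s j))" using functional_expand[OF _ tr] r by simp
      finally show "?L $$ (i, j) = ?R $$ (i, j)" using ij by simp
    qed (use Rmc Smc in auto)
    finally show ?thesis by simp
  qed
  have eqset: "translate_mat (1\<^sub>m n) (skew_join ns) = {(Rm * R) * M * Sm |M. M \<in> V}"
  proof -
    have "op_mats n s r (F ` W) = (\<lambda>A. (Rm * R) * (P + A) * Sm) ` W"
      unfolding op_mats_def image_image by (rule image_cong[OF refl ent])
    also have "\<dots> = {(Rm * R) * M * Sm |M. M \<in> V}" unfolding V translate_mat_def by blast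
    finally show ?thesis using om by simp
  qed
  have "1\<^sub>m n \<in> {(Rm * R) * M * Sm |M. M \<in> V}"
    unfolding eqset[symmetric] using one_in_translate_skew_join[of ns] ns(2) by simp
  then obtain M where M: "M \<in> V" "1\<^sub>m n = (Rm * R) * M * Sm" by blast
  have Mc: "M \<in> carrier_mat n n" using M(1) GL by (auto simp: GL_def)
  have RRc: "Rm * R \<in> carrier_mat n n" using Rmc R(1) by simp
  \<comment> \<open>The identity matrix occurs as this product, so each factor has nonzero
    determinant.\<close>
  have "det ((Rm * R) * M * Sm) = det (Rm * R) * det M * det Sm"
    using RRc Mc Smc by (simp add: det_mult[of _ n])
  then have "det (Rm * R) * det M * det Sm = 1" using M(2) by (metis det_one)
  then have "Rm * R \<in> GL n" "Sm \<in> GL n" using RRc Smc by (auto simp: GL_det)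
  then show ?thesis using ns eqset unfolding equiv_mats_def by blast
qed

section \<open>Uniqueness\<close>

text \<open>Differences remove the translation: for an affine space this is its direction applied to
  \<open>f\<close>, and for a linear space it is the space itself applied to
  \<open>f\<close>.\<close>

definition orbit :: "nat \<Rightarrow> real mat set \<Rightarrow> (nat \<Rightarrow> real) \<Rightarrow> (nat \<Rightarrow> real) set" where
  "orbit n X f = {mat_op n A f - mat_op n B f |A B. A \<in> X \<and> B \<in> X}"

definition orbit_dims :: "nat \<Rightarrow> real mat set \<Rightarrow> nat set" where
  "orbit_dims n X = {dim (orbit n X f) |f. trunc n f = f \<and> f \<noteq> 0}"

lemma orbit_translate:
  assumes "X \<subseteq> carrier_mat n n" "P \<in> carrier_mat n n"
  shows "orbit n (translate_mat P X) f = orbit n X f"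
proof -
  have "mat_op n (P + A) f - mat_op n (P + B) f = mat_op n A f - mat_op n B f" if "A \<in> X" "B \<in> X" for A B
    using that assms by (simp add: mat_op_add subset_iff)
  then have "{mat_op n (P + A) f - mat_op n (P + B) f |A B. A \<in> X \<and> B \<in> X} = orbit n X f"
    unfolding orbit_def by (intro Collect_cong) (metis (no_types, lifting))
  moreover have "orbit n (translate_mat P X) f = {mat_op n (P + A) f - mat_op n (P + B) f |A B. A \<in> X \<and> B \<in> X}"
    unfolding orbit_def translate_mat_def by blast
  ultimately show ?thesis by simp
qed

text \<open>The orbit of the transformed space at \<open>f\<close> is the image under
  \<open>R\<close> of the orbit of \<open>V\<close> at \<open>S f\<close>. Here \<open>R\<close>
  preserves dimensions and \<open>S\<close> permutes the nonzero vectors.\<close>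

lemma orbit_dims_equiv:
  assumes aff: "affine_subspace_mat n V" and R: "R \<in> GL n" and S: "S \<in> GL n"
  shows "orbit_dims n {R * M * S |M. M \<in> V} = orbit_dims n V"
proof -
  obtain P W where P: "P \<in> carrier_mat n n" and W: "VectorSpace.subspace class_ring W (module_mat TYPE(real) n n)"
    and V: "V = translate_mat P W" using aff unfolding affine_subspace_mat_def by blast
  note Ws = subspace_matD[OF W]
  have Wc: "A \<in> carrier_mat n n" if "A \<in> W" for A using that Ws(1) by blast
  have Vc: "M \<in> carrier_mat n n" if "M \<in> V" for M using that P Ws(1) unfolding V translate_mat_def by auto
  have Rc: "R \<in> carrier_mat n n" and Sc: "S \<in> carrier_mat n n" using R S by (auto simp: GL_def)
  obtain R' where R': "R' \<in> carrier_mat n n" "R' * R = 1\<^sub>m n" using GL_inverse[OF R] by metis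
  obtain S' where S': "S' \<in> carrier_mat n n" "S * S' = 1\<^sub>m n" "S' * S = 1\<^sub>m n" using GL_inverse[OF S] by metis
  have fds_orbit: "fds (orbit n V f)" for f
  proof -
    have "orbit n W f = (\<lambda>A. mat_op n A f) ` W"
    proof
      show "orbit n W f \<subseteq> (\<lambda>A. mat_op n A f) ` W"
      proof
        fix v assume "v \<in> orbit n W f"
        then obtain A B where AB: "A \<in> W" "B \<in> W" "v = mat_op n A f - mat_op n B f"
          unfolding orbit_def by blast
        then have "v = mat_op n (A + (-1) \<cdot>\<^sub>m B) f" using Wc by (simp add: mat_op_add mat_op_smult)
        then show "v \<in> (\<lambda>A. mat_op n A f) ` W" using Ws(3)[OF AB(1) Ws(4)[OF AB(2)]] by blast
      qed
      show "(\<lambda>A. mat_op n A f) ` W \<subseteq> orbit n W f"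
      proof
        fix v assume "v \<in> (\<lambda>A. mat_op n A f) ` W"
        then obtain A where "A \<in> W" "v = mat_op n A f - mat_op n (0\<^sub>m n n) f" by (auto simp: mat_op_zero)
        then show "v \<in> orbit n W f" unfolding orbit_def using Ws(2) by blast
      qed
    qed
    moreover have "lin_subspace ((\<lambda>A. mat_op n A f) ` W)"
    proof (rule lin_subspaceI)
      show "0 \<in> (\<lambda>A. mat_op n A f) ` W" by (rule image_eqI[OF _ Ws(2)]) (simp add: mat_op_zero)
    next
      fix x y assume "x \<in> (\<lambda>A. mat_op n A f) ` W" "y \<in> (\<lambda>A. mat_op n A f) ` W"
      then obtain A B where "A \<in> W" "B \<in> W" "x = mat_op n A f" "y = mat_op n B f" by blast
      then show "x + y \<in> (\<lambda>A. mat_op n A f) ` W"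
        using Ws(3) Wc by (intro image_eqI[of _ _ "A + B"]) (simp_all add: mat_op_add)
    next
      fix c x assume "x \<in> (\<lambda>A. mat_op n A f) ` W"
      then obtain A where "A \<in> W" "x = mat_op n A f" by blast
      then show "c *\<^sub>R x \<in> (\<lambda>A. mat_op n A f) ` W"
        using Ws(4) Wc by (intro image_eqI[of _ _ "c \<cdot>\<^sub>m A"]) (simp_all add: mat_op_smult)
    qed
    moreover have "(\<lambda>A. mat_op n A f) ` W \<subseteq> range (trunc n)"
      using trunc_mat_op(1) by (metis (no_types, lifting) image_subsetI rangeI)
    ultimately have "fds (orbit n W f)"
      using fds_subset(1)[OF fin_projector.fds_P[OF fin_projector_trunc]] by simp
    then show ?thesis using orbit_translate[OF Ws(1) P] unfolding V by simp
  qed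
  have orb: "orbit n {R * M * S |M. M \<in> V} f = mat_op n R ` orbit n V (mat_op n S f)" for f
  proof -
    have *: "mat_op n (R * M * S) f - mat_op n (R * N * S) f =
        mat_op n R (mat_op n M (mat_op n S f) - mat_op n N (mat_op n S f))" if "M \<in> V" "N \<in> V" for M N
      using mat_op_mult[of "R * M" n S f] mat_op_mult[of "R * N" n S f] mat_op_mult[of R n _ "mat_op n S f"]
        Rc Sc Vc that by (simp add: linear_diff[OF linear_mat_op])
    show ?thesis
    proof
      show "orbit n {R * M * S |M. M \<in> V} f \<subseteq> mat_op n R ` orbit n V (mat_op n S f)"
        unfolding orbit_def using * by blast
      show "mat_op n R ` orbit n V (mat_op n S f) \<subseteq> orbit n {R * M * S |M. M \<in> V} f"
      proof
        fix v assume "v \<in> mat_op n R ` orbit n V (mat_op n S f)"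
        then obtain M N where MN: "M \<in> V" "N \<in> V"
            "v = mat_op n R (mat_op n M (mat_op n S f) - mat_op n N (mat_op n S f))"
          unfolding orbit_def by blast
        then have "v = mat_op n (R * M * S) f - mat_op n (R * N * S) f" using * by simp
        then show "v \<in> orbit n {R * M * S |M. M \<in> V} f" unfolding orbit_def using MN(1,2) by blast
      qed
    qed
  qed
  have R'R: "mat_op n R' (mat_op n R f) = trunc n f" for f
    using mat_op_mult[OF R'(1) Rc, of f] R'(2) by (simp add: mat_op_one)
  have SS': "mat_op n S (mat_op n S' f) = trunc n f" "mat_op n S' (mat_op n S f) = trunc n f" for f
    using mat_op_mult[OF Sc S'(1), of f] mat_op_mult[OF S'(1) Sc, of f] S'(2,3) by (simp_all add: mat_op_one)
  have dim_orb: "dim (orbit n {R * M * S |M. M \<in> V} f) = dim (orbit n V (mat_op n S f))" for f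
    unfolding orb
  proof (rule dim_image_inj[OF linear_mat_op fds_orbit])
    fix v assume v: "v \<in> orbit n V (mat_op n S f)" "mat_op n R v = 0"
    have "trunc n v = v"
      using v(1) linear_diff[OF fin_projector.lin_P[OF fin_projector_trunc]]
      unfolding orbit_def by (auto simp: trunc_mat_op)
    then show "v = 0" using R'R[of v] v(2) linear_0[OF linear_mat_op] by simp
  qed
  show ?thesis
  proof
    show "orbit_dims n {R * M * S |M. M \<in> V} \<subseteq> orbit_dims n V"
    proof
      fix d assume "d \<in> orbit_dims n {R * M * S |M. M \<in> V}"
      then obtain f where f: "trunc n f = f" "f \<noteq> 0" "d = dim (orbit n V (mat_op n S f))"
        unfolding orbit_dims_def using dim_orb by auto
      have "mat_op n S f \<noteq> 0" using SS'(2)[of f] f(1,2) linear_0[OF linear_mat_op] by metis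
      then show "d \<in> orbit_dims n V" unfolding orbit_dims_def using f(3) trunc_mat_op(1) by blast
    qed
    show "orbit_dims n V \<subseteq> orbit_dims n {R * M * S |M. M \<in> V}"
    proof
      fix d assume "d \<in> orbit_dims n V"
      then obtain f where f: "trunc n f = f" "f \<noteq> 0" "d = dim (orbit n V f)"
        unfolding orbit_dims_def by blast
      define g where "g = mat_op n S' f"
      have "mat_op n S g = f" using SS'(1)[of f] f(1) by (simp add: g_def)
      moreover from this have "g \<noteq> 0" using f(2) linear_0[OF linear_mat_op] by metis
      moreover have "trunc n g = g" by (simp add: g_def trunc_mat_op)
      moreover have "d = dim (orbit n {R * M * S |M. M \<in> V} g)"
        using dim_orb[of g] f(3) \<open>mat_op n S g = f\<close> by simp
      ultimately show "d \<in> orbit_dims n {R * M * S |M. M \<in> V}"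
        unfolding orbit_dims_def by blast
    qed
  qed
qed

section \<open>Orbits of a join of skew spaces\<close>

fun levels :: "nat list \<Rightarrow> nat set" where
  "levels [] = {}"
| "levels (m # ms) = insert (m - 1) ((+) m ` levels ms)"

text \<open>For positive entries the least level is the head minus one. Removing it and subtracting
  the head from the others leaves the levels of the tail.\<close>

lemma levels_inject:
  assumes "\<forall>m\<in>set ns. 0 < m" "\<forall>m\<in>set ns'. 0 < m" "levels ns = levels ns'"
  shows "ns = ns'"
  using assms
proof (induction ns arbitrary: ns')
  case Nil
  then show ?case by (cases ns') auto
next
  case (Cons m ms)
  then obtain m' ms' where ns': "ns' = m' # ms'" by (cases ns') auto
  have pos: "0 < m" "0 < m'" using Cons.prems ns' by auto
  have eq: "insert (m - 1) ((+) m ` levels ms) = insert (m' - 1) ((+) m' ` levels ms')"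
    using Cons.prems(3) ns' by simp
  have "m - 1 \<in> insert (m' - 1) ((+) m' ` levels ms')" "m' - 1 \<in> insert (m - 1) ((+) m ` levels ms)"
    using eq by blast+
  then have m: "m = m'" using pos by auto
  have "m - 1 \<notin> (+) m ` levels ms" "m - 1 \<notin> (+) m ` levels ms'" using pos by auto
  then have "(+) m ` levels ms = (+) m ` levels ms'"
    using eq m by (metis insert_ident)
  then have "levels ms = levels ms'" by (simp add: inj_image_eq_iff)
  then have "ms = ms'" using Cons.IH[of ms'] Cons.prems ns' by simp
  then show ?case using m ns' by simp
qed

lemma sum_lessThan_add: "(\<Sum>j<m + k. h j) = (\<Sum>j<m. h j) + (\<Sum>j<k. h (j + m))" for h :: "nat \<Rightarrow> real"
  by (induction k) (simp_all add: add.commute add.left_commute)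

lemma mat_op_four_block:
  assumes "A \<in> carrier_mat m m" "B \<in> carrier_mat m k" "C \<in> carrier_mat k k"
  shows "mat_op (m + k) (four_block_mat A B (0\<^sub>m k m) C) f =
    (\<lambda>i. if i < m then mat_op m A f i + (\<Sum>j<k. B $$ (i, j) * f (j + m)) else mat_op k C (\<lambda>i. f (i + m)) (i - m))"
  using assms by (auto simp: mat_op_def fun_eq_iff sum_lessThan_add)

text \<open>A vector supported in the first block is seen only by the skew block \<open>A\<close>,
  and \<open>A f\<close> is orthogonal to \<open>f\<close>. Conversely, an \<open>h\<close>
  orthogonal to \<open>f\<close> is the value at \<open>f\<close> of the skew matrix
  \<open>(h f^T - f h^T) / q\<close>, where \<open>q\<close> is the squared length of
  \<open>f\<close>.\<close>

lemma orbit_skew_join_lower: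
  assumes f: "trunc (m + sum_list ms) f = f" "(\<lambda>i. f (i + m)) = 0" "f \<noteq> 0"
  shows "orbit (m + sum_list ms) (skew_join (m # ms)) f = {h \<in> {h. \<forall>i\<ge>m. h i = 0}. (\<Sum>i<m. f i * h i) = 0}"
    and "(\<Sum>i<m. f i * f i) \<noteq> 0"
proof -
  let ?k = "sum_list ms"
  let ?S = "{h \<in> {h. \<forall>i\<ge>m. h i = 0}. (\<Sum>i<m. f i * h i) = 0}"
  have fm: "f i = 0" if "i \<ge> m" for i using fun_cong[OF f(2), of "i - m"] that by simp
  obtain i0 where "f i0 \<noteq> 0" using f(3) by force
  then have "i0 < m" "0 < f i0 * f i0" using fm by (metis not_le, metis not_real_square_gt_zero)
  then have "0 < (\<Sum>i<m. f i * f i)" by (intro sum_pos2[of _ i0]) auto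
  then show nz: "(\<Sum>i<m. f i * f i) \<noteq> 0" by simp
  have op: "mat_op (m + ?k) (four_block_mat A B (0\<^sub>m ?k m) C) f = mat_op m A f"
    if "A \<in> carrier_mat m m" "B \<in> carrier_mat m ?k" "C \<in> carrier_mat ?k ?k" for A B C
    using mat_op_four_block[OF that, of f] f(2) linear_0[OF linear_mat_op, of ?k C]
    by (auto simp: fun_eq_iff fm mat_op_def)
  have zero_sj: "0\<^sub>m ?k ?k \<in> skew_join ms" by (rule zero_in_skew_join)
  have mem: "four_block_mat A (0\<^sub>m m ?k) (0\<^sub>m ?k m) (0\<^sub>m ?k ?k) \<in> skew_join (m # ms)" if "A \<in> skew_mats m" for A
    using that zero_sj unfolding skew_join.simps join_mats_def by (metis (mono_tags, lifting) mem_Collect_eq zero_carrier_mat)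
  show "orbit (m + ?k) (skew_join (m # ms)) f = ?S"
  proof
    show "orbit (m + ?k) (skew_join (m # ms)) f \<subseteq> ?S"
    proof
      fix h assume "h \<in> orbit (m + ?k) (skew_join (m # ms)) f"
      then obtain Y Z where YZ: "Y \<in> skew_join (m # ms)" "Z \<in> skew_join (m # ms)"
          "h = mat_op (m + ?k) Y f - mat_op (m + ?k) Z f" unfolding orbit_def by blast
      have ex: "\<exists>A. A \<in> skew_mats m \<and> mat_op (m + ?k) Y f = mat_op m A f" if "Y \<in> skew_join (m # ms)" for Y
      proof -
        from that obtain A B C where ABC: "A \<in> skew_mats m" "B \<in> carrier_mat m ?k" "C \<in> skew_join ms"
            "Y = four_block_mat A B (0\<^sub>m ?k m) C" unfolding skew_join.simps join_mats_def by blast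
        moreover have "A \<in> carrier_mat m m" "C \<in> carrier_mat ?k ?k"
          using ABC(1,3) skew_join_carrier by (auto simp: skew_mats_def)
        ultimately show ?thesis using op by blast
      qed
      have quad: "(\<Sum>i<m. f i * mat_op m A f i) = 0" if A: "A \<in> skew_mats m" for A
      proof -
        let ?T = "\<Sum>i<m. \<Sum>j<m. f i * f j * A $$ (i, j)"
        have eqT: "(\<Sum>i<m. f i * mat_op m A f i) = ?T"
          by (simp add: mat_op_def sum_distrib_left mult.assoc mult.left_commute mult.commute)
        have "?T = (\<Sum>i<m. \<Sum>j<m. f j * f i * A $$ (j, i))" by (rule sum.swap)
        also have "\<dots> = (\<Sum>i<m. \<Sum>j<m. - (f i * f j * A $$ (i, j)))"
        proof (intro sum.cong refl)
          fix i j assume "i \<in> {..<m}" "j \<in> {..<m}"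
          then have "A $$ (j, i) = - A $$ (i, j)" using A unfolding skew_mats_iff by blast
          then show "f j * f i * A $$ (j, i) = - (f i * f j * A $$ (i, j))" by simp
        qed
        finally have "?T = - ?T" by (simp add: sum_negf)
        then show ?thesis using eqT by simp
      qed
      obtain A B where "A \<in> skew_mats m" "B \<in> skew_mats m" "h = mat_op m A f - mat_op m B f"
        using ex[OF YZ(1)] ex[OF YZ(2)] YZ(3) by auto
      then show "h \<in> ?S" using quad by (auto simp: right_diff_distrib sum_subtractf mat_op_def)
    qed
    show "?S \<subseteq> orbit (m + ?k) (skew_join (m # ms)) f"
    proof
      fix h assume h: "h \<in> ?S"
      define q where "q = (\<Sum>i<m. f i * f i)"
      define A where "A = mat m m (\<lambda>(i, j). (h i * f j - f i * h j) / q)"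
      have A: "A \<in> skew_mats m" unfolding skew_mats_iff A_def
        by (auto simp: minus_divide_left algebra_simps simp del: minus_divide_left[symmetric])
      have "mat_op m A f = h"
      proof
        fix i
        show "mat_op m A f i = h i"
        proof (cases "i < m")
          case True
          have "mat_op m A f i = (\<Sum>j<m. (h i * f j - f i * h j) / q * f j)"
            using True by (simp add: mat_op_def A_def)
          also have "\<dots> = (\<Sum>j<m. (h i / q) * (f j * f j) - (f i / q) * (f j * h j))"
            by (intro sum.cong refl) (simp add: field_simps diff_divide_distrib)
          also have "\<dots> = (h i / q) * q - (f i / q) * (\<Sum>j<m. f j * h j)"
            by (simp add: sum_subtractf sum_distrib_left q_def)
          also have "\<dots> = h i" using h nz by (simp add: q_def)
          finally show ?thesis .
        qed (use h in \<open>simp add: mat_op_def\<close>)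
      qed
      moreover have "A \<in> carrier_mat m m" by (simp add: A_def)
      moreover have z: "0\<^sub>m m m \<in> skew_mats m" by (simp add: skew_mats_iff)
      ultimately have "h = mat_op (m + ?k) (four_block_mat A (0\<^sub>m m ?k) (0\<^sub>m ?k m) (0\<^sub>m ?k ?k)) f -
          mat_op (m + ?k) (four_block_mat (0\<^sub>m m m) (0\<^sub>m m ?k) (0\<^sub>m ?k m) (0\<^sub>m ?k ?k)) f"
        by (simp add: op mat_op_zero)
      then show "h \<in> orbit (m + ?k) (skew_join (m # ms)) f"
        unfolding orbit_def using mem[OF A] mem[OF z] by blast
    qed
  qed
qed

text \<open>As the tail of \<open>f\<close> is nonzero, the arbitrary block \<open>B\<close> makes
  the first \<open>m\<close> coordinates free, while the others depend on the tail alone.\<close>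

lemma orbit_skew_join_upper:
  assumes nz: "(\<lambda>i. f (i + m)) \<noteq> 0" and f: "trunc (m + sum_list ms) f = f"
  shows "orbit (m + sum_list ms) (skew_join (m # ms)) f =
    {h. (\<lambda>i. h (i + m)) \<in> orbit (sum_list ms) (skew_join ms) (\<lambda>i. f (i + m))}"
proof -
  let ?k = "sum_list ms"
  let ?f2 = "\<lambda>i. f (i + m)"
  obtain j0 where j0: "f (j0 + m) \<noteq> 0" using nz by force
  have "j0 < ?k"
  proof (rule ccontr)
    assume "\<not> j0 < ?k"
    then show False using fun_cong[OF f, of "j0 + m"] j0 by (simp add: trunc_def)
  qed
  have cC: "C \<in> carrier_mat ?k ?k" if "C \<in> skew_join ms" for C using that skew_join_carrier by blast
  show ?thesis
  proof
    show "orbit (m + ?k) (skew_join (m # ms)) f \<subseteq> {h. (\<lambda>i. h (i + m)) \<in> orbit ?k (skew_join ms) ?f2}"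
    proof
      fix h assume "h \<in> orbit (m + ?k) (skew_join (m # ms)) f"
      then obtain Y Z where YZ: "Y \<in> skew_join (m # ms)" "Z \<in> skew_join (m # ms)"
          "h = mat_op (m + ?k) Y f - mat_op (m + ?k) Z f" unfolding orbit_def by blast
      have ex: "\<exists>C. C \<in> skew_join ms \<and> (\<lambda>i. mat_op (m + ?k) Y f (i + m)) = mat_op ?k C ?f2"
        if "Y \<in> skew_join (m # ms)" for Y
      proof -
        from that obtain A B C where ABC: "A \<in> skew_mats m" "B \<in> carrier_mat m ?k" "C \<in> skew_join ms"
            "Y = four_block_mat A B (0\<^sub>m ?k m) C" unfolding skew_join.simps join_mats_def by blast
        have "A \<in> carrier_mat m m" using ABC(1) by (simp add: skew_mats_def)
        then have "(\<lambda>i. mat_op (m + ?k) Y f (i + m)) = mat_op ?k C ?f2"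
          unfolding ABC(4) using ABC(2) cC[OF ABC(3)] by (simp add: mat_op_four_block)
        then show ?thesis using ABC(3) by blast
      qed
      obtain C D where CD: "C \<in> skew_join ms" "D \<in> skew_join ms"
        "(\<lambda>i. mat_op (m + ?k) Y f (i + m)) = mat_op ?k C ?f2"
        "(\<lambda>i. mat_op (m + ?k) Z f (i + m)) = mat_op ?k D ?f2"
        using ex[OF YZ(1)] ex[OF YZ(2)] by blast
      have "(\<lambda>i. h (i + m)) = mat_op ?k C ?f2 - mat_op ?k D ?f2"
        unfolding CD(3,4)[symmetric] YZ(3) by (simp add: fun_eq_iff)
      then show "h \<in> {h. (\<lambda>i. h (i + m)) \<in> orbit ?k (skew_join ms) ?f2}"
        unfolding orbit_def using CD(1,2) by blast
    qed
    show "{h. (\<lambda>i. h (i + m)) \<in> orbit ?k (skew_join ms) ?f2} \<subseteq> orbit (m + ?k) (skew_join (m # ms)) f"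
    proof
      fix h assume "h \<in> {h. (\<lambda>i. h (i + m)) \<in> orbit ?k (skew_join ms) ?f2}"
      then obtain C D where CD: "C \<in> skew_join ms" "D \<in> skew_join ms"
        "(\<lambda>i. h (i + m)) = mat_op ?k C ?f2 - mat_op ?k D ?f2" unfolding orbit_def by blast
      \<comment> \<open>Only the column \<open>j0\<close>, at which the tail of \<open>f\<close>
        does not vanish, is used to produce the first \<open>m\<close> entries of
        \<open>h\<close>.\<close>
      define B where "B = mat m ?k (\<lambda>(i, j). if j = j0 then h i / f (j0 + m) else 0)"
      have Bf: "(\<Sum>j<?k. B $$ (i, j) * f (j + m)) = h i" if "i < m" for i
      proof -
        have "(\<Sum>j<?k. B $$ (i, j) * f (j + m)) = (\<Sum>j<?k. if j = j0 then h i else 0)"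
          using that j0 by (intro sum.cong refl) (auto simp: B_def)
        then show ?thesis using \<open>j0 < ?k\<close> by simp
      qed
      have Bc: "B \<in> carrier_mat m ?k" by (simp add: B_def)
      have z: "0\<^sub>m m m \<in> skew_mats m" by (simp add: skew_mats_iff)
      define Y where "Y = four_block_mat (0\<^sub>m m m) B (0\<^sub>m ?k m) C"
      define Z where "Z = four_block_mat (0\<^sub>m m m) (0\<^sub>m m ?k) (0\<^sub>m ?k m) D"
      have "Y \<in> skew_join (m # ms)" "Z \<in> skew_join (m # ms)"
        unfolding Y_def Z_def skew_join.simps join_mats_def
        using z Bc CD(1,2) zero_carrier_mat[of m ?k] by blast+
      moreover have "h = mat_op (m + ?k) Y f - mat_op (m + ?k) Z f"
      proof
        fix i
        have "h i = mat_op ?k C ?f2 (i - m) - mat_op ?k D ?f2 (i - m)" if "\<not> i < m"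
          using fun_cong[OF CD(3), of "i - m"] that by simp
        then show "h i = (mat_op (m + ?k) Y f - mat_op (m + ?k) Z f) i"
          unfolding Y_def Z_def using Bc cC CD(1,2) Bf
          by (simp add: mat_op_four_block mat_op_zero)
      qed
      ultimately show "h \<in> orbit (m + ?k) (skew_join (m # ms)) f" unfolding orbit_def by blast
    qed
  qed
qed

text \<open>A nonzero \<open>f\<close> supported in the first block gives \<open>m - 1\<close>; any
  other \<open>f\<close> gives \<open>m\<close> plus the dimension for its tail. This is the
  recursion of \<open>levels\<close>. Finite dimension is carried along so that rank and nullity
  apply to the shift, whose kernel on the orbit consists of the \<open>m\<close> free
  coordinates.\<close>

lemma orbit_dims_skew_join:
  assumes "\<forall>m\<in>set ns. 0 < m"
  shows "(\<forall>f. trunc (sum_list ns) f = f \<longrightarrow> f \<noteq> 0 \<longrightarrow> fds (orbit (sum_list ns) (skew_join ns) f)) \<and>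
         orbit_dims (sum_list ns) (skew_join ns) = levels ns"
  using assms
proof (induction ns)
  case Nil
  have "f = 0" if "trunc 0 f = f" for f using that by (auto simp: trunc_def fun_eq_iff)
  then show ?case unfolding orbit_dims_def sum_list.Nil levels.simps by blast
next
  case (Cons m ms)
  let ?k = "sum_list ms"
  let ?sh = "\<lambda>(f::nat \<Rightarrow> real) i. f (i + m)"
  let ?O = "orbit (m + ?k) (skew_join (m # ms))"
  have IH1: "fds (orbit ?k (skew_join ms) f)" if "trunc ?k f = f" "f \<noteq> 0" for f
    using Cons.IH Cons.prems that by (metis list.set_intros(2))
  have IH2: "orbit_dims ?k (skew_join ms) = levels ms" using Cons by simp
  have m: "0 < m" using Cons.prems by simp
  have lin_sh: "linear ?sh" by (rule linearI) (auto simp: fun_eq_iff)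
  have low: "fds (?O f) \<and> dim (?O f) = m - 1" if f: "trunc (m + ?k) f = f" "?sh f = 0" "f \<noteq> 0" for f
  proof -
    let ?l = "\<lambda>h::nat \<Rightarrow> real. \<Sum>i<m. f i * h i"
    let ?Sm = "{h::nat \<Rightarrow> real. \<forall>i\<ge>m. h i = 0}"
    have lin: "linear ?l" by (rule linearI) (simp_all add: algebra_simps sum.distrib sum_distrib_left)
    note o = orbit_skew_join_lower[OF f]
    have "f i = 0" if "i \<ge> m" for i using fun_cong[OF f(2), of "i - m"] that by simp
    then have "f \<in> ?Sm" by simp
    then have "dim ?Sm = Suc (dim {h \<in> ?Sm. ?l h = 0})"
      using o(2) by (intro dim_functional_kernel[OF lin dim_finitely_supported(1)])
    moreover have "fds {h \<in> ?Sm. ?l h = 0}"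
      by (rule fds_subset(1)[OF dim_finitely_supported(1)[of m] lin_subspace_kernel[OF lin]])
         (auto simp: dim_finitely_supported(1) fds_lin_subspace)
    ultimately show ?thesis unfolding o(1) using dim_finitely_supported(2)[of m] by simp
  qed
  have trsh: "trunc ?k (?sh f) = ?sh f" if "trunc (m + ?k) f = f" for f
  proof
    fix i show "trunc ?k (?sh f) i = ?sh f i"
      using fun_cong[OF that, of "i + m"] by (simp add: trunc_def)
  qed
  have up: "fds (?O f) \<and> dim (?O f) = m + dim (orbit ?k (skew_join ms) (?sh f))"
    if f: "trunc (m + ?k) f = f" "?sh f \<noteq> 0" for f
  proof -
    let ?O2 = "orbit ?k (skew_join ms) (?sh f)"
    note o = orbit_skew_join_upper[OF f(2,1)]
    have f2: "fds ?O2" using IH1[OF trsh[OF f(1)] f(2)] .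
    have s2: "lin_subspace ?O2" using f2 by (rule fds_lin_subspace)
    have sO: "lin_subspace (?O f)" unfolding o
    proof (rule lin_subspaceI)
      show "0 \<in> {h. ?sh h \<in> ?O2}" using lin_subspace_0[OF s2] by (simp add: zero_fun_def)
      show "x + y \<in> {h. ?sh h \<in> ?O2}" if "x \<in> {h. ?sh h \<in> ?O2}" "y \<in> {h. ?sh h \<in> ?O2}" for x y
        using that lin_subspace_add[OF s2, of "?sh x" "?sh y"] by (simp add: plus_fun_def)
      show "c *\<^sub>R x \<in> {h. ?sh h \<in> ?O2}" if "x \<in> {h. ?sh h \<in> ?O2}" for c x
        using that lin_subspace_scale[OF s2, of "?sh x" c] by (simp add: scaleR_fun_def)
    qed
    have im: "?sh ` ?O f = ?O2"
    proof
      show "?O2 \<subseteq> ?sh ` ?O f"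
      proof
        fix h assume "h \<in> ?O2"
        then have "(\<lambda>i. h (i - m)) \<in> ?O f" unfolding o by simp
        then show "h \<in> ?sh ` ?O f" by (intro image_eqI[where x = "\<lambda>i. h (i - m)"]) simp_all
      qed
      show "?sh ` ?O f \<subseteq> ?O2" unfolding o by blast
    qed
    have ker: "{h \<in> ?O f. ?sh h = 0} = {h. \<forall>i\<ge>m. h i = 0}"
    proof
      show "{h \<in> ?O f. ?sh h = 0} \<subseteq> {h. \<forall>i\<ge>m. h i = 0}"
      proof safe
        fix h i assume "?sh h = 0" "m \<le> i"
        then show "h i = 0" using fun_cong[of "?sh h" 0 "i - m"] by simp
      qed
      show "{h. \<forall>i\<ge>m. h i = 0} \<subseteq> {h \<in> ?O f. ?sh h = 0}"
        using lin_subspace_0[OF s2] unfolding o by (auto simp: zero_fun_def)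
    qed
    show ?thesis
      using rank_nullity_gen[OF lin_sh sO] f2 dim_finitely_supported[of m] unfolding im ker by simp
  qed
  have "fds (?O f)" if "trunc (m + ?k) f = f" "f \<noteq> 0" for f using low up that by blast
  moreover have "orbit_dims (m + ?k) (skew_join (m # ms)) = insert (m - 1) ((+) m ` levels ms)"
  proof
    show "orbit_dims (m + ?k) (skew_join (m # ms)) \<subseteq> insert (m - 1) ((+) m ` levels ms)"
    proof
      fix d assume "d \<in> orbit_dims (m + ?k) (skew_join (m # ms))"
      then obtain f where f: "trunc (m + ?k) f = f" "f \<noteq> 0" "d = dim (?O f)" unfolding orbit_dims_def by blast
      show "d \<in> insert (m - 1) ((+) m ` levels ms)"
      proof (cases "?sh f = 0")
        case True
        then show ?thesis using low f by simp
      next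
        case False
        then have "dim (orbit ?k (skew_join ms) (?sh f)) \<in> levels ms"
          unfolding IH2[symmetric] orbit_dims_def using trsh[OF f(1)] by blast
        then show ?thesis using up[OF f(1) False] f(3) by simp
      qed
    qed
    show "insert (m - 1) ((+) m ` levels ms) \<subseteq> orbit_dims (m + ?k) (skew_join (m # ms))"
    proof
      fix d assume "d \<in> insert (m - 1) ((+) m ` levels ms)"
      then consider "d = m - 1" | e where "d = m + e" "e \<in> levels ms" by blast
      then show "d \<in> orbit_dims (m + ?k) (skew_join (m # ms))"
      proof cases
        case 1
        \<comment> \<open>The first unit vector, which lies in the first block because
          \<open>0 < m\<close>.\<close>
        define f :: "nat \<Rightarrow> real" where "f i = (if i = 0 then 1 else 0)" for i
        have f: "trunc (m + ?k) f = f" "?sh f = 0" "f \<noteq> 0"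
          using m by (auto simp: f_def trunc_def fun_eq_iff)
        have "d = dim (?O f)" using low[OF f] 1 by metis
        then show ?thesis unfolding orbit_dims_def using f(1,3) by blast
      next
        case 2
        then obtain g where g: "trunc ?k g = g" "g \<noteq> 0" "e = dim (orbit ?k (skew_join ms) g)"
          unfolding IH2[symmetric] orbit_dims_def by blast
        define f where "f i = (if i < m then 0 else g (i - m))" for i
        have sh: "?sh f = g" by (simp add: f_def)
        have "g i = 0" if "i \<ge> ?k" for i using fun_cong[OF g(1), of i] that by (simp add: trunc_def)
        then have tf: "trunc (m + ?k) f = f" by (auto simp: f_def trunc_def fun_eq_iff)
        have "f \<noteq> 0" using sh g(2) by (auto simp: fun_eq_iff) metis
        moreover have "d = dim (?O f)" using up[OF tf] g(2,3) 2(1) unfolding sh by metis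
        ultimately show ?thesis unfolding orbit_dims_def using tf by blast
      qed
    qed
  qed
  ultimately show ?case unfolding sum_list.Cons levels.simps by blast
qed

theorem corollary8:
  fixes n :: nat and V :: "real mat set"
  assumes "affine_subspace_mat n V"
    and "V \<subseteq> GL n"
    and "affine_dim_mat n V = n choose 2"
  shows "\<exists>!ns. (\<forall>m \<in> set ns. 0 < m) \<and> n = sum_list ns \<and>
           equiv_mats n V (translate_mat (1\<^sub>m n) (skew_join ns))"
proof (rule ex_ex1I)
  show "\<exists>ns. (\<forall>m \<in> set ns. 0 < m) \<and> n = sum_list ns \<and>
          equiv_mats n V (translate_mat (1\<^sub>m n) (skew_join ns))"
    using normal_form_exists[OF assms] .
next
  have levels: "levels ns = orbit_dims n V"
    if ns: "\<forall>m \<in> set ns. 0 < m" "n = sum_list ns" "equiv_mats n V (translate_mat (1\<^sub>m n) (skew_join ns))" for ns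
  proof -
    obtain R S where RS: "R \<in> GL n" "S \<in> GL n"
      "translate_mat (1\<^sub>m n) (skew_join ns) = {R * M * S |M. M \<in> V}"
      using ns(3) unfolding equiv_mats_def by blast
    have "orbit_dims n V = orbit_dims n (translate_mat (1\<^sub>m n) (skew_join ns))"
      unfolding RS(3) using orbit_dims_equiv[OF assms(1) RS(1,2)] by simp
    also have "\<dots> = orbit_dims n (skew_join ns)"
      using orbit_translate[OF skew_join_carrier one_carrier_mat, of ns]
      unfolding orbit_dims_def ns(2) by simp
    also have "\<dots> = levels ns" using orbit_dims_skew_join[OF ns(1)] ns(2) by simp
    finally show ?thesis by simp
  qed
  show "ns = ns'"
    if "(\<forall>m \<in> set ns. 0 < m) \<and> n = sum_list ns \<and> equiv_mats n V (translate_mat (1\<^sub>m n) (skew_join ns))"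
      "(\<forall>m \<in> set ns'. 0 < m) \<and> n = sum_list ns' \<and> equiv_mats n V (translate_mat (1\<^sub>m n) (skew_join ns'))"
    for ns ns'
    using levels_inject[of ns ns'] levels[of ns] levels[of ns'] that by metis
qed

end
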